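(* Let $\mathbb{K}$ be a field of characteristic zero, $\ell\ge 1$, $k\in\mathbb{Z}_{\ge 0}$, and let $G$ be a directed graph with vertex set $\{1,2,\dots,\ell+1\}$ and edge set $E_G$, where $(i,j)\in E_G$ denotes an arrow from $i$ to $j$. Put $\epsilon(i,j)=1$ if $(i,j)\in E_G$ and $\epsilon(i,j)=0$ otherwise. Let $\mathcal{A}_G$ be the affine arrangement in $\mathbb{K}^{\ell+1}$ consisting of the hyperplanes $$x_i-x_j=-k-\epsilon(i,j),\,-k,\,-(k-1),\,\dots,\,k,\,k+\epsilon(j,i)\qquad(1\le i<j\le \ell+1).$$ Suppose that for all triples of distinct vertices $i,j,h$ with $i,j<h$: (A1) if $(i,j)\in E_G$, then $(i,h)\in E_G$ or $(h,j)\in E_G$; (A2) if $(i,h)\in E_G$ and $(h,j)\in E_G$, then $(i,j)\in E_G$. Then the cone $c\mathcal{A}_G$ of $\mathcal{A}_G$ is a free arrangement. In particular (the case $k=0$), if $k=0$ and $G$ satisfies (A1) and (A2), then $c\mathcal{A}_G$ is free.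
   Context: The set of constants in the definition of $\mathcal{A}_G$ is taken without repetition: for $i<j$ it is $\{-k,\dots,k\}$, together with $-k-1$ if $(i,j)\in E_G$ and $k+1$ if $(j,i)\in E_G$. The cone $c\mathcal{A}$ of an affine arrangement $\mathcal{A}$ in $\mathbb{K}^{n}$ is the central arrangement in $\mathbb{K}^{n+1}$ (with extra coordinate $z$) consisting of the hyperplane at infinity $H_\infty=\{z=0\}$ and, for each hyperplane $\{\alpha=c\}\in\mathcal{A}$ ($\alpha$ linear, $c\in\mathbb{K}$), the hyperplane $\{\alpha=cz\}$. A central arrangement $\mathcal{B}$ in a vector space $W$ is free if $D(\mathcal{B})=\{\theta\in\mathrm{Der}_{\mathbb{K}}(S):\theta(\alpha_H)\in S\alpha_H\text{ for all }H\in\mathcal{B}\}$ is a free $S$-module, where $S=\mathrm{Sym}(W^* )$ and $\alpha_H$ is a linear form with kernel $H$. *)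

theory Defs
  imports
    "HOL-Library.FuncSet"
    "HOL-Library.Function_Algebras"
    "HOL-Library.Poly_Mapping"
    "Graph_Theory.Pair_Digraph"
begin

section \<open>Vectors, linear forms and hyperplanes\<close>

text \<open>The space of vectors with coordinates indexed by a finite set \<open>I\<close>. The space
  of dimension \<open>n\<close> is indexed by \<open>{1..n}\<close>; in its cone the extra coordinate \<open>z\<close> has
  index \<open>0\<close>, so that the index set becomes \<open>{0..n}\<close>.\<close>

definition coord_space :: "nat set \<Rightarrow> (nat \<Rightarrow> 'k::field) set"
  where "coord_space I = I \<rightarrow>\<^sub>E UNIV"

text \<open>A linear form is given by its coefficients; their values outside \<open>I\<close> are irrelevant.\<close>

definition lin_form :: "nat set \<Rightarrow> (nat \<Rightarrow> 'k) \<Rightarrow> (nat \<Rightarrow> 'k) \<Rightarrow> 'k::field"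
  where "lin_form I a x = (\<Sum>i\<in>I. a i * x i)"

definition level_set :: "nat set \<Rightarrow> (nat \<Rightarrow> 'k) \<Rightarrow> 'k \<Rightarrow> (nat \<Rightarrow> 'k::field) set"
  where "level_set I a c = {x \<in> coord_space I. lin_form I a x = c}"

definition central_arrangement :: "nat set \<Rightarrow> (nat \<Rightarrow> 'k::field) set set \<Rightarrow> bool"
  where "central_arrangement I B \<longleftrightarrow>
    finite B \<and> (\<forall>H\<in>B. \<exists>a. (\<exists>i\<in>I. a i \<noteq> 0) \<and> H = level_set I a 0)"

text \<open>The cone of an affine arrangement in the space of dimension \<open>n\<close>. The equation of a
  hyperplane is unique up to a nonzero factor, so each hyperplane contributes one
  hyperplane to the cone.\<close>

definition cone_arrangement :: "nat \<Rightarrow> (nat \<Rightarrow> 'k::field) set set \<Rightarrow> (nat \<Rightarrow> 'k) set set"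
  where "cone_arrangement n A =
    insert {x \<in> coord_space {0..n}. x 0 = 0}
      {{x \<in> coord_space {0..n}. lin_form {1..n} a x = c * x 0} | a c.
         (\<exists>i\<in>{1..n}. a i \<noteq> 0) \<and> level_set {1..n} a c \<in> A}"


section \<open>The polynomial ring and its derivations\<close>

text \<open>Monomials are exponent vectors. All polynomials in countably many variables form one
  type; \<open>mpoly_ring I\<close> is the symmetric algebra of the dual of \<open>coord_space I\<close>, i.e. the
  subring of polynomials in the variables with index in \<open>I\<close>.\<close>

type_synonym 'k mpoly = "(nat \<Rightarrow>\<^sub>0 nat) \<Rightarrow>\<^sub>0 'k"

definition mpoly_ring :: "nat set \<Rightarrow> 'k::field mpoly set"
  where "mpoly_ring I = {p. \<forall>m \<in> Poly_Mapping.keys p. Poly_Mapping.keys m \<subseteq> I}"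

definition const_poly :: "'k::field \<Rightarrow> 'k mpoly"
  where "const_poly c = Poly_Mapping.single 0 c"

definition var_poly :: "nat \<Rightarrow> 'k::field mpoly"
  where "var_poly i = Poly_Mapping.single (Poly_Mapping.single i 1) 1"

definition lin_poly :: "nat set \<Rightarrow> (nat \<Rightarrow> 'k::field) \<Rightarrow> 'k mpoly"
  where "lin_poly I a = (\<Sum>i\<in>I. const_poly (a i) * var_poly i)"

text \<open>Derivations over the base field, extended by \<open>0\<close> outside \<open>mpoly_ring I\<close> so that
  equal derivations are equal functions.\<close>

definition derivations :: "nat set \<Rightarrow> ('k::field mpoly \<Rightarrow> 'k mpoly) set"
  where "derivations I = {\<theta>.
    \<theta> \<in> mpoly_ring I \<rightarrow> mpoly_ring I \<and>
    (\<forall>f. f \<notin> mpoly_ring I \<longrightarrow> \<theta> f = 0) \<and>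
    (\<forall>f\<in>mpoly_ring I. \<forall>g\<in>mpoly_ring I. \<theta> (f + g) = \<theta> f + \<theta> g) \<and>
    (\<forall>c. \<forall>f\<in>mpoly_ring I. \<theta> (const_poly c * f) = const_poly c * \<theta> f) \<and>
    (\<forall>f\<in>mpoly_ring I. \<forall>g\<in>mpoly_ring I. \<theta> (f * g) = f * \<theta> g + g * \<theta> f)}"

text \<open>The form defining a hyperplane is unique up to a nonzero constant, so quantifying over
  all such forms imposes the same condition as choosing one.\<close>

definition log_derivations ::
    "nat set \<Rightarrow> (nat \<Rightarrow> 'k::field) set set \<Rightarrow> ('k mpoly \<Rightarrow> 'k mpoly) set"
  where "log_derivations I B = {\<theta> \<in> derivations I.
    \<forall>H\<in>B. \<forall>a. H = level_set I a 0 \<longrightarrow>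
      (\<exists>g\<in>mpoly_ring I. \<theta> (lin_poly I a) = g * lin_poly I a)}"


section \<open>Freeness\<close>

text \<open>\<open>R\<close> is meant to be a subring of the ambient ring and \<open>M\<close> closed under addition and
  under scaling by elements of \<open>R\<close>; then this says that the \<open>R\<close>-module \<open>M\<close> has a basis.
  (The locale \<open>module\<close> of the library is not used because its scalars range over a
  whole type.)\<close>

definition free_module_on ::
    "'r::comm_ring_1 set \<Rightarrow> ('r \<Rightarrow> 'm \<Rightarrow> 'm) \<Rightarrow> 'm::ab_group_add set \<Rightarrow> bool"
  where "free_module_on R scale M \<longleftrightarrow> (\<exists>B\<subseteq>M.
    (\<forall>m\<in>M. \<exists>T c. finite T \<and> T \<subseteq> B \<and> c \<in> T \<rightarrow> R \<and> m = (\<Sum>b\<in>T. scale (c b) b)) \<and>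
    (\<forall>T c. finite T \<and> T \<subseteq> B \<and> c \<in> T \<rightarrow> R \<and> (\<Sum>b\<in>T. scale (c b) b) = 0 \<longrightarrow>
       (\<forall>b\<in>T. c b = 0)))"

definition free_arrangement :: "nat set \<Rightarrow> (nat \<Rightarrow> 'k::field) set set \<Rightarrow> bool"
  where "free_arrangement I B \<longleftrightarrow> central_arrangement I B \<and>
    free_module_on (mpoly_ring I) (\<lambda>p \<theta> f. p * \<theta> f) (log_derivations I B)"


section \<open>The arrangement of a directed graph\<close>

definition arc_ind :: "nat pair_pre_digraph \<Rightarrow> nat \<Rightarrow> nat \<Rightarrow> int"
  where "arc_ind G i j = (if (i, j) \<in> parcs G then 1 else 0)"

definition graph_arrangement ::
    "nat \<Rightarrow> nat \<Rightarrow> nat pair_pre_digraph \<Rightarrow> (nat \<Rightarrow> 'k::field) set set"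
  where "graph_arrangement n k G =
    {{x \<in> coord_space {1..n}. x i - x j = of_int c} | i j c.
       1 \<le> i \<and> i < j \<and> j \<le> n \<and>
       c \<in> {- int k - arc_ind G i j} \<union> {- int k..int k} \<union> {int k + arc_ind G j i}}"

end

theory Submission
  imports Defs "HOL-Computational_Algebra.Polynomial" "HOL-Combinatorics.Transposition"
begin

text \<open>Derivations of the cone that are tangent to all its hyperplanes split as multiples of the Euler
  derivation plus derivations killing \<open>z\<close>; the latter are vectors \<open>f\<close> of polynomials such that
  \<open>x i - x j - c z\<close> divides \<open>f i - f j\<close> for every affine hyperplane \<open>x i - x j = c\<close>. Freeness of this
  module is shown by Terao's addition theorem, adding one hyperplane at a time, for the larger family
  of arrangements \<open>- (b i + a j + \<epsilon>(i, j)) \<le> x i - x j \<le> b j + a i + \<epsilon>(j, i)\<close> with integer vertex weights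
  such that \<open>a i + b i \<ge> 0\<close>. This family is closed under the restrictions that occur: if both \<open>G\<close>
  and \<open>G\<close> without the arc \<open>(p, q)\<close> satisfy (A1) and (A2), then restricting to the hyperplane which the arc
  \<open>(p, q)\<close> contributes identifies \<open>p\<close> and \<open>q\<close>, and the result is again in the family, with one
  vertex less and total weight increased by one. Every graph with (A1) and (A2) that has an arc has an
  arc that can be removed in this sense, so everything reduces to graphs without arcs. There a unit of the
  weight \<open>b v\<close> can be traded for the full star of arcs out of \<open>v\<close>, until all weights
  \<open>a i + b i\<close> vanish and the arrangement is a translate of the braid arrangement.\<close>

section \<open>Removable arcs\<close>

text \<open>Freeness of the smaller arrangement and of the restriction does not suffice for the
  addition step: the exponents of the restriction must be those of the smaller arrangement with one
  entry left out, and this entry must be the number of hyperplanes lost by restricting. So the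
  induction carries exact exponents, one per vertex. \<open>exponent\<close> is made such that
  adding the arc (p, q) raises only the entry at the larger of p and q, and leaving out this entry
  gives the exponents of the restriction. The weights are forced by merging p and q: on x q = x p +
  s z, the constants allowed at p and at q form two intervals without a gap between them, and the
  ends of their union can be written as weights of the merged vertex. Merging adds weight, and
  trading weight for a star adds arcs. Hence the nesting of the inductions: vertex set outermost,
  then total weight, then number of arcs. All divisibility is tested in the ring of all variables;
  coefficients are moved back to the variables of the cone only at the very end.\<close>

definition valid_digraph :: "nat set \<Rightarrow> (nat \<Rightarrow> nat \<Rightarrow> bool) \<Rightarrow> bool" where
  "valid_digraph V E \<longleftrightarrow> (\<forall>i\<in>V. \<forall>j\<in>V. \<forall>h\<in>V. i \<noteq> j \<and> i < h \<and> j < h \<longrightarrow>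
     (E i j \<longrightarrow> E i h \<or> E h j) \<and> (E i h \<and> E h j \<longrightarrow> E i j))"

text \<open>The clauses are what (A1) and (A2) for E without (p, q) demand beyond (A1) and (A2) for
  E: the first is (A2) with the lost conclusion E p q, the other two are (A1) with (p, q) as one of
  its alternatives.\<close>

definition removable_arc :: "nat set \<Rightarrow> (nat \<Rightarrow> nat \<Rightarrow> bool) \<Rightarrow> nat \<Rightarrow> nat \<Rightarrow> bool" where
  "removable_arc V E p q \<longleftrightarrow> p \<in> V \<and> q \<in> V \<and> p \<noteq> q \<and> E p q \<and>
     (\<forall>m\<in>V. m \<noteq> p \<and> m \<noteq> q \<longrightarrow>
        (p < m \<and> q < m \<longrightarrow> \<not> (E p m \<and> E m q)) \<and>
        (m < q \<and> p < q \<longrightarrow> E p m \<longrightarrow> E q m) \<and>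
        (m < p \<and> q < p \<longrightarrow> E m q \<longrightarrow> E m p))"

lemma valid_digraphD1:
  "\<lbrakk>valid_digraph V E; i \<in> V; j \<in> V; h \<in> V; i \<noteq> j; i < h; j < h; E i j\<rbrakk> \<Longrightarrow> E i h \<or> E h j"
  and valid_digraphD2:
  "\<lbrakk>valid_digraph V E; i \<in> V; j \<in> V; h \<in> V; i \<noteq> j; i < h; j < h; E i h; E h j\<rbrakk> \<Longrightarrow> E i j"
  unfolding valid_digraph_def by blast+

lemma valid_digraph_subset: "valid_digraph V E \<Longrightarrow> U \<subseteq> V \<Longrightarrow> valid_digraph U E"
  unfolding valid_digraph_def by blast

text \<open>Reversal combined with exchanging i and j maps (A1) and (A2) to themselves. It turns
  removable arcs with p < q into those with q < p, so one case is enough below.\<close>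

lemma valid_digraph_converse:
  assumes "valid_digraph V E"
  shows "valid_digraph V (\<lambda>i j. E j i)"
  unfolding valid_digraph_def
proof (intro ballI impI)
  fix i j h
  assume "i \<in> V" "j \<in> V" "h \<in> V" "i \<noteq> j \<and> i < h \<and> j < h"
  then show "(E j i \<longrightarrow> E h i \<or> E j h) \<and> (E h i \<and> E j h \<longrightarrow> E j i)"
    using valid_digraphD1[OF assms, of j i h] valid_digraphD2[OF assms, of j i h] by blast
qed

lemma removable_arc_converse: "removable_arc V (\<lambda>i j. E j i) p q \<longleftrightarrow> removable_arc V E q p"
  unfolding removable_arc_def by blast

text \<open>With the target on top, the first clause would need a vertex above t and the third would
  need t < p; the second is the assumption on rows.\<close>

lemma removable_arc_into_top:
  assumes top: "\<And>v. v \<in> V \<Longrightarrow> v < t" and p: "p \<in> V" "E p t"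
    and row: "\<And>m. m \<in> V \<Longrightarrow> m \<noteq> p \<Longrightarrow> E p m \<Longrightarrow> E t m"
  shows "removable_arc (insert t V) E p t"
  unfolding removable_arc_def
proof (intro conjI ballI impI)
  have pt: "p < t"
    using top p by blast
  then show "p \<noteq> t"
    by simp
  fix m
  assume m: "m \<in> insert t V" "m \<noteq> p \<and> m \<noteq> t"
  then have mV: "m \<in> V" and mt: "m < t"
    using top by blast+
  show "\<not> (E p m \<and> E m t)" if "p < m \<and> t < m"
    using that mt by simp
  show "E t m" if "E p m"
    using row[OF mV] m that by blast
  show "E m p" if "m < p \<and> t < p"
    using that pt by simp
qed (use p in simp_all)

lemma removable_arc_from_top:
  assumes "\<And>v. v \<in> V \<Longrightarrow> v < t" "q \<in> V" "E t q" "\<And>m. m \<in> V \<Longrightarrow> m \<noteq> q \<Longrightarrow> E m q \<Longrightarrow> E m t"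
  shows "removable_arc (insert t V) E t q"
  by (rule iffD1[OF removable_arc_converse[of "insert t V" E q t]],
      rule removable_arc_into_top[of V t q "\<lambda>i j. E j i"]) (fact assms)+

text \<open>A new top vertex lies below no endpoint, so it can violate only the first
  clause.\<close>

lemma removable_arc_insert_top:
  assumes "p < t" "q < t" "removable_arc V E p q" "\<not> (E p t \<and> E t q)"
  shows "removable_arc (insert t V) E p q"
  using assms unfolding removable_arc_def by (elim conjE, intro conjI ballI impI) auto

text \<open>If nothing were removable in the larger graph, then p -> t -> q, and neither p -> t nor
  t -> q would be removable. This gives witnesses j with p -> j but not t -> j, and i with i -> q
  but not i -> t. By (A1) at t there is no arc i -> j, and this forces i and j to coincide.\<close>

lemma removable_arc_extend_less:
  assumes val: "valid_digraph (insert t V) E" and t: "\<And>v. v \<in> V \<Longrightarrow> v < t"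
    and rem: "removable_arc V E p q" and pq: "p < q"
  shows "\<exists>p q. removable_arc (insert t V) E p q"
proof (rule ccontr)
  assume "\<not> ?thesis"
  then have none: "\<And>p q. \<not> removable_arc (insert t V) E p q"
    by blast
  note D1 = valid_digraphD1[OF val] and D2 = valid_digraphD2[OF val]
  have p: "p \<in> V" "p < t" and q: "q \<in> V" "q < t" and Epq: "E p q"
    and hi: "\<And>m. m \<in> V \<Longrightarrow> q < m \<Longrightarrow> \<not> (E p m \<and> E m q)"
    and lo: "\<And>m. m \<in> V \<Longrightarrow> m \<noteq> p \<Longrightarrow> m < q \<Longrightarrow> E p m \<Longrightarrow> E q m"
    using rem t pq unfolding removable_arc_def by auto
  have tp: "E p t" and tq: "E t q"
    using removable_arc_insert_top[of p t q V E] none p q rem by blast+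
  obtain j where j: "j \<in> V" "j \<noteq> p" "j < t" "E p j" "\<not> E t j"
    using removable_arc_into_top[where E = E, OF t p(1) tp] none t by blast
  obtain i where i: "i \<in> V" "i \<noteq> q" "i < t" "E i q" "\<not> E i t"
    using removable_arc_from_top[where E = E, OF t q(1) tq] none t by blast
  have jq: "j \<noteq> q" and ip: "i \<noteq> p"
    using j i tp tq by auto
  have nij: "\<not> E i j" if "i \<noteq> j"
    using D1[of i j t] i j that by auto
  \<comment> \<open>Both witnesses lie below q: otherwise (A1) at the larger vertex yields either
    the excluded arc i -> j or a path p -> m -> q with m above q, which removability of (p, q)
    excludes.\<close>
  have jlt: "j < q"
  proof (rule ccontr)
    assume "\<not> j < q"
    then have jq': "q < j"
      using jq by simp
    then have njq: "\<not> E j q"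
      using hi[of j] j by auto
    then have ij: "i \<noteq> j"
      using i by auto
    show False
    proof (cases "i < j")
      case True
      then show False
        using D1[of i q j] i j q jq' njq nij[OF ij] by auto
    next
      case False
      then have "j < i" "q < i"
        using ij jq' by auto
      then show False
        using hi[of i] i D1[of p j i] p j pq nij[OF ij] by auto
    qed
  qed
  have ilt: "i < q"
  proof (rule ccontr)
    assume "\<not> i < q"
    then have "q < i" "i \<noteq> j"
      using i jlt by auto
    then show False
      using hi[of i] i D1[of p j i] p j pq nij jlt by auto
  qed
  have Eqj: "E q j"
    using lo j jlt by auto
  have ij: "i = j"
    using D2[of i j q] i j q nij ilt jlt Eqj by auto
  \<comment> \<open>The two obstructions coincide, and then the arc from that vertex to \<open>q\<close> is removable.\<close>
  have Eqt: "E q t"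
    using D1[of q j t] q j jq Eqj by auto
  have "removable_arc (insert t V) E i q"
    unfolding removable_arc_def
  proof (intro conjI ballI impI)
    fix m
    assume m: "m \<in> insert t V" "m \<noteq> i \<and> m \<noteq> q"
    {
      assume mq: "i < m \<and> q < m"
      show "\<not> (E i m \<and> E m q)"
      proof (cases "m = t")
        case True
        then show ?thesis
          using i by simp
      next
        case False
        then have "m \<in> V" "m < t"
          using m t by auto
        then show ?thesis
          using D1[of i m t] D2[of p m t] hi[of m] i p m mq pq tp by auto
      qed
    next
      assume "m < q \<and> i < q" "E i m"
      moreover from this have "m \<in> V" "m < t"
        using m t q by auto
      ultimately show "E q m"
        using D1[of i m t] D2[of q m t] i q m Eqt by auto
    next
      assume "m < i \<and> q < i"
      then show "E m i"
        using ilt by simp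
    }
  qed (use i q in auto)
  then show False
    using none by blast
qed

lemma exists_removable_arc:
  assumes "finite V" "valid_digraph V E" "\<exists>i\<in>V. \<exists>j\<in>V. i \<noteq> j \<and> E i j"
  shows "\<exists>p q. removable_arc V E p q"
  using assms
proof (induction V rule: finite_linorder_max_induct)
  case empty
  then show ?case
    by simp
next
  case (insert t V)
  have t: "\<And>v. v \<in> V \<Longrightarrow> v < t"
    using insert.hyps by simp
  have val: "valid_digraph (insert t V) E"
    using insert.prems by simp
  show ?case
  proof (cases "\<exists>i\<in>V. \<exists>j\<in>V. i \<noteq> j \<and> E i j")
    case True
    then obtain p q where rem: "removable_arc V E p q"
      using insert.IH valid_digraph_subset[OF val] by blast
    then have "p < q \<or> q < p"
      unfolding removable_arc_def by auto
    then show ?thesis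
    proof
      assume "p < q"
      then show ?thesis
        using removable_arc_extend_less[OF val t rem] by blast
    next
      assume "q < p"
      have rem': "removable_arc V (\<lambda>i j. E j i) q p"
        by (rule iffD2[OF removable_arc_converse[of V E q p] rem])
      have val': "valid_digraph (insert t V) (\<lambda>i j. E j i)"
        by (rule valid_digraph_converse[OF val])
      have "\<exists>a b. removable_arc (insert t V) (\<lambda>i j. E j i) a b"
        by (rule removable_arc_extend_less[where V = V]) (fact val' t rem' \<open>q < p\<close>)+
      then obtain a b where "removable_arc (insert t V) (\<lambda>i j. E j i) a b"
        by (elim exE)
      then show ?thesis
        by (intro exI) (rule iffD1[OF removable_arc_converse[of "insert t V" E a b]])
    qed
  next
    \<comment> \<open>Without arcs among the old vertices, the row or column condition at the top is
      vacuous and every arc at t is removable.\<close>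
    case False
    then have no: "\<And>i j. i \<in> V \<Longrightarrow> j \<in> V \<Longrightarrow> i \<noteq> j \<Longrightarrow> \<not> E i j"
      by blast
    obtain p where p: "p \<in> V" "E p t \<or> E t p"
      using insert.prems(2) no by auto
    have *: "removable_arc (insert t V) E p t" if "E p t"
      using removable_arc_into_top[where E = E, OF t p(1) that] p no by blast
    have **: "removable_arc (insert t V) E t p" if "E t p"
      using removable_arc_from_top[where E = E, OF t p(1) that] p no by blast
    show ?thesis
      using p(2) * ** by blast
  qed
qed

section \<open>Linear relations over a subring\<close>

text \<open>Gaussian elimination without division, so that the solution stays in the subring F. In
  its application F consists of the polynomials fixed by the elimination of a variable.\<close>

lemma elimination:
  fixes M :: "'a \<Rightarrow> 'b \<Rightarrow> 's::idom"
  assumes "finite J" "finite K" "card J < card K"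
    and "\<And>k w. k \<in> K \<Longrightarrow> w \<in> J \<Longrightarrow> M k w \<in> F"
    and "0 \<in> F" "1 \<in> F" "\<And>x y. x \<in> F \<Longrightarrow> y \<in> F \<Longrightarrow> x - y \<in> F" "\<And>x y. x \<in> F \<Longrightarrow> y \<in> F \<Longrightarrow> x * y \<in> F"
  shows "\<exists>x. (\<forall>k\<in>K. x k \<in> F) \<and> (\<exists>k\<in>K. x k \<noteq> 0) \<and> (\<forall>w\<in>J. (\<Sum>k\<in>K. x k * M k w) = 0)"
  using assms(1-4)
proof (induction J arbitrary: K M rule: finite_induct)
  case empty
  then obtain k where "k \<in> K"
    by (metis card.empty card_gt_0_iff ex_in_conv)
  then show ?case
    using assms(6) by (intro exI[of _ "\<lambda>_. 1"]) auto
next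
  case (insert w0 J)
  show ?case
  proof (cases "\<forall>k\<in>K. M k w0 = 0")
    case True
    have "card J < card K"
      using insert.prems insert.hyps by simp
    then obtain x where "\<forall>k\<in>K. x k \<in> F" "\<exists>k\<in>K. x k \<noteq> 0" "\<forall>w\<in>J. (\<Sum>k\<in>K. x k * M k w) = 0"
      using insert.IH[of K M] insert.prems by auto
    then show ?thesis
      using True by (intro exI[of _ x]) auto
  next
    case False
    then obtain k0 where k0: "k0 \<in> K" "M k0 w0 \<noteq> 0"
      by blast
    \<comment> \<open>The pivot row is subtracted with denominators cleared, so that column w0 of N
      vanishes. A solution for N is lifted by scaling with the pivot; the entry - S at k0 then
      settles column w0.\<close>
    define N where "N k w = M k0 w0 * M k w - M k w0 * M k0 w" for k w
    have "card J < card (K - {k0})"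
      using insert.prems insert.hyps k0 by simp
    moreover have "\<And>k w. k \<in> K - {k0} \<Longrightarrow> w \<in> J \<Longrightarrow> N k w \<in> F"
      unfolding N_def using insert.prems(3) k0 assms(7,8) by auto
    ultimately have "\<exists>x. (\<forall>k\<in>K - {k0}. x k \<in> F) \<and> (\<exists>k\<in>K - {k0}. x k \<noteq> 0) \<and>
        (\<forall>w\<in>J. (\<Sum>k\<in>K - {k0}. x k * N k w) = 0)"
      using insert.prems(1) by (intro insert.IH) auto
    then obtain x where x: "\<And>k. k\<in>K - {k0} \<Longrightarrow> x k \<in> F" "\<exists>k\<in>K - {k0}. x k \<noteq> 0"
      "\<And>w. w\<in>J \<Longrightarrow> (\<Sum>k\<in>K - {k0}. x k * N k w) = 0"
      by blast
    define S where "S = (\<Sum>k\<in>K - {k0}. x k * M k w0)"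
    define y where "y k = (if k = k0 then - S else x k * M k0 w0)" for k
    have closed_sum: "(\<Sum>k\<in>A. f k) \<in> F" if "\<And>k. k \<in> A \<Longrightarrow> f k \<in> F" "finite A" for f :: "'a \<Rightarrow> 's" and A
      using that(2,1)
    proof (induction A rule: finite_induct)
      case (insert a A)
      have "f a - (0 - sum f A) \<in> F"
        using insert assms(5,7) by (meson insertCI)
      then show ?case
        using insert by simp
    qed (use assms(5) in auto)
    have "S \<in> F"
      unfolding S_def using x(1) insert.prems(1,3) assms(8) by (intro closed_sum) auto
    then have "- S \<in> F"
      using assms(7)[OF assms(5), of S] by simp
    then have "\<forall>k\<in>K. y k \<in> F"
      unfolding y_def using x(1) insert.prems(3) k0 assms(8) by auto
    moreover have "\<exists>k\<in>K. y k \<noteq> 0"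
      using x(2) k0 unfolding y_def by auto
    moreover have "(\<Sum>k\<in>K. y k * M k w) = 0" if w: "w \<in> insert w0 J" for w
    proof -
      have "(\<Sum>k\<in>K. y k * M k w) = - S * M k0 w + (\<Sum>k\<in>K - {k0}. y k * M k w)"
        using insert.prems(1) k0 by (simp add: sum.remove y_def)
      also have "(\<Sum>k\<in>K - {k0}. y k * M k w) = (\<Sum>k\<in>K - {k0}. x k * (M k0 w0 * M k w))"
        by (intro sum.cong) (auto simp: y_def)
      also have "- S * M k0 w + \<dots> = (\<Sum>k\<in>K - {k0}. x k * N k w)"
        unfolding S_def N_def
        by (simp add: sum_distrib_right right_diff_distrib sum_subtractf mult.assoc)
      also have "\<dots> = 0"
        using w x(3) by (auto simp: N_def mult.commute)
      finally show ?thesis .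
    qed
    ultimately show ?thesis
      by blast
  qed
qed

section \<open>Substitution in polynomials\<close>

lemma const_poly_mult: "const_poly c * const_poly d = const_poly (c * d)"
  by (simp add: const_poly_def mult_single)

lemma const_poly_add: "const_poly (c + d) = const_poly c + const_poly d"
  by (simp add: const_poly_def single_add)

lemma const_poly_0 [simp]: "const_poly 0 = 0"
  and const_poly_1 [simp]: "const_poly 1 = 1"
  by (simp_all add: const_poly_def)

lemma const_poly_of_int: "const_poly (of_int n) = of_int n"
  by (simp add: const_poly_def)

lemma sum_single_lookup: "(\<Sum>m\<in>Poly_Mapping.keys p. Poly_Mapping.single m (Poly_Mapping.lookup p m)) = p"
proof (rule poly_mapping_eqI)
  fix k
  have "Poly_Mapping.lookup (\<Sum>m\<in>Poly_Mapping.keys p. Poly_Mapping.single m (Poly_Mapping.lookup p m)) k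
      = (\<Sum>m\<in>Poly_Mapping.keys p. if m = k then Poly_Mapping.lookup p k else 0)"
    unfolding lookup_sum by (intro sum.cong) (auto simp: lookup_single when_def)
  then show "Poly_Mapping.lookup (\<Sum>m\<in>Poly_Mapping.keys p. Poly_Mapping.single m (Poly_Mapping.lookup p m)) k
      = Poly_Mapping.lookup p k"
    by (auto simp: in_keys_iff)
qed

lemma var_poly_power: "var_poly i ^ n = (Poly_Mapping.single (Poly_Mapping.single i n) 1 :: 'k::field mpoly)"
  by (induction n) (simp_all add: var_poly_def mult_single flip: single_add)

lemma monomial_eq:
  "(Poly_Mapping.single m c :: 'k::field mpoly) =
     const_poly c * (\<Prod>i\<in>Poly_Mapping.keys m. var_poly i ^ Poly_Mapping.lookup m i)"
proof -
  have "(\<Prod>i\<in>A. Poly_Mapping.single (f i) (1::'k)) = Poly_Mapping.single (sum f A) 1"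
    if "finite A" for A and f :: "nat \<Rightarrow> nat \<Rightarrow>\<^sub>0 nat"
    using that by (induction A rule: finite_induct) (simp_all add: mult_single)
  then show ?thesis
    by (simp add: var_poly_power const_poly_def mult_single sum_single_lookup)
qed


section \<open>The subring of polynomials in prescribed variables\<close>

lemma mpoly_ring_const [simp]: "const_poly c \<in> mpoly_ring I"
  by (auto simp: mpoly_ring_def const_poly_def)

lemma mpoly_ring_0 [simp]: "0 \<in> mpoly_ring I"
  and mpoly_ring_1 [simp]: "1 \<in> mpoly_ring I"
  using mpoly_ring_const[of 0 I] mpoly_ring_const[of 1 I] by simp_all

lemma mpoly_ring_of_int [simp]: "of_int n \<in> mpoly_ring I"
  using mpoly_ring_const[of "of_int n" I] by (simp add: const_poly_of_int)

lemma mpoly_ring_var: "i \<in> I \<Longrightarrow> var_poly i \<in> mpoly_ring I"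
  by (auto simp: mpoly_ring_def var_poly_def)

lemma mpoly_ring_add: "p \<in> mpoly_ring I \<Longrightarrow> q \<in> mpoly_ring I \<Longrightarrow> p + q \<in> mpoly_ring I"
  using Poly_Mapping.keys_add[of p q] unfolding mpoly_ring_def by fast

lemma mpoly_ring_mult:
  assumes "p \<in> mpoly_ring I" "q \<in> mpoly_ring I"
  shows "p * q \<in> mpoly_ring I"
  unfolding mpoly_ring_def
proof (intro CollectI ballI)
  fix m
  assume "m \<in> Poly_Mapping.keys (p * q)"
  then obtain a b where "m = a + b" "a \<in> Poly_Mapping.keys p" "b \<in> Poly_Mapping.keys q"
    using Poly_Mapping.keys_mult[of p q] by auto
  then show "Poly_Mapping.keys m \<subseteq> I"
    using Poly_Mapping.keys_add[of a b] assms unfolding mpoly_ring_def by blast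
qed

lemma mpoly_ring_uminus: "p \<in> mpoly_ring I \<Longrightarrow> - p \<in> mpoly_ring I"
  unfolding mpoly_ring_def by simp

lemma mpoly_ring_diff: "p \<in> mpoly_ring I \<Longrightarrow> q \<in> mpoly_ring I \<Longrightarrow> p - q \<in> mpoly_ring I"
  using mpoly_ring_add[OF _ mpoly_ring_uminus, of p I q] by simp

lemma mpoly_ring_sum: "(\<And>a. a \<in> A \<Longrightarrow> f a \<in> mpoly_ring I) \<Longrightarrow> sum f A \<in> mpoly_ring I"
  by (induction A rule: infinite_finite_induct) (auto intro: mpoly_ring_add)

lemma mpoly_ring_prod: "(\<And>a. a \<in> A \<Longrightarrow> f a \<in> mpoly_ring I) \<Longrightarrow> prod f A \<in> mpoly_ring I"
  by (induction A rule: infinite_finite_induct) (auto intro: mpoly_ring_mult)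

lemma mpoly_ring_power: "p \<in> mpoly_ring I \<Longrightarrow> p ^ n \<in> mpoly_ring I"
  by (induction n) (auto intro: mpoly_ring_mult)

lemmas mpoly_ring_closed = mpoly_ring_add mpoly_ring_mult mpoly_ring_uminus mpoly_ring_diff
  mpoly_ring_sum mpoly_ring_prod mpoly_ring_power

lemma mpoly_ring_UNIV [simp]: "p \<in> mpoly_ring UNIV"
  by (simp add: mpoly_ring_def)

lemma mpoly_ring_mono: "I \<subseteq> J \<Longrightarrow> mpoly_ring I \<subseteq> mpoly_ring J"
  by (auto simp: mpoly_ring_def)

lemma mpoly_ring_induct [consumes 1, case_names const var add mult]:
  fixes p :: "'k::field mpoly"
  assumes p: "p \<in> mpoly_ring I"
    and const: "\<And>c. P (const_poly c)" and var: "\<And>i. i \<in> I \<Longrightarrow> P (var_poly i)"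
    and add: "\<And>p q. p \<in> mpoly_ring I \<Longrightarrow> q \<in> mpoly_ring I \<Longrightarrow> P p \<Longrightarrow> P q \<Longrightarrow> P (p + q)"
    and mult: "\<And>p q. p \<in> mpoly_ring I \<Longrightarrow> q \<in> mpoly_ring I \<Longrightarrow> P p \<Longrightarrow> P q \<Longrightarrow> P (p * q)"
  shows "P p"
proof -
  let ?Q = "\<lambda>p. p \<in> mpoly_ring I \<and> P p"
  have power: "?Q (var_poly i ^ n)" if "i \<in> I" for i n
    using that const[of 1] by (induction n) (auto intro: mpoly_ring_mult mpoly_ring_var mult var)
  have prod: "?Q (\<Prod>i\<in>A. var_poly i ^ f i)" if "A \<subseteq> I" "finite A" for A f
    using that(2,1) const[of 1] power
    by (induction A rule: finite_induct) (auto intro!: mpoly_ring_mult mult)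
  have mono: "?Q (Poly_Mapping.single m c)" if "Poly_Mapping.keys m \<subseteq> I" for m c
    unfolding monomial_eq using prod[OF that] const by (auto intro!: mpoly_ring_mult mult)
  have "?Q (\<Sum>m\<in>A. Poly_Mapping.single m (f m))"
    if "finite A" "\<forall>m\<in>A. Poly_Mapping.keys m \<subseteq> I" for A f
    using that const[of 0] mono
    by (induction A rule: finite_induct) (auto intro!: mpoly_ring_add add)
  from this[of "Poly_Mapping.keys p" "Poly_Mapping.lookup p"]
  have "?Q (\<Sum>m\<in>Poly_Mapping.keys p. Poly_Mapping.single m (Poly_Mapping.lookup p m))"
    using p unfolding mpoly_ring_def by fastforce
  then show ?thesis
    by (simp add: sum_single_lookup)
qed

section \<open>Evaluation homomorphisms\<close>

definition monom_value :: "(nat \<Rightarrow> 'r::comm_ring_1) \<Rightarrow> (nat \<Rightarrow>\<^sub>0 nat) \<Rightarrow> 'r" where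
  "monom_value s m = (\<Prod>i\<in>Poly_Mapping.keys m. s i ^ Poly_Mapping.lookup m i)"

lemma monom_value_superset:
  "finite A \<Longrightarrow> Poly_Mapping.keys m \<subseteq> A \<Longrightarrow> monom_value s m = (\<Prod>i\<in>A. s i ^ Poly_Mapping.lookup m i)"
  unfolding monom_value_def by (rule prod.mono_neutral_left) (auto simp: in_keys_iff)

lemma monom_value_add: "monom_value s (m + n) = monom_value s m * monom_value s n"
proof -
  let ?A = "Poly_Mapping.keys m \<union> Poly_Mapping.keys n"
  have "monom_value s (m + n) = (\<Prod>i\<in>?A. s i ^ Poly_Mapping.lookup (m + n) i)"
    using Poly_Mapping.keys_add[of m n] by (intro monom_value_superset) auto
  then show ?thesis
    by (simp add: lookup_add power_add prod.distrib monom_value_superset[of ?A])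
qed

text \<open>The map c on coefficients is a parameter because the target is sometimes the polynomial
  ring itself (substitution) and sometimes polynomials over it in a formal parameter
  (derivations).\<close>

definition eval_poly :: "('k::field \<Rightarrow> 'r) \<Rightarrow> (nat \<Rightarrow> 'r) \<Rightarrow> 'k mpoly \<Rightarrow> 'r::comm_ring_1" where
  "eval_poly c s p = (\<Sum>m\<in>Poly_Mapping.keys p. c (Poly_Mapping.lookup p m) * monom_value s m)"

locale coefficient_hom =
  fixes c :: "'k::field \<Rightarrow> 'r::comm_ring_1"
  assumes c_add: "c (x + y) = c x + c y" and c_mult: "c (x * y) = c x * c y" and c_1: "c 1 = 1"
begin

lemma c_0: "c 0 = 0"
  using c_add[of 0 0] by simp

lemma eval_superset:
  "finite A \<Longrightarrow> Poly_Mapping.keys p \<subseteq> A \<Longrightarrow>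
    eval_poly c s p = (\<Sum>m\<in>A. c (Poly_Mapping.lookup p m) * monom_value s m)"
  unfolding eval_poly_def by (rule sum.mono_neutral_left) (auto simp: in_keys_iff c_0)

lemma eval_add: "eval_poly c s (p + q) = eval_poly c s p + eval_poly c s q"
proof -
  let ?A = "Poly_Mapping.keys p \<union> Poly_Mapping.keys q"
  have "eval_poly c s (p + q) = (\<Sum>m\<in>?A. c (Poly_Mapping.lookup (p + q) m) * monom_value s m)"
    using Poly_Mapping.keys_add[of p q] by (intro eval_superset) auto
  then show ?thesis
    by (simp add: lookup_add c_add distrib_right sum.distrib eval_superset[of ?A])
qed

lemma eval_0 [simp]: "eval_poly c s 0 = 0"
  by (simp add: eval_poly_def)

lemma eval_sum: "eval_poly c s (sum f A) = (\<Sum>a\<in>A. eval_poly c s (f a))"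
  by (induction A rule: infinite_finite_induct) (simp_all add: eval_add)

lemma eval_single: "eval_poly c s (Poly_Mapping.single m a) = c a * monom_value s m"
  by (simp add: eval_poly_def c_0)

lemma eval_mult: "eval_poly c s (p * q) = eval_poly c s p * eval_poly c s q"
proof -
  let ?p = "\<lambda>m. Poly_Mapping.single m (Poly_Mapping.lookup p m)"
  let ?q = "\<lambda>m. Poly_Mapping.single m (Poly_Mapping.lookup q m)"
  have "p * q = (\<Sum>m\<in>Poly_Mapping.keys p. ?p m) * (\<Sum>n\<in>Poly_Mapping.keys q. ?q n)"
    by (simp add: sum_single_lookup)
  also have "\<dots> = (\<Sum>m\<in>Poly_Mapping.keys p. \<Sum>n\<in>Poly_Mapping.keys q.
      Poly_Mapping.single (m + n) (Poly_Mapping.lookup p m * Poly_Mapping.lookup q n))"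
    by (simp add: sum_product mult_single)
  finally have "eval_poly c s (p * q) = (\<Sum>m\<in>Poly_Mapping.keys p. \<Sum>n\<in>Poly_Mapping.keys q.
      (c (Poly_Mapping.lookup p m) * monom_value s m) * (c (Poly_Mapping.lookup q n) * monom_value s n))"
    by (simp add: eval_sum eval_single c_mult monom_value_add ac_simps)
  then show ?thesis
    by (simp add: eval_poly_def sum_product)
qed

lemma eval_const [simp]: "eval_poly c s (const_poly a) = c a"
  by (simp add: const_poly_def eval_single monom_value_def)

lemma eval_1 [simp]: "eval_poly c s 1 = 1"
  using eval_const[of s 1] by (simp add: c_1)

lemma eval_var [simp]: "eval_poly c s (var_poly i) = s i"
  by (simp add: var_poly_def eval_single monom_value_def c_1)

lemma eval_uminus: "eval_poly c s (- p) = - eval_poly c s p"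
  by (rule minus_unique[symmetric]) (simp flip: eval_add)

lemma eval_diff: "eval_poly c s (p - q) = eval_poly c s p - eval_poly c s q"
  by (simp only: diff_conv_add_uminus eval_add eval_uminus)

lemma eval_of_int [simp]: "eval_poly c s (of_int n) = of_int n"
proof -
  have nat: "eval_poly c s (of_nat k) = of_nat k" for k
    by (induction k) (simp_all add: eval_add)
  show ?thesis
    using nat by (cases n rule: int_cases2) (simp_all add: eval_uminus)
qed

lemma eval_prod: "eval_poly c s (prod f A) = (\<Prod>a\<in>A. eval_poly c s (f a))"
  by (induction A rule: infinite_finite_induct) (simp_all add: eval_mult)

lemma eval_power: "eval_poly c s (p ^ n) = eval_poly c s p ^ n"
  by (induction n) (simp_all add: eval_mult)

end

interpretation poly_subst: coefficient_hom "const_poly :: 'k::field \<Rightarrow> 'k mpoly"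
  by (rule coefficient_hom.intro[OF const_poly_add const_poly_mult[symmetric] const_poly_1])

lemmas poly_subst_hom = poly_subst.eval_add poly_subst.eval_mult poly_subst.eval_uminus
  poly_subst.eval_diff poly_subst.eval_sum poly_subst.eval_prod poly_subst.eval_power

lemma poly_subst_in_ring:
  "p \<in> mpoly_ring I \<Longrightarrow> (\<And>i. i \<in> I \<Longrightarrow> s i \<in> mpoly_ring J) \<Longrightarrow>
    eval_poly const_poly s p \<in> mpoly_ring J"
  by (induction rule: mpoly_ring_induct) (auto simp: poly_subst_hom intro: mpoly_ring_closed)

lemma poly_subst_cong:
  "p \<in> mpoly_ring I \<Longrightarrow> (\<And>i. i \<in> I \<Longrightarrow> s i = t i) \<Longrightarrow>
    eval_poly const_poly s p = eval_poly const_poly t p"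
  by (induction rule: mpoly_ring_induct) (auto simp: poly_subst_hom)

lemma poly_subst_var: "eval_poly const_poly var_poly p = p"
  using mpoly_ring_UNIV[of p] by (induction rule: mpoly_ring_induct) (auto simp: poly_subst_hom)

text \<open>A ring retraction onto \<open>mpoly_ring I\<close>. Applied to an identity over all
  variables, it moves unknown coefficients into the subring and leaves the known data fixed.\<close>

definition restrict_vars :: "nat set \<Rightarrow> 'k::field mpoly \<Rightarrow> 'k mpoly" where
  "restrict_vars I = eval_poly const_poly (\<lambda>i. if i \<in> I then var_poly i else 0)"

lemma restrict_vars_in_ring: "restrict_vars I p \<in> mpoly_ring I"
  unfolding restrict_vars_def
  by (rule poly_subst_in_ring[of p UNIV]) (auto intro: mpoly_ring_var)

lemma restrict_vars_id: "p \<in> mpoly_ring I \<Longrightarrow> restrict_vars I p = p"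
  unfolding restrict_vars_def using poly_subst_cong[of p I _ var_poly] by (simp add: poly_subst_var)

text \<open>Retract both sides of p = s * q and cancel q: the quotient s equals its own
  retraction.\<close>

lemma mpoly_ring_cancel:
  assumes "p \<in> mpoly_ring I" "q \<in> mpoly_ring I" "p = s * q" "q \<noteq> 0"
  shows "s \<in> mpoly_ring I"
proof -
  have "s * q = restrict_vars I (s * q)"
    using restrict_vars_id[OF assms(1)] assms(3) by simp
  also have "\<dots> = restrict_vars I s * q"
    using restrict_vars_id[OF assms(2)] by (simp add: restrict_vars_def poly_subst_hom)
  finally have "s = restrict_vars I s"
    using assms(4) by simp
  then show ?thesis
    using restrict_vars_in_ring[of I s] by simp
qed

section \<open>Homogeneous polynomials\<close>

definition monom_degree :: "(nat \<Rightarrow>\<^sub>0 nat) \<Rightarrow> nat" where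
  "monom_degree m = (\<Sum>i\<in>Poly_Mapping.keys m. Poly_Mapping.lookup m i)"

lemma monom_degree_superset:
  "finite A \<Longrightarrow> Poly_Mapping.keys m \<subseteq> A \<Longrightarrow> monom_degree m = (\<Sum>i\<in>A. Poly_Mapping.lookup m i)"
  unfolding monom_degree_def by (rule sum.mono_neutral_left) (auto simp: in_keys_iff)

lemma monom_degree_add: "monom_degree (m + n) = monom_degree m + monom_degree n"
proof -
  let ?A = "Poly_Mapping.keys m \<union> Poly_Mapping.keys n"
  have "monom_degree (m + n) = (\<Sum>i\<in>?A. Poly_Mapping.lookup (m + n) i)"
    using Poly_Mapping.keys_add[of m n] by (intro monom_degree_superset) auto
  then show ?thesis
    by (simp add: lookup_add sum.distrib monom_degree_superset[of ?A])
qed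

lemma monom_degree_0_iff: "monom_degree m = 0 \<longleftrightarrow> m = 0"
  unfolding monom_degree_def by (auto simp: in_keys_iff intro!: poly_mapping_eqI)

text \<open>Zero is homogeneous of every degree; hence the separate case s = 0 in the degree
  arguments below.\<close>

definition homogeneous :: "nat \<Rightarrow> 'k::field mpoly \<Rightarrow> bool" where
  "homogeneous d p \<longleftrightarrow> (\<forall>m\<in>Poly_Mapping.keys p. monom_degree m = d)"

lemma homogeneous_0 [simp]: "homogeneous d 0"
  by (simp add: homogeneous_def)

lemma homogeneous_const [simp]: "homogeneous 0 (const_poly c)"
  by (auto simp: homogeneous_def const_poly_def monom_degree_def)

lemma homogeneous_1 [simp]: "homogeneous 0 1"
  using homogeneous_const[of 1] by simp

lemma homogeneous_of_int [simp]: "homogeneous 0 (of_int n)"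
  using homogeneous_const[of "of_int n"] by (simp add: const_poly_of_int)

lemma homogeneous_var [simp]: "homogeneous 1 (var_poly i)"
  by (auto simp: homogeneous_def var_poly_def monom_degree_def)

lemma homogeneous_add: "homogeneous d p \<Longrightarrow> homogeneous d q \<Longrightarrow> homogeneous d (p + q)"
  using Poly_Mapping.keys_add[of p q] unfolding homogeneous_def by fast

lemma homogeneous_uminus: "homogeneous d p \<Longrightarrow> homogeneous d (- p)"
  unfolding homogeneous_def by simp

lemma homogeneous_diff: "homogeneous d p \<Longrightarrow> homogeneous d q \<Longrightarrow> homogeneous d (p - q)"
  using homogeneous_add[OF _ homogeneous_uminus, of d p q] by simp

lemma homogeneous_sum: "(\<And>a. a \<in> A \<Longrightarrow> homogeneous d (f a)) \<Longrightarrow> homogeneous d (sum f A)"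
  by (induction A rule: infinite_finite_induct) (auto intro: homogeneous_add)

lemma homogeneous_mult:
  assumes "homogeneous d p" "homogeneous e q"
  shows "homogeneous (d + e) (p * q)"
  unfolding homogeneous_def
proof
  fix m
  assume "m \<in> Poly_Mapping.keys (p * q)"
  then obtain a b where "m = a + b" "a \<in> Poly_Mapping.keys p" "b \<in> Poly_Mapping.keys q"
    using Poly_Mapping.keys_mult[of p q] by auto
  then show "monom_degree m = d + e"
    using assms by (simp add: homogeneous_def monom_degree_add)
qed

lemma homogeneous_prod:
  "(\<And>a. a \<in> A \<Longrightarrow> homogeneous (g a) (f a)) \<Longrightarrow> homogeneous (sum g A) (prod f A)"
  by (induction A rule: infinite_finite_induct) (auto intro: homogeneous_mult)

lemma homogeneous_power: "homogeneous d p \<Longrightarrow> homogeneous (n * d) (p ^ n)"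
  by (induction n) (auto intro: homogeneous_mult)

lemma homogeneous_0_const:
  assumes "homogeneous 0 p"
  obtains c where "p = const_poly c"
proof -
  have "Poly_Mapping.keys p \<subseteq> {0}"
    using assms by (auto simp: homogeneous_def monom_degree_0_iff)
  then have "p = const_poly (Poly_Mapping.lookup p 0)"
    by (intro poly_mapping_eqI) (auto simp: const_poly_def lookup_single when_def in_keys_iff)
  then show ?thesis
    by (rule that)
qed

lemma homogeneous_subst:
  assumes "homogeneous d p" "\<And>i. homogeneous 1 (s i)"
  shows "homogeneous d (eval_poly const_poly s p)"
  unfolding eval_poly_def
proof (rule homogeneous_sum)
  fix m
  assume m: "m \<in> Poly_Mapping.keys p"
  have "homogeneous (Poly_Mapping.lookup m i) (s i ^ Poly_Mapping.lookup m i)" for i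
    using homogeneous_power[OF assms(2)[of i]] by simp
  then have "homogeneous (monom_degree m) (monom_value s m)"
    unfolding monom_degree_def monom_value_def by (rule homogeneous_prod)
  then have "homogeneous (0 + monom_degree m) (const_poly (Poly_Mapping.lookup p m) * monom_value s m)"
    by (intro homogeneous_mult) simp_all
  then show "homogeneous d (const_poly (Poly_Mapping.lookup p m) * monom_value s m)"
    using assms(1) m by (simp add: homogeneous_def)
qed

definition hom_part :: "nat \<Rightarrow> 'k::field mpoly \<Rightarrow> 'k mpoly" where
  "hom_part d p = (\<Sum>m | m \<in> Poly_Mapping.keys p \<and> monom_degree m = d.
     Poly_Mapping.single m (Poly_Mapping.lookup p m))"

lemma lookup_hom_part:
  "Poly_Mapping.lookup (hom_part d p) m = (if monom_degree m = d then Poly_Mapping.lookup p m else 0)"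
proof -
  have "Poly_Mapping.lookup (hom_part d p) m =
      (\<Sum>n | n \<in> Poly_Mapping.keys p \<and> monom_degree n = d. if n = m then Poly_Mapping.lookup p m else 0)"
    unfolding hom_part_def lookup_sum by (intro sum.cong) (auto simp: lookup_single when_def)
  then show ?thesis
    by (auto simp: in_keys_iff)
qed

lemma hom_part_homogeneous: "homogeneous d (hom_part d p)"
  unfolding homogeneous_def by (auto simp: in_keys_iff lookup_hom_part split: if_splits)

lemma hom_part_add: "hom_part d (p + q) = hom_part d p + hom_part d q"
  by (rule poly_mapping_eqI) (simp add: lookup_hom_part lookup_add)

lemma hom_part_0 [simp]: "hom_part d 0 = 0"
  by (simp add: hom_part_def)

lemma hom_part_sum: "hom_part d (sum f A) = (\<Sum>a\<in>A. hom_part d (f a))"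
  by (induction A rule: infinite_finite_induct) (simp_all add: hom_part_add)

lemma hom_part_of_homogeneous:
  "homogeneous e p \<Longrightarrow> hom_part d p = (if d = e then p else 0)"
  by (rule poly_mapping_eqI) (auto simp: lookup_hom_part homogeneous_def in_keys_iff)

lemma sum_hom_part: "(\<Sum>d\<in>monom_degree ` Poly_Mapping.keys p. hom_part d p) = p"
proof (rule poly_mapping_eqI)
  fix m
  show "Poly_Mapping.lookup (\<Sum>d\<in>monom_degree ` Poly_Mapping.keys p. hom_part d p) m =
      Poly_Mapping.lookup p m"
    by (auto simp: lookup_sum lookup_hom_part in_keys_iff)
qed

lemma hom_part_mult:
  assumes "homogeneous b B"
  shows "hom_part n (s * B) = (if b \<le> n then hom_part (n - b) s * B else 0)"
proof -
  let ?D = "monom_degree ` Poly_Mapping.keys s"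
  have "s * B = (\<Sum>d\<in>?D. hom_part d s * B)"
    by (simp add: sum_hom_part flip: sum_distrib_right)
  also have "hom_part n \<dots> = (\<Sum>d\<in>?D. if n = d + b then hom_part d s * B else 0)"
    unfolding hom_part_sum
    by (intro sum.cong hom_part_of_homogeneous homogeneous_mult hom_part_homogeneous assms refl)
  also have "\<dots> = (\<Sum>d\<in>?D. if d = n - b \<and> b \<le> n then hom_part d s * B else 0)"
    by (intro sum.cong) auto
  also have "\<dots> = (if b \<le> n then hom_part (n - b) s * B else 0)"
  proof -
    have "hom_part (n - b) s = 0" if "n - b \<notin> ?D"
      using that unfolding hom_part_def by (intro sum.neutral ballI) (auto simp: image_iff)
    then show ?thesis
      by auto
  qed
  finally show ?thesis .
qed

text \<open>Taking components of degree e replaces s by one of its homogeneous components, because B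
  is homogeneous; then B cancels.\<close>

lemma homogeneous_cancel:
  assumes "homogeneous e (s * B)" "homogeneous b B" "B \<noteq> 0"
  shows "s = 0 \<or> b \<le> e \<and> homogeneous (e - b) s"
proof -
  have "s * B = hom_part e (s * B)"
    using assms(1) by (simp add: hom_part_of_homogeneous)
  also have "\<dots> = (if b \<le> e then hom_part (e - b) s * B else 0)"
    by (rule hom_part_mult[OF assms(2)])
  finally show ?thesis
    using assms(3) hom_part_homogeneous[of "e - b" s] by (auto split: if_splits)
qed

section \<open>Linear forms of difference arrangements\<close>

definition diff_form :: "nat \<Rightarrow> nat \<Rightarrow> int \<Rightarrow> 'k::field mpoly" where
  "diff_form i j c = var_poly i - var_poly j - of_int c * var_poly 0"

text \<open>Reduction modulo \<open>diff_form i j c\<close>, with the quotient ring realized as the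
  polynomials without x i. Congruences modulo the form thereby become equations.\<close>

definition elim_var :: "nat \<Rightarrow> nat \<Rightarrow> int \<Rightarrow> 'k::field mpoly \<Rightarrow> 'k mpoly" where
  "elim_var i j c = eval_poly const_poly (var_poly(i := var_poly j + of_int c * var_poly 0))"

lemma elim_var_hom:
  "elim_var i j c (p + q) = elim_var i j c p + elim_var i j c q"
  "elim_var i j c (p * q) = elim_var i j c p * elim_var i j c q"
  "elim_var i j c (- p) = - elim_var i j c p"
  "elim_var i j c (p - q) = elim_var i j c p - elim_var i j c q"
  "elim_var i j c (sum f A) = (\<Sum>a\<in>A. elim_var i j c (f a))"
  "elim_var i j c (prod f A) = (\<Prod>a\<in>A. elim_var i j c (f a))"
  "elim_var i j c (p ^ n) = elim_var i j c p ^ n"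
  by (simp_all add: elim_var_def poly_subst_hom)

lemma elim_var_simps [simp]:
  "elim_var i j c (const_poly a) = const_poly a"
  "elim_var i j c (of_int n) = of_int n"
  "elim_var i j c 0 = 0"
  "elim_var i j c 1 = 1"
  "elim_var i j c (var_poly k) = (if k = i then var_poly j + of_int c * var_poly 0 else var_poly k)"
  by (simp_all add: elim_var_def)

lemma diff_form_minus: "diff_form j i (- c) = - diff_form i j c"
  by (simp add: diff_form_def algebra_simps)

lemma int_var_poly:
  "of_int c * var_poly i = (Poly_Mapping.single (Poly_Mapping.single i 1) (of_int c) :: 'k::field mpoly)"
proof -
  have "of_int c * var_poly i = (const_poly (of_int c) * var_poly i :: 'k mpoly)"
    by (simp only: const_poly_of_int)
  then show ?thesis
    by (simp only: const_poly_def var_poly_def mult_single add_0_left mult_1_right)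
qed

lemma homogeneous_int_var: "homogeneous 1 (of_int c * var_poly i)"
  using homogeneous_mult[OF homogeneous_of_int homogeneous_var] by simp

lemma homogeneous_diff_form: "homogeneous 1 (diff_form i j c)"
  unfolding diff_form_def by (intro homogeneous_diff homogeneous_var homogeneous_int_var)

lemma homogeneous_elim_var: "homogeneous d p \<Longrightarrow> homogeneous d (elim_var i j c p)"
  unfolding elim_var_def
  by (erule homogeneous_subst) (simp add: homogeneous_add homogeneous_int_var del: One_nat_def)

lemma diff_form_in_ring: "i \<in> I \<Longrightarrow> j \<in> I \<Longrightarrow> 0 \<in> I \<Longrightarrow> diff_form i j c \<in> mpoly_ring I"
  unfolding diff_form_def by (intro mpoly_ring_closed mpoly_ring_var mpoly_ring_of_int)

lemma elim_var_in_ring: "p \<in> mpoly_ring I \<Longrightarrow> j \<in> I \<Longrightarrow> 0 \<in> I \<Longrightarrow> elim_var i j c p \<in> mpoly_ring I"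
  unfolding elim_var_def
  by (erule poly_subst_in_ring) (auto intro!: mpoly_ring_add mpoly_ring_mult mpoly_ring_var)

text \<open>Factor theorem, by induction on the polynomial. Consequently, for i distinct from j and
  0, the form generates the kernel of a homomorphism into a domain, which makes it prime.\<close>

lemma diff_form_dvd_diff_elim: "diff_form i j c dvd p - elim_var i j c p"
  using mpoly_ring_UNIV[of p]
proof (induction rule: mpoly_ring_induct)
  case (var k)
  then show ?case
    by (simp add: diff_form_def algebra_simps)
next
  case (add p q)
  have "p + q - elim_var i j c (p + q) = (p - elim_var i j c p) + (q - elim_var i j c q)"
    by (simp add: elim_var_hom)
  then show ?case
    using add.IH by (simp only: dvd_add)
next
  case (mult p q)
  have "p * q - elim_var i j c (p * q)
      = p * (q - elim_var i j c q) + (p - elim_var i j c p) * elim_var i j c q"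
    by (simp add: elim_var_hom algebra_simps)
  then show ?case
    using mult.IH by (simp only: dvd_add dvd_mult dvd_mult2)
qed simp

lemma elim_var_diff_form: "i \<noteq> j \<Longrightarrow> i \<noteq> 0 \<Longrightarrow> elim_var i j c (diff_form i j c) = 0"
  by (simp add: diff_form_def elim_var_hom)

lemma diff_form_dvd_iff:
  assumes "i \<noteq> j" "i \<noteq> 0"
  shows "diff_form i j c dvd p \<longleftrightarrow> elim_var i j c p = 0"
proof
  assume "diff_form i j c dvd p"
  then show "elim_var i j c p = 0"
    using elim_var_diff_form[OF assms] by (auto simp: dvd_def elim_var_hom)
next
  assume "elim_var i j c p = 0"
  then show "diff_form i j c dvd p"
    using diff_form_dvd_diff_elim[of i j c p] by simp
qed

lemma diff_form_prime:
  "i \<noteq> j \<Longrightarrow> i \<noteq> 0 \<Longrightarrow> diff_form i j c dvd p * q \<Longrightarrow> diff_form i j c dvd p \<or> diff_form i j c dvd q"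
  by (simp add: diff_form_dvd_iff elim_var_hom)

lemma elim_var_idem:
  assumes "i \<noteq> j" "i \<noteq> 0"
  shows "elim_var i j c (elim_var i j c p) = elim_var i j c p"
  using mpoly_ring_UNIV[of p]
  by (induction rule: mpoly_ring_induct) (use assms in \<open>simp_all add: elim_var_hom\<close>)

lemma single_eq_single_iff:
  "n \<noteq> 0 \<Longrightarrow> Poly_Mapping.single i n = Poly_Mapping.single j n \<longleftrightarrow> i = j"
  by (metis keys_single singleton_inject)

lemma lookup_var_poly:
  "Poly_Mapping.lookup (var_poly i) (Poly_Mapping.single j (Suc 0)) = (if i = j then 1 else 0)"
  by (auto simp: var_poly_def lookup_single when_def single_eq_single_iff)

lemma lookup_int_var_poly:
  "Poly_Mapping.lookup (of_int c * var_poly i :: 'k::field mpoly) (Poly_Mapping.single j (Suc 0)) =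
    (if i = j then of_int c else 0)"
  by (auto simp: int_var_poly lookup_single when_def single_eq_single_iff)

lemma var_poly_neq_0 [simp]: "var_poly i \<noteq> 0"
  using lookup_var_poly[of i i] by (metis lookup_zero zero_neq_one)

text \<open>After eliminating x i, some coefficient of degree one survives. Where it is the
  coefficient of z, it is a nonzero integer, and characteristic zero keeps it nonzero in the
  field.\<close>

lemma not_diff_form_dvd:
  fixes c d :: int
  assumes ij: "i \<noteq> j" "i \<noteq> 0" "j \<noteq> 0" and kl: "k \<noteq> l" "k \<noteq> 0" "l \<noteq> 0"
    and ne: "\<not> (k = i \<and> l = j \<and> d = c)" "\<not> (k = j \<and> l = i \<and> d = - c)"
  shows "\<not> (diff_form i j c :: 'k::field_char_0 mpoly) dvd diff_form k l d"
proof
  let ?p = "elim_var i j c (diff_form k l d) :: 'k mpoly"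
  assume "(diff_form i j c :: 'k mpoly) dvd diff_form k l d"
  then have 0: "?p = 0"
    using diff_form_dvd_iff[OF ij(1,2)] by blast
  have look: "Poly_Mapping.lookup ?p (Poly_Mapping.single n (Suc 0)) = 0" for n
    by (simp add: 0)
  note rules = diff_form_def elim_var_hom lookup_minus lookup_add lookup_var_poly lookup_int_var_poly
  consider "k = i" "l = j" | "k = i" "l \<noteq> j" | "k = j" "l = i" | "k \<noteq> i" "k \<noteq> j" "l = i" | "k \<noteq> i" "l \<noteq> i"
    using kl ij by blast
  then show False
  proof cases
    case 1
    then show ?thesis
      using look[of 0] ne ij kl by (simp add: rules)
  next
    case 2
    then show ?thesis
      using look[of j] ne ij kl by (simp add: rules)
  next
    case 3
    then have "of_int (- c - d) = (0::'k)"
      using look[of 0] ne ij kl by (simp add: rules)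
    then have "- c - d = 0"
      by (simp only: of_int_eq_0_iff)
    then show ?thesis
      using ne 3 by simp
  next
    case 4
    then show ?thesis
      using look[of k] ne ij kl by (simp add: rules)
  next
    case 5
    then show ?thesis
      using look[of k] ne ij kl by (simp add: rules)
  qed
qed

lemma not_diff_form_dvd_var_0_power:
  assumes "i \<noteq> j" "i \<noteq> 0"
  shows "\<not> diff_form i j c dvd var_poly 0 ^ n"
  using assms by (simp add: diff_form_dvd_iff elim_var_hom)

lemma diff_form_nonzero:
  assumes "i \<noteq> j" "i \<noteq> 0"
  shows "(diff_form i j c :: 'k::field_char_0 mpoly) \<noteq> 0"
proof -
  have "Poly_Mapping.lookup (diff_form i j c :: 'k mpoly) (Poly_Mapping.single i (Suc 0)) = 1"
    using assms by (simp add: diff_form_def lookup_minus lookup_var_poly lookup_int_var_poly)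
  then show ?thesis
    by (metis lookup_zero zero_neq_one)
qed

text \<open>A prime that divides f but not the product of the primes already split off must divide
  the cofactor.\<close>

lemma prod_dvd_of_primes:
  fixes p :: "'a \<Rightarrow> 'r::comm_ring_1"
  assumes "finite A"
    and prime: "\<And>a x y. a \<in> A \<Longrightarrow> p a dvd x * y \<Longrightarrow> p a dvd x \<or> p a dvd y"
    and unit: "\<And>a. a \<in> A \<Longrightarrow> \<not> p a dvd 1"
    and distinct: "\<And>a b. a \<in> A \<Longrightarrow> b \<in> A \<Longrightarrow> a \<noteq> b \<Longrightarrow> \<not> p a dvd p b"
    and dvd: "\<And>a. a \<in> A \<Longrightarrow> p a dvd f"
  shows "prod p A dvd f"
proof -
  have ndvd: "\<not> p a dvd prod p B" if "finite B" "B \<subseteq> A" "a \<in> A" "a \<notin> B" for a B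
    using that
  proof (induction B rule: finite_induct)
    case empty
    then show ?case
      using unit[of a] by simp
  next
    case (insert b B)
    then have "\<not> p a dvd p b" "\<not> p a dvd prod p B"
      using distinct[of a b] by auto
    then have "\<not> p a dvd p b * prod p B"
      using prime[OF \<open>a \<in> A\<close>] by blast
    then show ?case
      using insert.hyps by simp
  qed
  have "prod p B dvd f" if "finite B" "B \<subseteq> A" for B
    using that
  proof (induction B rule: finite_induct)
    case (insert a B)
    then have a: "a \<in> A" and B: "B \<subseteq> A" and "prod p B dvd f"
      by auto
    then obtain g where g: "f = prod p B * g"
      by (elim dvdE)
    have "p a dvd g"
      using prime[OF a, of "prod p B" g] dvd[OF a] ndvd[OF insert.hyps(1) B a insert.hyps(2)]
      unfolding g by blast
    then have "prod p B * p a dvd f"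
      unfolding g by (rule mult_dvd_mono[OF dvd_refl])
    then show ?case
      using insert.hyps by (simp add: mult.commute)
  qed simp
  then show ?thesis
    using \<open>finite A\<close> by blast
qed

section \<open>Modules of difference arrangements\<close>

definition diff_module :: "nat set \<Rightarrow> (nat \<Rightarrow> nat \<Rightarrow> int set) \<Rightarrow> (nat \<Rightarrow> 'k::field mpoly) set" where
  "diff_module V C = {f. \<forall>i\<in>V. \<forall>j\<in>V. i \<noteq> j \<longrightarrow> (\<forall>c\<in>C i j. diff_form i j c dvd f i - f j)}"

text \<open>The rank equals the number of vertices, so V itself indexes the basis and exponents
  become labels of vertices. Vectors are compared on V only. The entries of the basis use the
  variables of the cone, while the coefficients c range over polynomials in all variables.\<close>

definition graded_basis ::
    "nat set \<Rightarrow> (nat \<Rightarrow> nat \<Rightarrow> int set) \<Rightarrow> (nat \<Rightarrow> nat) \<Rightarrow> (nat \<Rightarrow> nat \<Rightarrow> 'k::field mpoly) \<Rightarrow> bool" where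
  "graded_basis V C e b \<longleftrightarrow>
    (\<forall>u\<in>V. b u \<in> diff_module V C \<and>
       (\<forall>v\<in>V. homogeneous (e u) (b u v) \<and> b u v \<in> mpoly_ring (insert 0 V))) \<and>
    (\<forall>f\<in>diff_module V C. \<exists>c. \<forall>v\<in>V. f v = (\<Sum>u\<in>V. c u * b u v)) \<and>
    (\<forall>c. (\<forall>v\<in>V. (\<Sum>u\<in>V. c u * b u v) = 0) \<longrightarrow> (\<forall>u\<in>V. c u = 0))"

lemma diff_moduleD:
  "f \<in> diff_module V C \<Longrightarrow> i \<in> V \<Longrightarrow> j \<in> V \<Longrightarrow> i \<noteq> j \<Longrightarrow> c \<in> C i j \<Longrightarrow> diff_form i j c dvd f i - f j"
  by (auto simp: diff_module_def)

lemma diff_moduleI: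
  "(\<And>i j c. i \<in> V \<Longrightarrow> j \<in> V \<Longrightarrow> i \<noteq> j \<Longrightarrow> c \<in> C i j \<Longrightarrow> diff_form i j c dvd f i - f j) \<Longrightarrow> f \<in> diff_module V C"
  by (auto simp: diff_module_def)

lemma diff_module_add:
  assumes "f \<in> diff_module V C" "g \<in> diff_module V C"
  shows "(\<lambda>v. f v + g v) \<in> diff_module V C"
proof (rule diff_moduleI)
  fix i j c
  assume *: "i \<in> V" "j \<in> V" "i \<noteq> j" "c \<in> C i j"
  have "diff_form i j c dvd (f i - f j) + (g i - g j)"
    by (intro dvd_add diff_moduleD[OF assms(1)] diff_moduleD[OF assms(2)] *)
  then show "diff_form i j c dvd f i + g i - (f j + g j)"
    by (simp add: algebra_simps)
qed

lemma diff_module_scale: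
  assumes "f \<in> diff_module V C"
  shows "(\<lambda>v. p * f v) \<in> diff_module V C"
  by (rule diff_moduleI) (simp add: dvd_mult diff_moduleD[OF assms] flip: right_diff_distrib)

lemma diff_module_diff:
  assumes "f \<in> diff_module V C" "g \<in> diff_module V C"
  shows "(\<lambda>v. f v - g v) \<in> diff_module V C"
  using diff_module_add[OF assms(1) diff_module_scale[OF assms(2), of "- 1"]] by simp

lemma graded_basisD:
  assumes "graded_basis V C e b"
  shows "\<And>u. u \<in> V \<Longrightarrow> b u \<in> diff_module V C"
    and "\<And>u v. u \<in> V \<Longrightarrow> v \<in> V \<Longrightarrow> homogeneous (e u) (b u v)"
    and "\<And>u v. u \<in> V \<Longrightarrow> v \<in> V \<Longrightarrow> b u v \<in> mpoly_ring (insert 0 V)"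
    and "\<And>f. f \<in> diff_module V C \<Longrightarrow> \<exists>c. \<forall>v\<in>V. f v = (\<Sum>u\<in>V. c u * b u v)"
    and "\<And>c u. (\<And>v. v \<in> V \<Longrightarrow> (\<Sum>u\<in>V. c u * b u v) = 0) \<Longrightarrow> u \<in> V \<Longrightarrow> c u = 0"
  using assms unfolding graded_basis_def by blast+

lemma graded_basis_reindex:
  fixes b :: "nat \<Rightarrow> nat \<Rightarrow> 'k::field mpoly"
  assumes b: "graded_basis V C e b" and \<pi>: "bij_betw \<pi> V V"
    and e': "\<And>u. u \<in> V \<Longrightarrow> e' u = e (\<pi> u)"
  shows "graded_basis V C e' (\<lambda>u. b (\<pi> u))"
  unfolding graded_basis_def
proof (intro conjI ballI allI impI)
  have \<pi>V: "\<pi> u \<in> V" if "u \<in> V" for u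
    using \<pi> that by (auto simp: bij_betw_def)
  fix u
  assume u: "u \<in> V"
  show "b (\<pi> u) \<in> diff_module V C"
    using graded_basisD(1)[OF b] \<pi>V u by blast
  fix v
  assume "v \<in> V"
  then show "homogeneous (e' u) (b (\<pi> u) v)" "b (\<pi> u) v \<in> mpoly_ring (insert 0 V)"
    using graded_basisD(2,3)[OF b \<pi>V[OF u]] e' u by simp_all
next
  fix f :: "nat \<Rightarrow> 'k mpoly"
  assume "f \<in> diff_module V C"
  then obtain c where c: "\<forall>v\<in>V. f v = (\<Sum>u\<in>V. c u * b u v)"
    using graded_basisD(4)[OF b] by blast
  have "(\<Sum>u\<in>V. c (\<pi> u) * b (\<pi> u) v) = (\<Sum>u\<in>V. c u * b u v)" for v
    by (rule sum.reindex_bij_betw[OF \<pi>])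
  with c show "\<exists>c. \<forall>v\<in>V. f v = (\<Sum>u\<in>V. c u * b (\<pi> u) v)"
    by (intro exI[of _ "\<lambda>u. c (\<pi> u)"]) simp
next
  fix c :: "nat \<Rightarrow> 'k mpoly" and u
  assume *: "\<forall>v\<in>V. (\<Sum>u\<in>V. c u * b (\<pi> u) v) = 0" and u: "u \<in> V"
  define d where "d u = c (inv_into V \<pi> u)" for u
  have d: "d (\<pi> u) = c u" if "u \<in> V" for u
    unfolding d_def using \<pi> that by (simp add: bij_betw_def)
  have "(\<Sum>u\<in>V. d u * b u v) = 0" if v: "v \<in> V" for v
  proof -
    have "(\<Sum>u\<in>V. d u * b u v) = (\<Sum>u\<in>V. d (\<pi> u) * b (\<pi> u) v)"
      by (rule sum.reindex_bij_betw[OF \<pi>, symmetric])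
    also have "\<dots> = (\<Sum>u\<in>V. c u * b (\<pi> u) v)"
      using d by (intro sum.cong) auto
    finally show ?thesis
      using * v by simp
  qed
  moreover have "\<pi> u \<in> V"
    using \<pi> u by (auto simp: bij_betw_def)
  ultimately have "d (\<pi> u) = 0"
    by (rule graded_basisD(5)[where c = d, OF b])
  then show "c u = 0"
    using d[OF u] by simp
qed

text \<open>In the component of degree d, the coefficient of b u has degree d - e u, so vectors of
  exponent above d drop out.\<close>

lemma graded_basis_coeffs:
  assumes b: "graded_basis V C e b" and f: "f \<in> diff_module V C"
    and hom: "\<And>v. v \<in> V \<Longrightarrow> homogeneous d (f v)"
  obtains c where "\<And>v. v \<in> V \<Longrightarrow> f v = (\<Sum>u\<in>V. c u * b u v)" "\<And>u. d < e u \<Longrightarrow> c u = 0"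
proof -
  obtain c where c: "\<forall>v\<in>V. f v = (\<Sum>u\<in>V. c u * b u v)"
    using graded_basisD(4)[OF b f] by blast
  define c' where "c' u = (if e u \<le> d then hom_part (d - e u) (c u) else 0)" for u
  have "f v = (\<Sum>u\<in>V. c' u * b u v)" if v: "v \<in> V" for v
  proof -
    have "f v = hom_part d (f v)"
      using hom_part_of_homogeneous[OF hom[OF v]] by simp
    also have "\<dots> = (\<Sum>u\<in>V. hom_part d (c u * b u v))"
      using c v by (simp add: hom_part_sum)
    also have "\<dots> = (\<Sum>u\<in>V. c' u * b u v)"
      unfolding c'_def
      by (intro sum.cong refl) (simp add: hom_part_mult[OF graded_basisD(2)[OF b _ v]])
    finally show ?thesis .
  qed
  then show ?thesis
    by (intro that[of c']) (auto simp: c'_def)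
qed

section \<open>The addition theorem\<close>

text \<open>The basis stays independent modulo the form of a hyperplane outside C. If that form
  divides a combination f, the quotient is again in the module, because each form of C is prime and
  does not divide the new one. Expanding the quotient in the basis and comparing coefficients
  exhibits each x u as a multiple of the form.\<close>

lemma graded_basis_saturated:
  fixes b :: "nat \<Rightarrow> nat \<Rightarrow> 'k::field_char_0 mpoly"
  assumes b: "graded_basis V C e b" and V: "0 \<notin> V" and hr: "h \<in> V" "r \<in> V" "h \<noteq> r"
    and sym: "\<And>i j c. c \<in> C i j \<Longrightarrow> - c \<in> C j i" and c0: "c0 \<notin> C h r"
    and x: "\<And>v. v \<in> V \<Longrightarrow> elim_var h r c0 (\<Sum>u\<in>V. x u * b u v) = 0" and u: "u \<in> V"
  shows "elim_var h r c0 (x u) = 0"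
proof -
  let ?\<alpha> = "diff_form h r c0 :: 'k mpoly"
  have h0: "h \<noteq> 0" "r \<noteq> 0"
    using V hr by metis+
  define f where "f v = (\<Sum>u\<in>V. x u * b u v)" for v
  have "\<exists>w. f v = ?\<alpha> * w" if "v \<in> V" for v
    using x[OF that] diff_form_dvd_iff[OF hr(3) h0(1), of c0 "f v"] unfolding f_def dvd_def by blast
  then obtain w where w: "\<And>v. v \<in> V \<Longrightarrow> f v = ?\<alpha> * w v"
    by metis
  have f: "f \<in> diff_module V C"
  proof -
    have "(\<lambda>v. \<Sum>u\<in>U. x u * b u v) \<in> diff_module V C" if "finite U" "U \<subseteq> V" for U
      using that
    proof (induction U rule: finite_induct)
      case empty
      then show ?case
        by (intro diff_moduleI) simp
    next
      case (insert a U)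
      then have "(\<lambda>v. x a * b a v + (\<Sum>u\<in>U. x u * b u v)) \<in> diff_module V C"
        by (intro diff_module_add diff_module_scale graded_basisD(1)[OF b]) auto
      then show ?case
        using insert.hyps by simp
    qed
    moreover have "f = (\<lambda>v. 0)" if "infinite V"
      unfolding f_def using that by simp
    moreover have "(\<lambda>v. 0) \<in> diff_module V C"
      by (intro diff_moduleI) simp
    ultimately show ?thesis
      unfolding f_def by (cases "finite V") auto
  qed
  have "w \<in> diff_module V C"
  proof (rule diff_moduleI)
    fix i j c
    assume ij: "i \<in> V" "j \<in> V" "i \<noteq> j" and c: "c \<in> C i j"
    have ij0: "i \<noteq> 0" "j \<noteq> 0"
      using ij V by metis+
    have "f i - f j = ?\<alpha> * (w i - w j)"
      using w ij by (simp add: right_diff_distrib)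
    then have "diff_form i j c dvd ?\<alpha> * (w i - w j)"
      using diff_moduleD[of f V C i j c] f ij c by simp
    moreover have "\<not> diff_form i j c dvd ?\<alpha>"
      using not_diff_form_dvd[OF ij(3) ij0 hr(3) h0, of c0 c] c0 c sym[OF c] by blast
    ultimately show "diff_form i j c dvd w i - w j"
      using diff_form_prime[OF ij(3) ij0(1)] by blast
  qed
  then obtain y where y: "\<forall>v\<in>V. w v = (\<Sum>u\<in>V. y u * b u v)"
    using graded_basisD(4)[OF b] by blast
  have zero: "\<forall>v\<in>V. (\<Sum>u\<in>V. (x u - ?\<alpha> * y u) * b u v) = 0"
  proof
    fix v
    assume v: "v \<in> V"
    have "(\<Sum>u\<in>V. (x u - ?\<alpha> * y u) * b u v) = f v - ?\<alpha> * (\<Sum>u\<in>V. y u * b u v)"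
      unfolding f_def by (simp add: left_diff_distrib sum_subtractf sum_distrib_left mult.assoc)
    then show "(\<Sum>u\<in>V. (x u - ?\<alpha> * y u) * b u v) = 0"
      using w[OF v] y v by simp
  qed
  have "\<forall>c. (\<forall>v\<in>V. (\<Sum>u\<in>V. c u * b u v) = 0) \<longrightarrow> (\<forall>u\<in>V. c u = 0)"
    using b unfolding graded_basis_def by (elim conjE)
  from this[rule_format, of "\<lambda>u. x u - ?\<alpha> * y u", OF bspec[OF zero] u]
  have "x u = ?\<alpha> * y u"
    by simp
  then show ?thesis
    by (simp add: elim_var_hom elim_var_diff_form[OF hr(3) h0(1)])
qed

text \<open>Adding the hyperplane \<open>x h - x r = c0 z\<close> to the arrangement \<open>C\<close>; restricting to it
  identifies \<open>x h\<close> with \<open>x r + c0 z\<close>, and \<open>C2\<close> is the restricted arrangement.\<close>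

locale addition =
  fixes V :: "nat set" and C C1 C2 :: "nat \<Rightarrow> nat \<Rightarrow> int set" and e :: "nat \<Rightarrow> nat"
    and h r :: nat and c0 :: int
  assumes finV: "finite V" and V0: "0 \<notin> V" and hV: "h \<in> V" and rV: "r \<in> V" and hr: "h \<noteq> r"
    and sym: "\<And>i j c. c \<in> C i j \<Longrightarrow> - c \<in> C j i" and finC: "\<And>i j. finite (C i j)" and c0: "c0 \<notin> C h r"
    and C1: "\<And>i j. i \<in> V \<Longrightarrow> j \<in> V \<Longrightarrow> i \<noteq> j \<Longrightarrow>
      C1 i j = (if i = h \<and> j = r then insert c0 (C h r)
                else if i = r \<and> j = h then insert (- c0) (C r h) else C i j)"
    and C2: "\<And>i j. i \<in> V - {h, r} \<Longrightarrow> j \<in> V - {h, r} \<Longrightarrow> C2 i j \<subseteq> C i j"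
      "\<And>m. m \<in> V - {h, r} \<Longrightarrow> C2 r m \<subseteq> C r m \<union> {c. c + c0 \<in> C h m}"
      "\<And>m. m \<in> V - {h, r} \<Longrightarrow> C2 m r \<subseteq> C m r \<union> {c. c - c0 \<in> C m h}"
    and eh: "e h = card (C h r) + (\<Sum>m\<in>V - {h, r}. card {c \<in> C r m. c + c0 \<in> C h m})"
begin

abbreviation \<phi> :: "'k::field mpoly \<Rightarrow> 'k mpoly" where "\<phi> \<equiv> elim_var h r c0"

lemma h0: "h \<noteq> 0" "r \<noteq> 0"
  using V0 hV rV by metis+

text \<open>Only one divisibility is new, and modulo the new form it says that two coordinates
  agree.\<close>

lemma diff_module_C1_iff:
  fixes f :: "nat \<Rightarrow> 'k::field_char_0 mpoly"
  shows "f \<in> diff_module V C1 \<longleftrightarrow> f \<in> diff_module V C \<and> \<phi> (f h) = \<phi> (f r)"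
proof (intro iffI conjI)
  assume f: "f \<in> diff_module V C1"
  show "f \<in> diff_module V C"
  proof (rule diff_moduleI)
    fix i j c
    assume "i \<in> V" "j \<in> V" "i \<noteq> j" "c \<in> C i j"
    moreover from this have "c \<in> C1 i j"
      using C1[of i j] by auto
    ultimately show "diff_form i j c dvd f i - f j"
      using diff_moduleD[of f V C1 i j c] f by blast
  qed
  have "diff_form h r c0 dvd f h - f r"
    using diff_moduleD[of f V C1 h r c0] f hV rV hr C1[of h r] by simp
  then show "\<phi> (f h) = \<phi> (f r)"
    using diff_form_dvd_iff[OF hr h0(1), of c0 "f h - f r"] by (simp add: elim_var_hom)
next
  assume f: "f \<in> diff_module V C \<and> \<phi> (f h) = \<phi> (f r)"
  then have \<alpha>: "diff_form h r c0 dvd f h - f r"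
    using diff_form_dvd_iff[OF hr h0(1), of c0 "f h - f r"] by (simp add: elim_var_hom)
  show "f \<in> diff_module V C1"
  proof (rule diff_moduleI)
    fix i j c
    assume ij: "i \<in> V" "j \<in> V" "i \<noteq> j" "c \<in> C1 i j"
    then consider "c \<in> C i j" | "i = h" "j = r" "c = c0" | "i = r" "j = h" "c = - c0"
      using C1[of i j] by (auto split: if_splits)
    then show "diff_form i j c dvd f i - f j"
    proof cases
      case 1
      then show ?thesis
        using diff_moduleD[of f V C i j c] f ij by blast
    next
      case 2
      then show ?thesis
        using \<alpha> by simp
    next
      case 3
      have "- diff_form h r c0 dvd - (f h - f r)"
        using \<alpha> by (simp only: minus_dvd_iff dvd_minus_iff)
      then show ?thesis
        using 3 by (simp add: diff_form_minus)
    qed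
  qed
qed

lemma elim_diff_form_h: "j \<noteq> h \<Longrightarrow> \<phi> (diff_form h j c) = diff_form r j (c - c0)"
  by (simp add: diff_form_def elim_var_hom h0 algebra_simps)

lemma elim_diff_form_h': "i \<noteq> h \<Longrightarrow> \<phi> (diff_form i h c) = diff_form i r (c + c0)"
  by (simp add: diff_form_def elim_var_hom h0 algebra_simps)

lemma elim_diff_form_other: "i \<noteq> h \<Longrightarrow> j \<noteq> h \<Longrightarrow> \<phi> (diff_form i j c) = diff_form i j c"
  using h0 by (simp add: diff_form_def elim_var_hom)

lemma elim_dvd:
  "p dvd q \<Longrightarrow> \<phi> p dvd \<phi> q"
  by (auto simp: dvd_def elim_var_hom)

text \<open>Each hyperplane of C2 is the trace of a hyperplane of C, whose form is mapped to that of
  the trace by \<open>\<phi>\<close>. Traces of hyperplanes at h are stated at r, which is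
  legitimate because the coordinates h and r have the same image.\<close>

lemma restriction_in_diff_module:
  fixes f :: "nat \<Rightarrow> 'k::field_char_0 mpoly"
  assumes "f \<in> diff_module V C1"
  shows "(\<lambda>v. \<phi> (f v)) \<in> diff_module (V - {h}) C2"
proof (rule diff_moduleI)
  have f: "f \<in> diff_module V C" "\<phi> (f h) = \<phi> (f r)"
    using assms by (simp_all add: diff_module_C1_iff)
  have \<phi>f: "\<phi> (diff_form i j c) dvd \<phi> (f i) - \<phi> (f j)" if "i \<in> V" "j \<in> V" "i \<noteq> j" "c \<in> C i j" for i j c
    using elim_dvd[OF diff_moduleD[of f V C i j c]] f that by (simp add: elim_var_hom)
  fix i j c
  assume ij: "i \<in> V - {h}" "j \<in> V - {h}" "i \<noteq> j" and c: "c \<in> C2 i j"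
  consider "c \<in> C i j" | "i = r" "c + c0 \<in> C h j" | "j = r" "c - c0 \<in> C i h"
    using C2(1)[of i j] C2(2)[of j] C2(3)[of i] ij c by blast
  then show "diff_form i j c dvd \<phi> (f i) - \<phi> (f j)"
  proof cases
    case 1
    then show ?thesis
      using \<phi>f[of i j c] ij by (simp add: elim_diff_form_other)
  next
    case 2
    then show ?thesis
      using \<phi>f[of h j "c + c0"] ij f(2) hV by (simp add: elim_diff_form_h)
  next
    case 3
    then show ?thesis
      using \<phi>f[of i h "c - c0"] ij f(2) hV by (simp add: elim_diff_form_h')
  qed
qed

section \<open>Terao's polynomial and the degree argument\<close>

definition collisions :: "(nat \<times> int) set" where
  "collisions = (SIGMA m:V - {h, r}. {c \<in> C r m. c + c0 \<in> C h m})"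

text \<open>Terao's polynomial B. On the new hyperplane all hyperplanes at (h, r) become z = 0, and
  a collision is a pair of hyperplanes at (r, m) and (h, m) with the same trace. So the degree of B,
  which is e h, counts the hyperplanes lost by restricting C.\<close>

definition conductor :: "'k::field_char_0 mpoly" where
  "conductor = (\<Prod>(m, c)\<in>collisions. diff_form r m c) * var_poly 0 ^ card (C h r)"

lemma finite_collisions: "finite collisions"
  unfolding collisions_def using finV finC by auto

lemma conductor_homogeneous: "homogeneous (e h) conductor"
proof -
  have "homogeneous (sum (\<lambda>_. 1) collisions) (\<Prod>(m, c)\<in>collisions. diff_form r m c)"
    by (rule homogeneous_prod) (auto simp: homogeneous_diff_form simp del: One_nat_def)
  moreover have "homogeneous (card (C h r) * 1) (var_poly 0 ^ card (C h r))"
    by (rule homogeneous_power[OF homogeneous_var])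
  moreover have "card collisions = (\<Sum>m\<in>V - {h, r}. card {c \<in> C r m. c + c0 \<in> C h m})"
    unfolding collisions_def using finV finC by (subst card_SigmaI) auto
  ultimately show ?thesis
    unfolding conductor_def using homogeneous_mult by (fastforce simp: eh add.commute)
qed

lemma conductor_nonzero: "conductor \<noteq> 0"
  unfolding conductor_def using finite_collisions
  by (auto simp: prod_zero_iff diff_form_nonzero h0 collisions_def)

lemma elim_conductor: "\<phi> conductor = conductor"
proof -
  have "(\<Prod>a\<in>collisions. \<phi> (case a of (m, c) \<Rightarrow> diff_form r m c)) = (\<Prod>(m, c)\<in>collisions. diff_form r m c)"
    using hr by (intro prod.cong) (auto simp: collisions_def elim_diff_form_other)
  then show ?thesis
    unfolding conductor_def using h0 by (simp add: elim_var_hom)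
qed

lemma conductor_in_ring: "conductor \<in> mpoly_ring (insert 0 V)"
  unfolding conductor_def using rV
  by (auto simp: collisions_def intro!: mpoly_ring_closed mpoly_ring_var diff_form_in_ring)

text \<open>The forms at (h, r) divide f h - f r and reduce to integer multiples of z, which gives
  the power of z. At a collision, the forms at (h, m) and (r, m) reduce to the same form; it divides
  the reductions of f h - f m and f r - f m, hence also that of f h - f r. The factors so obtained
  are primes none of which divides another or a power of z.\<close>

lemma conductor_dvd:
  fixes f :: "nat \<Rightarrow> 'k::field_char_0 mpoly"
  assumes f: "f \<in> diff_module V C"
  shows "conductor dvd \<phi> (f h - f r)"
proof -
  let ?P = "\<Prod>c\<in>C h r. diff_form h r c :: 'k mpoly"
  have "?P dvd f h - f r"
  proof (rule prod_dvd_of_primes)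
    show "finite (C h r)"
      by (rule finC)
    fix a
    assume a: "a \<in> C h r"
    show "diff_form h r a dvd x \<or> diff_form h r a dvd y" if "diff_form h r a dvd x * y" for x y :: "'k mpoly"
      using diff_form_prime[OF hr h0(1) that] .
    show "\<not> (diff_form h r a :: 'k mpoly) dvd 1"
      using not_diff_form_dvd_var_0_power[OF hr h0(1), of a 0] by simp
    show "diff_form h r a dvd f h - f r"
      using diff_moduleD[of f V C h r a] f hV rV hr a by blast
    fix b
    assume "b \<in> C h r" "a \<noteq> b"
    then show "\<not> (diff_form h r a :: 'k mpoly) dvd diff_form h r b"
      using not_diff_form_dvd[of h r h r b a] hr h0 by auto
  qed
  then have "\<phi> ?P dvd \<phi> (f h - f r)"
    by (rule elim_dvd)
  moreover have "\<phi> ?P = of_int (\<Prod>c\<in>C h r. c0 - c) * var_poly 0 ^ card (C h r)"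
  proof -
    have "\<phi> (diff_form h r c) = (of_int (c0 - c) * var_poly 0 :: 'k mpoly)" for c
      using h0 hr by (simp add: diff_form_def elim_var_hom algebra_simps)
    then show ?thesis
      by (simp add: elim_var_hom prod.distrib)
  qed
  moreover have "(var_poly 0 ^ card (C h r) :: 'k mpoly) dvd of_int (\<Prod>c\<in>C h r. c0 - c) * var_poly 0 ^ card (C h r)"
    by simp
  moreover have "of_int n * p dvd q \<Longrightarrow> p dvd (q :: 'k mpoly)" for n p q
    by (rule dvd_mult_right)
  ultimately have "var_poly 0 ^ card (C h r) dvd \<phi> (f h - f r)"
    by metis
  then obtain g where g: "\<phi> (f h - f r) = var_poly 0 ^ card (C h r) * g"
    by (elim dvdE)
  let ?q = "\<lambda>a. (case a of (m, c) \<Rightarrow> diff_form r m c) :: 'k mpoly"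
  have "prod ?q collisions dvd g"
  proof (rule prod_dvd_of_primes[OF finite_collisions])
    fix a
    assume a: "a \<in> collisions"
    then obtain m c where mc: "a = (m, c)" "m \<in> V" "m \<noteq> h" "m \<noteq> r" "c \<in> C r m" "c + c0 \<in> C h m"
      unfolding collisions_def by auto
    have rm: "r \<noteq> m"
      using mc by auto
    show prime: "?q a dvd x \<or> ?q a dvd y" if "?q a dvd x * y" for x y
      using diff_form_prime[OF rm h0(2), of c x y] that mc(1) by simp
    show "\<not> ?q a dvd 1"
      using not_diff_form_dvd_var_0_power[OF rm h0(2), of c 0] mc(1) by simp
    have "diff_form h m (c + c0) dvd f h - f m" "diff_form r m c dvd f r - f m"
      using diff_moduleD[of f V C h m "c + c0"] diff_moduleD[of f V C r m c] f mc hV rV by blast+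
    then have "diff_form r m c dvd \<phi> (f h - f m)" "diff_form r m c dvd \<phi> (f r - f m)"
      using elim_dvd[of "diff_form h m (c + c0)" "f h - f m"] elim_dvd[of "diff_form r m c" "f r - f m"] mc hr
      by (simp_all add: elim_diff_form_h elim_diff_form_other)
    then have "diff_form r m c dvd \<phi> (f h - f m) - \<phi> (f r - f m)"
      by (rule dvd_diff)
    then have "diff_form r m c dvd var_poly 0 ^ card (C h r) * g"
      unfolding g[symmetric] by (simp add: elim_var_hom)
    then show "?q a dvd g"
      using diff_form_prime[OF rm h0(2), of c "var_poly 0 ^ card (C h r)" g]
        not_diff_form_dvd_var_0_power[OF rm h0(2), of c "card (C h r)"] mc(1) by auto
    fix b
    assume b: "b \<in> collisions" "a \<noteq> b"
    then obtain m' c' where b': "b = (m', c')" "m' \<in> V" "m' \<noteq> h" "m' \<noteq> r"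
      unfolding collisions_def by auto
    have "m \<noteq> 0" "m' \<noteq> 0"
      using mc(2) b'(2) V0 by metis+
    then show "\<not> ?q a dvd ?q b"
      using not_diff_form_dvd[of r m r m' c' c] b b' mc h0 rm by auto
  qed
  then show ?thesis
    unfolding conductor_def g by (subst mult.commute) (rule mult_dvd_mono[OF dvd_refl])
qed

text \<open>The degree bound is the point: a basis vector of exponent below e h has quotient zero
  and therefore already respects the new hyperplane.\<close>

lemma conductor_quotient:
  fixes b :: "nat \<Rightarrow> nat \<Rightarrow> 'k::field_char_0 mpoly"
  assumes b: "graded_basis V C e b" and u: "u \<in> V"
  obtains s where "\<phi> (b u h - b u r) = s * conductor" "\<phi> s = s" "s \<in> mpoly_ring (insert 0 V)"
    "s = 0 \<or> e h \<le> e u \<and> homogeneous (e u - e h) s"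
proof -
  obtain s where s: "\<phi> (b u h - b u r) = s * conductor"
    using conductor_dvd[OF graded_basisD(1)[OF b u]] by (metis dvd_def mult.commute)
  have "\<phi> s * conductor = s * conductor"
    using arg_cong[OF s, of \<phi>] s by (simp add: elim_var_hom elim_conductor elim_var_idem[OF hr h0(1)])
  then have "\<phi> s = s"
    by (simp add: conductor_nonzero)
  moreover have "homogeneous (e u) (s * conductor)"
    unfolding s[symmetric]
    by (intro homogeneous_elim_var homogeneous_diff graded_basisD(2)[OF b] u hV rV)
  from homogeneous_cancel[OF this conductor_homogeneous conductor_nonzero]
  have "s = 0 \<or> e h \<le> e u \<and> homogeneous (e u - e h) s" .
  moreover have "s \<in> mpoly_ring (insert 0 V)"
  proof (rule mpoly_ring_cancel[OF _ conductor_in_ring s conductor_nonzero])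
    show "\<phi> (b u h - b u r) \<in> mpoly_ring (insert 0 V)"
      using rV by (intro elim_var_in_ring mpoly_ring_diff graded_basisD(3)[OF b] u hV rV) auto
  qed
  ultimately show ?thesis
    using s that by blast
qed

text \<open>Otherwise all basis vectors of exponent at most e h would restrict to the module of C2,
  which has too few generators in these degrees. The resulting relation contradicts independence
  modulo the new form.\<close>

lemma exists_basis_element_of_conductor_degree:
  fixes b :: "nat \<Rightarrow> nat \<Rightarrow> 'k::field_char_0 mpoly" and b2 :: "nat \<Rightarrow> nat \<Rightarrow> 'k mpoly"
  assumes b: "graded_basis V C e b" and b2: "graded_basis (V - {h}) C2 e b2"
  shows "\<exists>u\<in>V. e u = e h \<and> \<phi> (b u h - b u r) \<noteq> 0"
proof (rule ccontr)
  assume contr: "\<not> ?thesis"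
  define K where "K = {u \<in> V. e u \<le> e h}"
  have K: "finite K" "K \<subseteq> V" "h \<in> K"
    using finV hV by (auto simp: K_def)
  have t0: "\<phi> (b u h) = \<phi> (b u r)" if u: "u \<in> K" for u
  proof -
    obtain s where s: "\<phi> (b u h - b u r) = s * conductor" "s = 0 \<or> e h \<le> e u \<and> homogeneous (e u - e h) s"
      using conductor_quotient[OF b, of u] u K by blast
    have "\<phi> (b u h - b u r) = 0"
      using s contr u by (cases "s = 0") (auto simp: K_def)
    then show ?thesis
      by (simp add: elim_var_hom)
  qed
  have "\<forall>u\<in>K. \<exists>c. (\<forall>v\<in>V - {h}. \<phi> (b u v) = (\<Sum>w\<in>V - {h}. c w * b2 w v)) \<and> (\<forall>w. e u < e w \<longrightarrow> c w = 0)"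
  proof
    fix u
    assume u: "u \<in> K"
    have uV: "u \<in> V"
      using u K by blast
    have "b u \<in> diff_module V C1"
      using graded_basisD(1)[OF b uV] t0[OF u] by (simp add: diff_module_C1_iff)
    then have mem: "(\<lambda>v. \<phi> (b u v)) \<in> diff_module (V - {h}) C2"
      by (rule restriction_in_diff_module)
    have hom: "\<And>v. v \<in> V - {h} \<Longrightarrow> homogeneous (e u) (\<phi> (b u v))"
      by (intro homogeneous_elim_var graded_basisD(2)[OF b uV]) blast
    obtain c where "\<And>v. v \<in> V - {h} \<Longrightarrow> \<phi> (b u v) = (\<Sum>w\<in>V - {h}. c w * b2 w v)"
      "\<And>w. e u < e w \<Longrightarrow> c w = 0"
      using graded_basis_coeffs[OF b2 mem hom] by blast
    then show "\<exists>c. (\<forall>v\<in>V - {h}. \<phi> (b u v) = (\<Sum>w\<in>V - {h}. c w * b2 w v)) \<and> (\<forall>w. e u < e w \<longrightarrow> c w = 0)"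
      by (intro exI[of _ c]) simp
  qed
  from bchoice[OF this] obtain c where
    c: "\<And>u v. u \<in> K \<Longrightarrow> v \<in> V - {h} \<Longrightarrow> \<phi> (b u v) = (\<Sum>w\<in>V - {h}. c u w * b2 w v)" and
    cz: "\<And>u w. u \<in> K \<Longrightarrow> e u < e w \<Longrightarrow> c u w = 0"
    by blast
  \<comment> \<open>For u in K, only vectors b2 w with e w at most e u can occur, and their indices
    lie in K without h: one generator fewer than there are vectors.\<close>
  let ?J = "K - {h}"
  have card: "card ?J < card K"
    using K by (intro psubset_card_mono) auto
  have cJ: "\<phi> (b u v) = (\<Sum>w\<in>?J. \<phi> (c u w) * \<phi> (b2 w v))" if u: "u \<in> K" and v: "v \<in> V - {h}" for u v
  proof -
    have "\<phi> (b u v) = \<phi> (\<phi> (b u v))"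
      by (simp only: elim_var_idem[OF hr h0(1)])
    also have "\<dots> = (\<Sum>w\<in>V - {h}. \<phi> (c u w) * \<phi> (b2 w v))"
      unfolding c[OF u v] by (simp add: elim_var_hom)
    also have "\<dots> = (\<Sum>w\<in>?J. \<phi> (c u w) * \<phi> (b2 w v))"
    proof (rule sum.mono_neutral_right)
      show "\<forall>w\<in>V - {h} - ?J. \<phi> (c u w) * \<phi> (b2 w v) = 0"
      proof
        fix w
        assume "w \<in> V - {h} - ?J"
        then have "e u < e w"
          using u by (auto simp: K_def)
        then show "\<phi> (c u w) * \<phi> (b2 w v) = 0"
          by (simp add: cz[OF u])
      qed
    qed (use finV K in auto)
    finally show ?thesis .
  qed
  \<comment> \<open>Coefficients fixed by \<open>\<phi>\<close> are not killed by the reduction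
    modulo the new form, so the relation stays nontrivial there.\<close>
  let ?F = "{p :: 'k mpoly. \<phi> p = p}"
  have "\<exists>x. (\<forall>k\<in>K. x k \<in> ?F) \<and> (\<exists>k\<in>K. x k \<noteq> 0) \<and> (\<forall>w\<in>?J. (\<Sum>k\<in>K. x k * \<phi> (c k w)) = 0)"
  proof (rule elimination[of ?J K "\<lambda>k w. \<phi> (c k w)" ?F])
    show "finite ?J" "finite K" "card ?J < card K"
      using K(1) card by simp_all
  qed (simp_all add: elim_var_hom elim_var_idem[OF hr h0(1)])
  then obtain x where x: "\<And>k. k \<in> K \<Longrightarrow> \<phi> (x k) = x k" "\<exists>k\<in>K. x k \<noteq> 0"
    "\<And>w. w \<in> ?J \<Longrightarrow> (\<Sum>k\<in>K. x k * \<phi> (c k w)) = 0"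
    by blast
  define x' where "x' u = (if u \<in> K then x u else 0)" for u
  have sumK: "(\<Sum>u\<in>V. x' u * b u v) = (\<Sum>u\<in>K. x u * b u v)" for v
    unfolding x'_def using K finV by (intro sum.mono_neutral_cong_right) auto
  have zero: "(\<Sum>u\<in>K. x u * \<phi> (b u v)) = 0" if v: "v \<in> V - {h}" for v
  proof -
    have "(\<Sum>u\<in>K. x u * \<phi> (b u v)) = (\<Sum>u\<in>K. \<Sum>w\<in>?J. x u * \<phi> (c u w) * \<phi> (b2 w v))"
      using cJ[OF _ v] by (simp add: sum_distrib_left mult.assoc)
    also have "\<dots> = (\<Sum>w\<in>?J. (\<Sum>u\<in>K. x u * \<phi> (c u w)) * \<phi> (b2 w v))"
      by (subst sum.swap) (simp only: sum_distrib_right)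
    also have "\<dots> = 0"
      using x(3) by (intro sum.neutral) simp
    finally show ?thesis .
  qed
  have zero': "\<phi> (\<Sum>u\<in>V. x' u * b u v) = 0" if v: "v \<in> V" for v
  proof -
    have "\<phi> (\<Sum>u\<in>V. x' u * b u v) = (\<Sum>u\<in>K. x u * \<phi> (b u v))"
      using x(1) by (simp add: sumK elim_var_hom)
    also have "\<dots> = 0"
    proof (cases "v = h")
      case True
      then have "(\<Sum>u\<in>K. x u * \<phi> (b u v)) = (\<Sum>u\<in>K. x u * \<phi> (b u r))"
        using t0 by simp
      also have "\<dots> = 0"
        using zero[of r] rV hr by simp
      finally show ?thesis .
    qed (use zero v in simp)
    finally show ?thesis .
  qed
  have "\<phi> (x' u) = 0" if "u \<in> V" for u
    by (rule graded_basis_saturated[OF b V0 hV rV hr sym c0 zero' that])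
  moreover have "\<phi> (x' u) = x u" if "u \<in> K" for u
    using x(1)[OF that] that by (simp add: x'_def)
  ultimately show False
    using x(2) K(2) by force
qed

text \<open>One basis vector of degree e h fails the new condition by a nonzero constant times the
  conductor. Multiples of it correct all other vectors, and multiplying it by the new form brings it
  into the module as well, which raises its degree by one.\<close>

lemma graded_basis_addition:
  fixes b :: "nat \<Rightarrow> nat \<Rightarrow> 'k::field_char_0 mpoly" and b2 :: "nat \<Rightarrow> nat \<Rightarrow> 'k mpoly"
  assumes b0: "graded_basis V C e b" and b2: "graded_basis (V - {h}) C2 e b2"
  shows "\<exists>b' :: nat \<Rightarrow> nat \<Rightarrow> 'k mpoly. graded_basis V C1 (e(h := Suc (e h))) b'"
proof -
  obtain u0 where u0: "u0 \<in> V" "e u0 = e h" "\<phi> (b u0 h - b u0 r) \<noteq> 0"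
    using exists_basis_element_of_conductor_degree[OF b0 b2] by blast
  \<comment> \<open>The vector just found is moved to index h; both indices have the same
    exponent.\<close>
  define \<theta> where "\<theta> u = b (transpose u0 h u)" for u
  have \<theta>: "graded_basis V C e \<theta>"
    unfolding \<theta>_def
  proof (rule graded_basis_reindex[OF b0])
    show "bij_betw (transpose u0 h) V V"
      using u0 hV by (simp add: bij_betw_transpose_iff)
    show "e u = e (transpose u0 h u)" for u
      using u0 by (simp add: transpose_def)
  qed
  have \<theta>h: "\<phi> (\<theta> h h - \<theta> h r) \<noteq> 0"
    using u0 by (simp add: \<theta>_def)
  have "\<forall>u\<in>V. \<exists>s. \<phi> (\<theta> u h - \<theta> u r) = s * conductor \<and> \<phi> s = s \<and> s \<in> mpoly_ring (insert 0 V) \<and>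
      (s = 0 \<or> e h \<le> e u \<and> homogeneous (e u - e h) s)"
    by (intro ballI, rule conductor_quotient[OF \<theta>]) blast+
  from bchoice[OF this] obtain s where s: "\<And>u. u \<in> V \<Longrightarrow> \<phi> (\<theta> u h - \<theta> u r) = s u * conductor"
    "\<And>u. u \<in> V \<Longrightarrow> \<phi> (s u) = s u" "\<And>u. u \<in> V \<Longrightarrow> s u \<in> mpoly_ring (insert 0 V)"
    "\<And>u. u \<in> V \<Longrightarrow> s u = 0 \<or> e h \<le> e u \<and> homogeneous (e u - e h) (s u)"
    by blast
  have sh: "s h \<noteq> 0" "homogeneous 0 (s h)"
    using s(1)[OF hV] s(4)[OF hV] \<theta>h by auto
  \<comment> \<open>Its quotient has degree e h - e h = 0, so it is a nonzero scalar and can be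
    inverted.\<close>
  obtain k where k: "s h = const_poly k"
    by (rule homogeneous_0_const[OF sh(2)])
  have "k \<noteq> 0"
    using sh(1) unfolding k by auto
  define g where "g u = const_poly (inverse k) * s u" for u
  have gs: "g u * s h = s u" for u
  proof -
    have "const_poly (inverse k) * s h = 1"
      unfolding k const_poly_mult using \<open>k \<noteq> 0\<close> by simp
    then show ?thesis
      unfolding g_def by (metis mult.assoc mult.commute mult_1_left)
  qed
  have \<phi>g: "\<phi> (g u) = g u" if "u \<in> V" for u
    using s(2)[OF that] by (simp add: g_def elim_var_hom)
  let ?\<alpha> = "diff_form h r c0 :: 'k mpoly"
  define \<psi> where "\<psi> u v = (if u = h then ?\<alpha> * \<theta> h v else \<theta> u v - g u * \<theta> h v)" for u v
  have combination: "(\<Sum>u\<in>V. y u * \<psi> u v) =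
      (\<Sum>u\<in>V. (if u = h then ?\<alpha> * y h - (\<Sum>w\<in>V - {h}. y w * g w) else y u) * \<theta> u v)" for y v
  proof -
    have "(\<Sum>u\<in>V. y u * \<psi> u v) = y h * (?\<alpha> * \<theta> h v) + (\<Sum>u\<in>V - {h}. y u * (\<theta> u v - g u * \<theta> h v))"
      using finV hV by (simp add: sum.remove[of V h] \<psi>_def)
    also have "(\<Sum>u\<in>V - {h}. y u * (\<theta> u v - g u * \<theta> h v)) =
        (\<Sum>u\<in>V - {h}. y u * \<theta> u v) - (\<Sum>w\<in>V - {h}. y w * g w) * \<theta> h v"
      by (simp add: right_diff_distrib sum_subtractf sum_distrib_right mult.assoc)
    finally show ?thesis
      using finV hV by (simp add: sum.remove[of V h] algebra_simps)
  qed
  have "graded_basis V C1 (e(h := Suc (e h))) \<psi>"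
    unfolding graded_basis_def
  proof (intro conjI ballI allI impI)
    fix u
    assume u: "u \<in> V"
    show "\<psi> u \<in> diff_module V C1"
    proof (cases "u = h")
      case True
      have "(\<lambda>v. ?\<alpha> * \<theta> h v) \<in> diff_module V C"
        by (rule diff_module_scale[OF graded_basisD(1)[OF \<theta> hV]])
      moreover have "\<phi> ?\<alpha> = 0"
        by (rule elim_var_diff_form[OF hr h0(1)])
      moreover have "\<psi> u = (\<lambda>v. ?\<alpha> * \<theta> h v)"
        using True by (simp add: \<psi>_def fun_eq_iff)
      ultimately show ?thesis
        by (simp add: diff_module_C1_iff elim_var_hom)
    next
      case False
      have "(\<lambda>v. \<theta> u v - g u * \<theta> h v) \<in> diff_module V C"
        by (intro diff_module_diff diff_module_scale graded_basisD(1)[OF \<theta>] u hV)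
      moreover have "\<phi> (\<theta> u h - g u * \<theta> h h) = \<phi> (\<theta> u r - g u * \<theta> h r)"
      proof -
        have "\<phi> (\<theta> u h - g u * \<theta> h h) - \<phi> (\<theta> u r - g u * \<theta> h r)
            = \<phi> (\<theta> u h - \<theta> u r) - g u * \<phi> (\<theta> h h - \<theta> h r)"
          using \<phi>g[OF u] by (simp add: elim_var_hom algebra_simps)
        also have "\<dots> = (s u - g u * s h) * conductor"
          unfolding s(1)[OF u] s(1)[OF hV] by (simp add: algebra_simps)
        finally show ?thesis
          by (simp add: gs)
      qed
      moreover have "\<psi> u = (\<lambda>v. \<theta> u v - g u * \<theta> h v)"
        using False by (simp add: \<psi>_def fun_eq_iff)
      ultimately show ?thesis
        by (simp add: diff_module_C1_iff)
    qed
    fix v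
    assume v: "v \<in> V"
    show "\<psi> u v \<in> mpoly_ring (insert 0 V)"
      unfolding \<psi>_def g_def using u v hV rV
      by (auto intro!: mpoly_ring_mult mpoly_ring_diff diff_form_in_ring s(3) graded_basisD(3)[OF \<theta>])
    show "homogeneous ((e(h := Suc (e h))) u) (\<psi> u v)"
    proof (cases "u = h")
      case True
      then show ?thesis
        using homogeneous_mult[OF homogeneous_diff_form[of h r c0] graded_basisD(2)[OF \<theta> hV v]]
        by (simp add: \<psi>_def)
    next
      case False
      have "homogeneous (e u) (g u * \<theta> h v)"
      proof (cases "s u = 0")
        case True
        then show ?thesis
          by (simp add: g_def)
      next
        case False
        then have *: "e h \<le> e u" "homogeneous (e u - e h) (s u)"
          using s(4)[OF u] by blast+
        have "homogeneous (0 + (e u - e h) + e h) (const_poly (inverse k) * s u * \<theta> h v)"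
          by (intro homogeneous_mult homogeneous_const * graded_basisD(2)[OF \<theta> hV v])
        then show ?thesis
          using *(1) by (simp add: g_def)
      qed
      then show ?thesis
        using False by (simp add: \<psi>_def homogeneous_diff graded_basisD(2)[OF \<theta> u v])
    qed
  next
    fix f :: "nat \<Rightarrow> 'k mpoly"
    assume "f \<in> diff_module V C1"
    then have f: "f \<in> diff_module V C" and fh: "\<phi> (f h) = \<phi> (f r)"
      by (simp_all add: diff_module_C1_iff)
    obtain c where c: "\<forall>v\<in>V. f v = (\<Sum>u\<in>V. c u * \<theta> u v)"
      using graded_basisD(4)[OF \<theta> f] by blast
    \<comment> \<open>The coordinates h and r of f agree modulo the form. Cancelling the conductor
      leaves a relation between the coefficients, which makes the coefficient needed at the
      corrected vector h divisible by the form.\<close>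
    have "(\<Sum>u\<in>V. \<phi> (c u) * s u) * conductor = (\<Sum>u\<in>V. \<phi> (c u) * \<phi> (\<theta> u h - \<theta> u r))"
      unfolding sum_distrib_right using s(1) by (intro sum.cong) (simp_all add: mult.assoc)
    also have "\<dots> = \<phi> (f h - f r)"
      using c hV rV by (simp add: elim_var_hom right_diff_distrib sum_subtractf)
    finally have "(\<Sum>u\<in>V. \<phi> (c u) * s u) = 0"
      using fh by (simp add: elim_var_hom conductor_nonzero)
    then have "(\<Sum>u\<in>V. \<phi> (c u) * g u) = 0"
      unfolding g_def mult.left_commute[of _ "const_poly (inverse k)"] sum_distrib_left[symmetric] by simp
    moreover have "g h = 1"
      using gs[of h] sh(1) by simp
    ultimately have "\<phi> (c h + (\<Sum>u\<in>V - {h}. c u * g u)) = 0"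
      using finV hV \<phi>g by (simp add: sum.remove[of V h] elim_var_hom)
    then have "?\<alpha> dvd c h + (\<Sum>u\<in>V - {h}. c u * g u)"
      by (simp only: diff_form_dvd_iff[OF hr h0(1)])
    then obtain y where y: "c h + (\<Sum>u\<in>V - {h}. c u * g u) = ?\<alpha> * y"
      by (elim dvdE)
    define c' where "c' u = (if u = h then y else c u)" for u
    have "f v = (\<Sum>u\<in>V. c' u * \<psi> u v)" if v: "v \<in> V" for v
    proof -
      have "?\<alpha> * c' h - (\<Sum>w\<in>V - {h}. c' w * g w) = c h"
        using y by (simp add: c'_def flip: eq_diff_eq)
      then show ?thesis
        unfolding combination using c v by (auto simp: c'_def intro!: sum.cong)
    qed
    then show "\<exists>c. \<forall>v\<in>V. f v = (\<Sum>u\<in>V. c u * \<psi> u v)"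
      by blast
  next
    fix y :: "nat \<Rightarrow> 'k mpoly" and u
    assume y: "\<forall>v\<in>V. (\<Sum>u\<in>V. y u * \<psi> u v) = 0" and u: "u \<in> V"
    define x where "x u = (if u = h then ?\<alpha> * y h - (\<Sum>w\<in>V - {h}. y w * g w) else y u)" for u
    have "(\<Sum>u\<in>V. x u * \<theta> u v) = 0" if "v \<in> V" for v
      using y that unfolding combination x_def by blast
    then have x0: "x w = 0" if "w \<in> V" for w
      using graded_basisD(5)[where c = x and u = w, OF \<theta>] that by blast
    have yw: "y w = 0" if "w \<in> V - {h}" for w
      using x0[of w] that by (simp add: x_def)
    then have "?\<alpha> * y h = 0"
      using x0[OF hV] by (simp add: x_def)
    then have "y h = 0"
      by (simp add: diff_form_nonzero[OF hr h0(1)])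
    then show "y u = 0"
      using yw u by blast
  qed
  then show ?thesis
    by blast
qed

end

section \<open>Adding an arc to a weighted digraph\<close>

text \<open>The largest c for which x j - x i = c belongs to the arrangement. Splitting it into a
  part b of the tail and a part a of the head is what lets a merged vertex take one part from q and
  the other from p.\<close>

definition arc_bound :: "(nat \<Rightarrow> int) \<Rightarrow> (nat \<Rightarrow> int) \<Rightarrow> (nat \<Rightarrow> nat \<Rightarrow> bool) \<Rightarrow> nat \<Rightarrow> nat \<Rightarrow> int" where
  "arc_bound a b E i j = b i + a j + of_bool (E i j)"

definition deformation :: "(nat \<Rightarrow> int) \<Rightarrow> (nat \<Rightarrow> int) \<Rightarrow> (nat \<Rightarrow> nat \<Rightarrow> bool) \<Rightarrow> nat \<Rightarrow> nat \<Rightarrow> int set" where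
  "deformation a b E i j = {- arc_bound a b E i j..arc_bound a b E j i}"

definition total_weight :: "nat set \<Rightarrow> (nat \<Rightarrow> int) \<Rightarrow> (nat \<Rightarrow> int) \<Rightarrow> nat" where
  "total_weight V a b = nat (\<Sum>v\<in>V. a v + b v)"

definition arcs_below :: "nat set \<Rightarrow> (nat \<Rightarrow> nat \<Rightarrow> bool) \<Rightarrow> nat \<Rightarrow> nat" where
  "arcs_below V E t = (\<Sum>m | m \<in> V \<and> m < t. of_bool (E t m) + of_bool (E m t))"

text \<open>The exponent 0 belongs to the constant vector (1, ..., 1). Without arcs and with W the
  total weight, the others are W + 1, ..., W + n - 1 for n vertices; each arc adds one at its larger
  endpoint. For nonnegative vertex weights the sum is the number of affine hyperplanes.\<close>

definition exponent :: "nat set \<Rightarrow> (nat \<Rightarrow> int) \<Rightarrow> (nat \<Rightarrow> int) \<Rightarrow> (nat \<Rightarrow> nat \<Rightarrow> bool) \<Rightarrow> nat \<Rightarrow> nat" where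
  "exponent V a b E t = (if \<forall>m\<in>V. t \<le> m then 0
     else total_weight V a b + card {m \<in> V. t < m} + 1 + arcs_below V E t)"

lemma graded_basis_cong:
  assumes "\<And>i j. i \<in> V \<Longrightarrow> j \<in> V \<Longrightarrow> i \<noteq> j \<Longrightarrow> C i j = C' i j" "\<And>u. u \<in> V \<Longrightarrow> e u = e' u"
  shows "graded_basis V C e b \<longleftrightarrow> graded_basis V C' e' b"
proof -
  have "diff_module V C = diff_module V C'"
    using assms(1) unfolding diff_module_def by (intro Collect_cong ball_cong refl imp_cong) simp
  then show ?thesis
    using assms(2) unfolding graded_basis_def by (intro conj_cong ball_cong refl) simp_all
qed

lemma graded_basis_exponent_cong:
  "graded_basis V C e b \<Longrightarrow> (\<And>u. u \<in> V \<Longrightarrow> e u = e' u) \<Longrightarrow> graded_basis V C e' b"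
  using graded_basis_cong[of V C C e e' b] by simp

locale arc_addition =
  fixes V :: "nat set" and a b :: "nat \<Rightarrow> int" and E :: "nat \<Rightarrow> nat \<Rightarrow> bool" and p q :: nat
  assumes finV: "finite V" and V0: "0 \<notin> V" and weights: "\<And>v. v \<in> V \<Longrightarrow> 0 \<le> a v + b v"
    and valid: "valid_digraph V E" and removable: "removable_arc V E p q"
begin

definition E' :: "nat \<Rightarrow> nat \<Rightarrow> bool" where "E' i j \<longleftrightarrow> E i j \<and> \<not> (i = p \<and> j = q)"
definition h where "h = max p q"
definition r where "r = min p q"
text \<open>The arc raises the bound at (p, q) by one to \<open>shift\<close>, so the new hyperplane
  is x q - x p = \<open>shift\<close>. \<open>c0\<close> is its constant when the larger vertex
  comes first.\<close>

definition shift :: int where "shift = b p + a q + 1"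
definition c0 :: int where "c0 = (if p < q then shift else - shift)"

text \<open>The vertex \<open>r\<close> of the restriction stands for the two identified vertices \<open>p\<close> and \<open>q\<close>: it
  keeps the arcs out of \<open>q\<close> and the arcs into \<open>p\<close>.\<close>

definition E2 :: "nat \<Rightarrow> nat \<Rightarrow> bool" where
  "E2 i j = E (if i = r then q else i) (if j = r then p else j)"
text \<open>Among the hyperplanes to a third vertex, the ends of the merged interval are the bound
  out of q and the bound into p, measured at r. If r is p, the bound out of q is translated; if r is
  q, the bound into p is.\<close>

definition a2 :: "nat \<Rightarrow> int" where
  "a2 v = (if v = r then (if p < q then a p else a p + shift) else a v)"
definition b2 :: "nat \<Rightarrow> int" where
  "b2 v = (if v = r then (if p < q then b q + shift else b q) else b v)"

lemma pq: "p \<in> V" "q \<in> V" "p \<noteq> q" "E p q"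
  using removable unfolding removable_arc_def by blast+

lemma hr: "h \<in> V" "r \<in> V" "h \<noteq> r" "r < h"
  using pq unfolding h_def r_def by (auto simp: max_def min_def)

lemma cases: "(p < q \<and> h = q \<and> r = p) \<or> (q < p \<and> h = p \<and> r = q)"
  using pq unfolding h_def r_def by (auto simp: max_def min_def)

text \<open>(A1) for the arc (p, q) gives at least one of the two arcs, removability excludes
  both.\<close>

lemma above: "m \<in> V \<Longrightarrow> h < m \<Longrightarrow> E p m \<longleftrightarrow> \<not> E m q"
  using removable valid_digraphD1[OF valid pq(1,2) _ pq(3), of m] pq(4) cases
  unfolding removable_arc_def by (smt (verit) less_trans nat_neq_iff)

text \<open>One inclusion is (A2) with h as the top vertex, the other is removability. So the merged
  vertex has the arcs of r as far as vertices below h are concerned.\<close>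

lemma below: "m \<in> V \<Longrightarrow> m < h \<Longrightarrow> m \<noteq> r \<Longrightarrow> E q m = E r m \<and> E m p = E m r"
proof -
  assume m: "m \<in> V" "m < h" "m \<noteq> r"
  from cases show ?thesis
  proof
    assume c: "p < q \<and> h = q \<and> r = p"
    then have m': "p < q" "m < q" "m \<noteq> p" "m \<noteq> q"
      using m by auto
    then have "E p m \<Longrightarrow> E q m"
      using removable m(1) unfolding removable_arc_def by blast
    moreover have "E q m \<Longrightarrow> E p m"
      using valid_digraphD2[OF valid, of p m q] pq m(1) m' by blast
    ultimately show ?thesis
      using c by auto
  next
    assume c: "q < p \<and> h = p \<and> r = q"
    then have m': "q < p" "m < p" "m \<noteq> p" "m \<noteq> q"
      using m by auto
    then have "E m q \<Longrightarrow> E m p"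
      using removable m(1) unfolding removable_arc_def by blast
    moreover have "E m p \<Longrightarrow> E m q"
      using valid_digraphD2[OF valid, of m q p] pq m(1) m' by blast
    ultimately show ?thesis
      using c by auto
  qed
qed

lemma E2_below:
  assumes "i \<in> V" "j \<in> V" "i < h" "j < h" "i \<noteq> j"
  shows "E2 i j = E i j"
  using assms below[of i] below[of j] unfolding E2_def by auto

text \<open>Below h nothing changes. For m above h, the conditions are those of E with r replaced by
  q as a tail and by p as a head; i and j are not both r, so these vertices stay distinct.\<close>

lemma valid_E2: "valid_digraph (V - {h}) E2"
  unfolding valid_digraph_def
proof (intro ballI impI)
  fix i j m
  assume ijm: "i \<in> V - {h}" "j \<in> V - {h}" "m \<in> V - {h}" "i \<noteq> j \<and> i < m \<and> j < m"
  show "(E2 i j \<longrightarrow> E2 i m \<or> E2 m j) \<and> (E2 i m \<and> E2 m j \<longrightarrow> E2 i j)"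
  proof (cases "m < h")
    case True
    then have "i < h" "j < h"
      using ijm by linarith+
    then have "E2 i j = E i j" "E2 i m = E i m" "E2 m j = E m j"
      using ijm True E2_below[of i j] E2_below[of i m] E2_below[of m j] by simp_all
    then show ?thesis
      using valid_digraphD1[OF valid, of i j m] valid_digraphD2[OF valid, of i j m] ijm by blast
  next
    case False
    then have m: "h < m"
      using ijm by auto
    define i' j' where "i' = (if i = r then q else i)" and "j' = (if j = r then p else j)"
    have "E2 i j = E i' j'" "E2 i m = E i' m" "E2 m j = E m j'"
      using m hr by (simp_all add: E2_def i'_def j'_def)
    moreover have lt: "p < m" "q < m"
      using m by (simp_all add: h_def)
    have "i' \<in> V \<and> i' < m"
      by (cases "i = r") (use ijm pq lt in \<open>simp_all add: i'_def\<close>)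
    moreover have "j' \<in> V \<and> j' < m"
      by (cases "j = r") (use ijm pq lt in \<open>simp_all add: j'_def\<close>)
    moreover have "q = h \<or> q = r" "p = h \<or> p = r"
      using cases by auto
    then have "i' \<noteq> j'"
      by (cases "i = r"; cases "j = r") (use ijm pq(3) in \<open>auto simp: i'_def j'_def\<close>)
    moreover have "m \<in> V"
      using ijm by blast
    ultimately show ?thesis
      using valid_digraphD1[OF valid, of i' j' m] valid_digraphD2[OF valid, of i' j' m] by blast
  qed
qed

lemma weights2: "v \<in> V - {h} \<Longrightarrow> 0 \<le> a2 v + b2 v"
  using weights[of v] weights[OF pq(1)] weights[OF pq(2)] unfolding a2_def b2_def shift_def by auto

lemma sum_weights2: "(\<Sum>v\<in>V - {h}. a2 v + b2 v) = (\<Sum>v\<in>V. a v + b v) + 1"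
proof -
  have "(\<Sum>v\<in>V. a v + b v) = (a h + b h) + ((a r + b r) + (\<Sum>v\<in>V - {h} - {r}. a v + b v))"
    using finV hr by (simp add: sum.remove[of V h] sum.remove[of "V - {h}" r])
  moreover have "(\<Sum>v\<in>V - {h}. a2 v + b2 v) = (a2 r + b2 r) + (\<Sum>v\<in>V - {h} - {r}. a v + b v)"
    using finV hr by (simp add: sum.remove[of "V - {h}" r] a2_def b2_def)
  ultimately show ?thesis
    using cases unfolding a2_def b2_def shift_def by auto
qed

lemma sum_weights_nonneg: "0 \<le> (\<Sum>v\<in>V. a v + b v)"
  using weights by (intro sum_nonneg)

lemma total_weight2: "total_weight (V - {h}) a2 b2 = Suc (total_weight V a b)"
  unfolding total_weight_def sum_weights2 using sum_weights_nonneg by (simp add: nat_add_distrib)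

lemma E'_simps: "i \<noteq> p \<or> j \<noteq> q \<Longrightarrow> E' i j = E i j" "\<not> E' p q"
  by (auto simp: E'_def)

text \<open>The additional unit of weight is compensated. For t below h, the vertex h no longer
  counts as lying above t. For t above h, merging drops the possible arcs p -> t and t -> q, exactly
  one of which is present by \<open>above\<close>.\<close>

lemma exponent2:
  assumes t: "t \<in> V - {h}"
  shows "exponent (V - {h}) a2 b2 E2 t = exponent V a b E' t"
proof (cases "\<forall>m\<in>V. t \<le> m")
  case True
  then show ?thesis
    by (simp add: exponent_def)
next
  case False
  then have first: "\<not> (\<forall>m\<in>V - {h}. t \<le> m)"
    using hr by (metis Diff_iff insertE leI order.strict_trans1 order_less_imp_le singletonD)
  show ?thesis
  proof (cases "t < h")
    case True
    have "{m \<in> V. t < m} = insert h {m \<in> V - {h}. t < m}"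
      using True hr by auto
    then have "card {m \<in> V. t < m} = Suc (card {m \<in> V - {h}. t < m})"
      using finV by simp
    moreover have "arcs_below (V - {h}) E2 t = arcs_below V E' t"
      unfolding arcs_below_def
    proof (rule sum.cong)
      show "{m \<in> V - {h}. m < t} = {m \<in> V. m < t}"
        using True by auto
    next
      fix m
      assume "m \<in> {m \<in> V. m < t}"
      then have m: "m \<in> V" "m < t" "m < h"
        using True by auto
      then have "E2 t m = E t m" "E2 m t = E m t"
        using E2_below[of t m] E2_below[of m t] t True by auto
      moreover have "E' t m = E t m" "E' m t = E m t"
        using m True cases by (auto intro!: E'_simps)
      ultimately show "of_bool (E2 t m) + of_bool (E2 m t) = (of_bool (E' t m) + of_bool (E' m t) :: nat)"
        by simp
    qed
    ultimately show ?thesis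
      using False first by (simp add: exponent_def total_weight2)
  next
    case False': False
    then have ht: "h < t"
      using t by auto
    have "{m \<in> V. t < m} = {m \<in> V - {h}. t < m}"
      using ht by auto
    moreover have "arcs_below V E' t = Suc (arcs_below (V - {h}) E2 t)"
    proof -
      let ?A = "{m \<in> V. m < t}" and ?B = "{m \<in> V - {h}. m < t}"
      let ?f = "\<lambda>m. of_bool (E' t m) + of_bool (E' m t) :: nat"
      let ?g = "\<lambda>m. of_bool (E2 t m) + of_bool (E2 m t) :: nat"
      have rt: "r < t" "p \<noteq> t" "q \<noteq> t"
        using ht hr cases by auto
      have "sum ?f ?A = ?f h + (?f r + sum ?f (?A - {h} - {r}))"
        using finV hr ht rt by (simp add: sum.remove[of ?A h] sum.remove[of "?A - {h}" r])
      moreover have "sum ?g ?B = ?g r + sum ?g (?B - {r})"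
        using finV hr rt by (intro sum.remove) auto
      moreover have "sum ?g (?B - {r}) = sum ?f (?A - {h} - {r})"
        using rt cases by (intro sum.cong) (auto simp: E2_def E'_simps)
      moreover have "?f h + ?f r = Suc (?g r)"
        using above[of t] t ht rt cases by (auto simp: E2_def E'_simps)
      ultimately show ?thesis
        unfolding arcs_below_def by simp
    qed
    ultimately show ?thesis
      using False first by (simp add: exponent_def total_weight2)
  qed
qed

lemma valid_E': "valid_digraph V E'"
  unfolding valid_digraph_def
proof (intro ballI impI conjI)
  fix i j t
  assume V: "i \<in> V" "j \<in> V" "t \<in> V" and ijt: "i \<noteq> j \<and> i < t \<and> j < t"
  show "E' i t \<or> E' t j" if "E' i j"
  proof -
    have "E i j"
      using that by (simp add: E'_def)
    then have Et: "E i t \<or> E t j"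
      using valid_digraphD1[OF valid V] ijt by blast
    consider "i = p" "t = q" | "t = p" "j = q" | "\<not> (i = p \<and> t = q)" "\<not> (t = p \<and> j = q)"
      by blast
    then show ?thesis
    proof cases
      case 1
      then have "h = q" "r = p"
        using cases ijt by auto
      then have "E q j"
        using below[OF V(2)] 1 ijt \<open>E i j\<close> by simp
      then show ?thesis
        using 1 pq(3) by (simp add: E'_def)
    next
      case 2
      then have "h = p" "r = q"
        using cases ijt by auto
      then have "E i p"
        using below[OF V(1)] 2 ijt \<open>E i j\<close> by simp
      then show ?thesis
        using 2 pq(3) by (simp add: E'_def)
    next
      case 3
      then show ?thesis
        using Et by (simp add: E'_def)
    qed
  qed
  show "E' i j" if "E' i t \<and> E' t j"
  proof -
    have Et: "E i t" "E t j"
      using that by (simp_all add: E'_def)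
    have "\<not> (i = p \<and> j = q)"
    proof
      assume "i = p \<and> j = q"
      moreover from this have "h < t"
        using ijt by (simp add: h_def)
      ultimately show False
        using above[OF V(3)] Et by blast
    qed
    then show ?thesis
      using valid_digraphD2[OF valid V] ijt Et by (simp add: E'_def)
  qed
qed

lemma arcs_below_h: "arcs_below V E h = Suc (arcs_below V E' h)"
  and arcs_below_h': "arcs_below V E' h = of_bool (E q p) + (\<Sum>m | m \<in> V - {h, r} \<and> m < h. of_bool (E m q) + of_bool (E p m))"
proof -
  let ?A = "{m \<in> V. m < h}"
  have A: "?A - {r} = {m \<in> V - {h, r}. m < h}"
    by auto
  have split: "arcs_below V F h = of_bool (F h r) + of_bool (F r h) +
      (\<Sum>m | m \<in> V - {h, r} \<and> m < h. of_bool (F h m) + of_bool (F m h))" for F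
    unfolding arcs_below_def using finV hr by (subst sum.remove[of _ r]) (auto simp: A)
  have eq: "(\<Sum>m | m \<in> V - {h, r} \<and> m < h. of_bool (E' h m) + of_bool (E' m h)) =
      (\<Sum>m | m \<in> V - {h, r} \<and> m < h. of_bool (E h m) + (of_bool (E m h) :: nat))"
    using cases by (intro sum.cong) (auto simp: E'_simps)
  show "arcs_below V E h = Suc (arcs_below V E' h)"
    unfolding split eq using cases pq by (auto simp: E'_def)
  have "(\<Sum>m | m \<in> V - {h, r} \<and> m < h. of_bool (E h m) + (of_bool (E m h) :: nat)) =
      (\<Sum>m | m \<in> V - {h, r} \<and> m < h. of_bool (E m q) + of_bool (E p m))"
    using cases below by (intro sum.cong) auto
  then show "arcs_below V E' h = of_bool (E q p) + (\<Sum>m | m \<in> V - {h, r} \<and> m < h. of_bool (E m q) + of_bool (E p m))"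
    unfolding split[of E'] eq using cases pq by (auto simp: E'_def)
qed

lemma exponent_E:
  assumes t: "t \<in> V"
  shows "exponent V a b E t = ((exponent V a b E')(h := Suc (exponent V a b E' h))) t"
proof (cases "t = h")
  case True
  have "\<not> (\<forall>m\<in>V. h \<le> m)"
    using hr by (auto simp: not_le)
  then have "exponent V a b E h = Suc (exponent V a b E' h)"
    unfolding exponent_def arcs_below_h by simp
  then show ?thesis
    using True by simp
next
  case False
  have "arcs_below V E t = arcs_below V E' t"
    unfolding arcs_below_def
  proof (rule sum.cong)
    fix m
    assume "m \<in> {m \<in> V. m < t}"
    then have "\<not> (t = p \<and> m = q)" "\<not> (m = p \<and> t = q)"
      using cases False by auto
    then show "of_bool (E t m) + of_bool (E m t) = (of_bool (E' t m) + of_bool (E' m t) :: nat)"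
      by (simp add: E'_def)
  qed simp
  then show ?thesis
    using False unfolding exponent_def by simp
qed

abbreviation "L \<equiv> arc_bound a b E'"

lemma L_pq: "L p q = b p + a q"
  by (simp add: arc_bound_def E'_def)

text \<open>The collisions form the intersection of the two intervals at r. Its ends are the bounds
  out of p and into q, and the weights of p and q cancel against \<open>shift\<close>.\<close>

lemma card_collisions:
  assumes m: "m \<in> V - {h, r}"
  shows "int (card {c \<in> deformation a b E' r m. c + c0 \<in> deformation a b E' h m}) =
    a m + b m + of_bool (E m q) + of_bool (E p m)"
proof -
  have mpq: "m \<noteq> p" "m \<noteq> q"
    using m cases by auto
  have w: "0 \<le> a m + b m" "0 \<le> a p + b p" "0 \<le> a q + b q"
    using weights m pq by auto
  have bool: "(0::int) \<le> of_bool x" "of_bool x \<le> (1::int)" for x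
    by simp_all
  have L: "L p m = b p + a m + of_bool (E p m)" "L m p = b m + a p + of_bool (E m p)"
    "L q m = b q + a m + of_bool (E q m)" "L m q = b m + a q + of_bool (E m q)"
    using mpq by (simp_all add: arc_bound_def E'_def)
  show ?thesis
  proof (cases "p < q")
    case True
    then have "h = q" "r = p"
      using cases by auto
    then have "{c \<in> deformation a b E' r m. c + c0 \<in> deformation a b E' h m} = {- L p m..L m q - shift}"
      using True w bool[of "E p m"] bool[of "E m p"] bool[of "E q m"] bool[of "E m q"]
      by (auto simp: deformation_def L c0_def shift_def)
    then show ?thesis
      using w by (simp add: L shift_def)
  next
    case False
    then have "h = p" "r = q"
      using cases by auto
    then have "{c \<in> deformation a b E' r m. c + c0 \<in> deformation a b E' h m} = {shift - L p m..L m q}"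
      using False w bool[of "E p m"] bool[of "E m p"] bool[of "E q m"] bool[of "E m q"]
      by (auto simp: deformation_def L c0_def shift_def)
    then show ?thesis
      using w by (simp add: L shift_def)
  qed
qed

lemma card_hr: "int (card (deformation a b E' h r)) = a p + b p + (a q + b q) + 1 + of_bool (E q p)"
proof -
  have L: "L p q = b p + a q" "L q p = b q + a p + of_bool (E q p)"
    using pq by (simp_all add: arc_bound_def E'_def)
  have w: "0 \<le> a p + b p" "0 \<le> a q + b q"
    using weights pq by auto
  show ?thesis
    using cases w by (auto simp: deformation_def L)
qed

text \<open>By \<open>above\<close>, each vertex above h contributes one arc term, which yields the
  count of larger vertices in \<open>exponent\<close>; the terms below h make up
  \<open>arcs_below\<close> by \<open>below\<close>.\<close>

lemma exponent_h:
  "exponent V a b E' h = card (deformation a b E' h r) +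
    (\<Sum>m\<in>V - {h, r}. card {c \<in> deformation a b E' r m. c + c0 \<in> deformation a b E' h m})"
proof -
  let ?W = "V - {h, r}"
  let ?g = "\<lambda>m. of_bool (E m q) + of_bool (E p m) :: int"
  have "int (\<Sum>m\<in>?W. card {c \<in> deformation a b E' r m. c + c0 \<in> deformation a b E' h m}) =
      (\<Sum>m\<in>?W. (a m + b m) + ?g m)"
    unfolding of_nat_sum by (intro sum.cong) (simp_all add: card_collisions)
  also have "\<dots> = (\<Sum>m\<in>?W. a m + b m) + (\<Sum>m\<in>?W. ?g m)"
    by (rule sum.distrib)
  also have "(\<Sum>m\<in>?W. ?g m) = (\<Sum>m | m \<in> ?W \<and> m < h. ?g m) + int (card {m \<in> V. h < m})"
  proof -
    have "?W = {m \<in> ?W. m < h} \<union> {m \<in> V. h < m}"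
      using hr by (auto simp: nat_neq_iff)
    then have "(\<Sum>m\<in>?W. ?g m) = (\<Sum>m\<in>{m \<in> ?W. m < h} \<union> {m \<in> V. h < m}. ?g m)"
      by (rule sum.cong[OF _ refl])
    also have "\<dots> = (\<Sum>m | m \<in> ?W \<and> m < h. ?g m) + (\<Sum>m | m \<in> V \<and> h < m. ?g m)"
      using finV by (intro sum.union_disjoint) auto
    also have "(\<Sum>m | m \<in> V \<and> h < m. ?g m) = (\<Sum>m | m \<in> V \<and> h < m. 1)"
      using above by (intro sum.cong) auto
    finally show ?thesis
      by simp
  qed
  also have "(\<Sum>m\<in>?W. a m + b m) = (\<Sum>v\<in>V. a v + b v) - (a p + b p) - (a q + b q)"
  proof -
    have "(\<Sum>v\<in>V. a v + b v) = (a p + b p) + ((a q + b q) + (\<Sum>v\<in>V - {p} - {q}. a v + b v))"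
      using finV pq by (simp add: sum.remove[of V p] sum.remove[of "V - {p}" q])
    moreover have "V - {p} - {q} = ?W"
      using cases by auto
    ultimately show ?thesis
      by simp
  qed
  finally have *: "int (card (deformation a b E' h r) +
      (\<Sum>m\<in>?W. card {c \<in> deformation a b E' r m. c + c0 \<in> deformation a b E' h m})) =
      (\<Sum>v\<in>V. a v + b v) + int (card {m \<in> V. h < m}) + 1 + of_bool (E q p) + (\<Sum>m | m \<in> ?W \<and> m < h. ?g m)"
    by (simp add: card_hr)
  have "\<not> (\<forall>m\<in>V. h \<le> m)"
    using hr by (auto simp: not_le)
  then have "exponent V a b E' h = total_weight V a b + card {m \<in> V. h < m} + 1 + arcs_below V E' h"
    unfolding exponent_def by (rule if_not_P)
  then have "int (exponent V a b E' h) = (\<Sum>v\<in>V. a v + b v) + int (card {m \<in> V. h < m}) + 1 + of_bool (E q p)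
      + (\<Sum>m | m \<in> ?W \<and> m < h. ?g m)"
    using sum_weights_nonneg by (simp add: total_weight_def arcs_below_h')
  with * show ?thesis
    by linarith
qed

lemma arc_bound2:
  assumes m: "m \<in> V - {h, r}"
  shows "arc_bound a2 b2 E2 r m = (if p < q then L q m + shift else L q m)"
    "arc_bound a2 b2 E2 m r = (if p < q then L m p else L m p + shift)"
proof -
  have "m \<noteq> p" "m \<noteq> q" "m \<noteq> r"
    using m cases by auto
  then show "arc_bound a2 b2 E2 r m = (if p < q then L q m + shift else L q m)"
    "arc_bound a2 b2 E2 m r = (if p < q then L m p else L m p + shift)"
    using pq by (auto simp: arc_bound_def E2_def a2_def b2_def E'_def)
qed

sublocale addition V "deformation a b E'" "deformation a b E" "deformation a2 b2 E2" "exponent V a b E'" h r c0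
proof
  show "finite V" "0 \<notin> V" "h \<in> V" "r \<in> V" "h \<noteq> r"
    using finV V0 hr by auto
  show "- c \<in> deformation a b E' j i" if "c \<in> deformation a b E' i j" for i j c
    using that by (auto simp: deformation_def)
  show "finite (deformation a b E' i j)" for i j
    by (simp add: deformation_def)
  have w: "0 \<le> a p + b p" "0 \<le> a q + b q"
    using weights pq by auto
  have LE: "arc_bound a b E p q = L p q + 1" "\<And>i j. i \<noteq> p \<or> j \<noteq> q \<Longrightarrow> arc_bound a b E i j = L i j"
    using pq by (auto simp: arc_bound_def E'_def)
  have Lqp: "L q p \<ge> b q + a p"
    by (simp add: arc_bound_def)
  show "c0 \<notin> deformation a b E' h r"
    using cases by (auto simp: deformation_def c0_def shift_def L_pq)
  show "deformation a b E i j = (if i = h \<and> j = r then insert c0 (deformation a b E' h r)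
      else if i = r \<and> j = h then insert (- c0) (deformation a b E' r h) else deformation a b E' i j)"
    if "i \<in> V" "j \<in> V" "i \<noteq> j" for i j
  proof -
    have qp: "deformation a b E q p = insert shift (deformation a b E' q p)"
      "deformation a b E p q = insert (- shift) (deformation a b E' p q)"
      using w Lqp pq(3) by (auto simp: deformation_def LE L_pq shift_def)
    have other: "deformation a b E i j = deformation a b E' i j" if "\<not> (i = p \<and> j = q)" "\<not> (i = q \<and> j = p)" for i j
      using that by (auto simp: deformation_def LE(2))
    show ?thesis
      using cases qp other[of i j] that by (auto simp: c0_def)
  qed
  show "deformation a2 b2 E2 i j \<subseteq> deformation a b E' i j" if "i \<in> V - {h, r}" "j \<in> V - {h, r}" for i j
  proof -
    have "i \<noteq> p" "i \<noteq> q" "j \<noteq> p" "j \<noteq> q"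
      using that cases by auto
    then show ?thesis
      using that by (auto simp: deformation_def arc_bound_def E2_def E'_def a2_def b2_def)
  qed
  \<comment> \<open>This says that the upper of the two intervals at r starts at most one past the
    end of the lower one, so their union is the whole interval of the merged vertex.\<close>
  have triangle: "L p q \<le> L p m + L m q" if "m \<in> V - {h, r}" for m
    using weights[of m] that by (auto simp: L_pq) (simp add: arc_bound_def)
  show "deformation a2 b2 E2 r m \<subseteq> deformation a b E' r m \<union> {c. c + c0 \<in> deformation a b E' h m}"
    if "m \<in> V - {h, r}" for m
    using arc_bound2[OF that] triangle[OF that] cases
    by (auto simp: deformation_def c0_def shift_def L_pq)
  show "deformation a2 b2 E2 m r \<subseteq> deformation a b E' m r \<union> {c. c - c0 \<in> deformation a b E' m h}"
    if "m \<in> V - {h, r}" for m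
    using arc_bound2[OF that] triangle[OF that] cases
    by (auto simp: deformation_def c0_def shift_def L_pq)
  show "exponent V a b E' h = card (deformation a b E' h r) +
    (\<Sum>m\<in>V - {h, r}. card {c \<in> deformation a b E' r m. c + c0 \<in> deformation a b E' h m})"
    by (rule exponent_h)
qed

lemma graded_basis_add_arc:
  fixes \<theta> \<eta> :: "nat \<Rightarrow> nat \<Rightarrow> 'k::field_char_0 mpoly"
  assumes "graded_basis V (deformation a b E') (exponent V a b E') \<theta>"
    and "graded_basis (V - {h}) (deformation a2 b2 E2) (exponent (V - {h}) a2 b2 E2) \<eta>"
  shows "\<exists>\<theta>' :: nat \<Rightarrow> nat \<Rightarrow> 'k mpoly. graded_basis V (deformation a b E) (exponent V a b E) \<theta>'"
proof -
  have "graded_basis (V - {h}) (deformation a2 b2 E2) (exponent V a b E') \<eta>"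
    by (rule graded_basis_exponent_cong[OF assms(2)]) (rule exponent2)
  from graded_basis_addition[OF assms(1) this]
  obtain \<theta>' :: "nat \<Rightarrow> nat \<Rightarrow> 'k mpoly" where
    "graded_basis V (deformation a b E) ((exponent V a b E')(h := Suc (exponent V a b E' h))) \<theta>'"
    by blast
  then have "graded_basis V (deformation a b E) (exponent V a b E) \<theta>'"
    by (rule graded_basis_exponent_cong) (rule exponent_E[symmetric])
  then show ?thesis
    by blast
qed

end

section \<open>Graphs without arcs\<close>

text \<open>Which vertex carries which exponent is immaterial as long as the same labels S are used,
  each once.\<close>

lemma graded_basis_permute:
  fixes b :: "nat \<Rightarrow> nat \<Rightarrow> 'k::field mpoly"
  assumes b: "graded_basis V C (\<lambda>u. g (\<kappa> u)) b" and \<kappa>: "bij_betw \<kappa> V S" and k: "bij_betw k V S"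
  shows "\<exists>b' :: nat \<Rightarrow> nat \<Rightarrow> 'k mpoly. graded_basis V C (\<lambda>u. g (k u)) b'"
proof -
  define \<pi> where "\<pi> u = inv_into V \<kappa> (k u)" for u
  have "bij_betw (inv_into V \<kappa> \<circ> k) V V"
    using k bij_betw_inv_into[OF \<kappa>] by (rule bij_betw_trans)
  then have \<pi>: "bij_betw \<pi> V V"
    by (simp add: \<pi>_def[abs_def] comp_def)
  have "g (k u) = g (\<kappa> (\<pi> u))" if "u \<in> V" for u
  proof -
    have "k u \<in> \<kappa> ` V"
      using \<kappa> k that by (auto simp: bij_betw_def)
    then show ?thesis
      unfolding \<pi>_def by (simp add: f_inv_into_f)
  qed
  from graded_basis_reindex[OF b \<pi> this] show ?thesis
    by blast
qed

text \<open>The braid arrangement: translating \<open>x i\<close> by \<open>b i z\<close> turns the hyperplanes into \<open>y i = y j\<close>. Adding a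
  vertex \<open>w\<close>, the module splits as \<open>D(V + w) = S (1,...,1) + (y - y w) D(V)\<close>.\<close>

lemma braid_graded_basis:
  fixes b :: "nat \<Rightarrow> int"
  assumes "finite V" "0 \<notin> V" "\<And>i j. i \<in> V \<Longrightarrow> j \<in> V \<Longrightarrow> i \<noteq> j \<Longrightarrow> C i j = {b j - b i}"
    and "bij_betw k V {..<card V}"
  shows "\<exists>\<theta> :: nat \<Rightarrow> nat \<Rightarrow> 'k::field_char_0 mpoly. graded_basis V C k \<theta>"
  using assms
proof (induction V arbitrary: k rule: finite_induct)
  case empty
  then show ?case
    by (simp add: graded_basis_def)
next
  case (insert w V)
  obtain k1 where k1: "bij_betw k1 V {..<card V}"
    using ex_bij_betw_finite_nat[OF insert.hyps(1)] by (auto simp: atLeast0LessThan)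
  obtain \<theta> :: "nat \<Rightarrow> nat \<Rightarrow> 'k mpoly" where \<theta>: "graded_basis V C k1 \<theta>"
    using insert.IH[of k1] insert.prems k1 by auto
  have V0: "w \<noteq> 0" "0 \<notin> V"
    using insert.prems(1) by auto
  define Y where "Y i = var_poly i + of_int (b i) * (var_poly 0 :: 'k mpoly)" for i
  have form: "diff_form i j (b j - b i) = Y i - Y j" for i j
    by (simp add: diff_form_def Y_def algebra_simps)
  have C: "C i j = {b j - b i}" if "i \<in> insert w V" "j \<in> insert w V" "i \<noteq> j" for i j
    using insert.prems(2) that by blast
  have memI: "f \<in> diff_module U C"
    if "U \<subseteq> insert w V" "\<And>i j. i \<in> U \<Longrightarrow> j \<in> U \<Longrightarrow> i \<noteq> j \<Longrightarrow> Y i - Y j dvd f i - f j" for f :: "nat \<Rightarrow> 'k mpoly" and U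
  proof (rule diff_moduleI)
    fix i j c
    assume ij: "i \<in> U" "j \<in> U" "i \<noteq> j" "c \<in> C i j"
    then have "c = b j - b i"
      using C[of i j] that(1) by blast
    then show "diff_form i j c dvd f i - f j"
      using that(2)[OF ij(1-3)] by (simp add: form)
  qed
  have memD: "Y i - Y j dvd f i - f j"
    if "f \<in> diff_module U C" "U \<subseteq> insert w V" "i \<in> U" "j \<in> U" "i \<noteq> j" for f :: "nat \<Rightarrow> 'k mpoly" and U i j
  proof -
    have "b j - b i \<in> C i j"
      using C[of i j] that by blast
    then show ?thesis
      using diff_moduleD[of f U C i j "b j - b i"] that by (simp add: form)
  qed
  define \<psi> where "\<psi> u v = (if u = w then 1 else if v = w then 0 else (Y v - Y w) * \<theta> u v)" for u v
  define \<kappa> where "\<kappa> u = (if u = w then 0 else Suc (k1 u))" for u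
  have sum_\<psi>: "(\<Sum>u\<in>insert w V. c u * \<psi> u v) = (if v = w then c w else c w + (Y v - Y w) * (\<Sum>u\<in>V. c u * \<theta> u v))" for c v
  proof -
    have "(\<Sum>u\<in>V. c u * \<psi> u v) = (\<Sum>u\<in>V. if v = w then 0 else (Y v - Y w) * (c u * \<theta> u v))"
      using insert.hyps(2) by (intro sum.cong) (auto simp: \<psi>_def)
    then show ?thesis
      using insert.hyps by (simp add: \<psi>_def sum_distrib_left)
  qed
  have "graded_basis (insert w V) C \<kappa> \<psi>"
    unfolding graded_basis_def
  proof (intro conjI ballI allI impI)
    fix u
    assume u: "u \<in> insert w V"
    show "\<psi> u \<in> diff_module (insert w V) C"
    proof (rule memI)
      fix i j
      assume ij: "i \<in> insert w V" "j \<in> insert w V" "i \<noteq> j"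
      show "Y i - Y j dvd \<psi> u i - \<psi> u j"
      proof (cases "u = w")
        case True
        then show ?thesis
          by (simp add: \<psi>_def)
      next
        case False
        then have uV: "u \<in> V"
          using u by simp
        consider "i = w" "j \<noteq> w" | "j = w" "i \<noteq> w" | "i \<in> V" "j \<in> V" "i \<noteq> w" "j \<noteq> w"
          using ij by blast
        then show ?thesis
        proof cases
          case 1
          have "\<psi> u i - \<psi> u j = (Y i - Y j) * \<theta> u j"
            using 1 False by (simp add: \<psi>_def algebra_simps)
          then show ?thesis
            by simp
        next
          case 2
          have "\<psi> u i - \<psi> u j = (Y i - Y j) * \<theta> u i"
            using 2 False by (simp add: \<psi>_def)
          then show ?thesis
            by simp
        next
          case 3
          have "\<psi> u i - \<psi> u j = (Y i - Y j) * \<theta> u i + (Y j - Y w) * (\<theta> u i - \<theta> u j)"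
            using 3 False by (simp add: \<psi>_def algebra_simps)
          moreover have "Y i - Y j dvd \<theta> u i - \<theta> u j"
            by (rule memD[OF graded_basisD(1)[OF \<theta> uV]]) (use 3 ij in auto)
          ultimately show ?thesis
            by (simp add: dvd_add)
        qed
      qed
    qed simp
    fix v
    assume v: "v \<in> insert w V"
    have Yw: "homogeneous 1 (Y v - Y w)" "Y v - Y w \<in> mpoly_ring (insert 0 (insert w V))"
      unfolding form[symmetric] using v by (simp_all add: homogeneous_diff_form diff_form_in_ring del: One_nat_def)
    have \<theta>uv: "homogeneous (k1 u) (\<theta> u v)" "\<theta> u v \<in> mpoly_ring (insert 0 (insert w V))" if "u \<noteq> w" "v \<noteq> w"
      using graded_basisD(2,3)[OF \<theta>, of u v] mpoly_ring_mono[of "insert 0 V" "insert 0 (insert w V)"] u v that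
      by auto
    show "homogeneous (\<kappa> u) (\<psi> u v)"
      using homogeneous_mult[OF Yw(1) \<theta>uv(1)] by (simp add: \<kappa>_def \<psi>_def)
    show "\<psi> u v \<in> mpoly_ring (insert 0 (insert w V))"
      using mpoly_ring_mult[OF Yw(2) \<theta>uv(2)] by (simp add: \<psi>_def)
  next
    fix f :: "nat \<Rightarrow> 'k mpoly"
    assume f: "f \<in> diff_module (insert w V) C"
    have "\<forall>v\<in>V. \<exists>g. f v - f w = (Y v - Y w) * g"
      using memD[OF f subset_refl] insert.hyps(2) unfolding dvd_def by blast
    from bchoice[OF this] obtain g where g: "\<And>v. v \<in> V \<Longrightarrow> f v - f w = (Y v - Y w) * g v"
      by blast
    have "g \<in> diff_module V C"
    proof (rule memI)
      fix i j
      assume ij: "i \<in> V" "j \<in> V" "i \<noteq> j"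
      then have ne: "i \<noteq> w" "j \<noteq> w" "i \<noteq> 0" "j \<noteq> 0"
        using insert.hyps(2) V0 by metis+
      have "f i - f j = (f i - f w) - (f j - f w)"
        by simp
      then have "f i - f j = (Y i - Y j) * g i + (Y j - Y w) * (g i - g j)"
        unfolding g[OF ij(1)] g[OF ij(2)] by (simp add: algebra_simps)
      moreover have "Y i - Y j dvd f i - f j"
        using memD[OF f subset_refl] ij by simp
      \<comment> \<open>Dividing by the forms at w preserves the conditions between old vertices: Y
        i - Y j is prime and does not divide Y j - Y w.\<close>
      ultimately have "Y i - Y j dvd (Y i - Y j) * g i + (Y j - Y w) * (g i - g j)"
        by simp
      then have "diff_form i j (b j - b i) dvd (Y j - Y w) * (g i - g j)"
        unfolding form by (simp only: dvd_add_right_iff[OF dvd_triv_left])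
      then have "diff_form i j (b j - b i) dvd Y j - Y w \<or> diff_form i j (b j - b i) dvd g i - g j"
        by (rule diff_form_prime[OF ij(3) ne(3)])
      moreover have "\<not> (diff_form i j (b j - b i) :: 'k mpoly) dvd Y j - Y w"
        unfolding form[of j w, symmetric]
        using not_diff_form_dvd[OF ij(3) ne(3,4) ne(2) ne(4) V0(1)] ij(3) ne by blast
      ultimately show "Y i - Y j dvd g i - g j"
        unfolding form by blast
    qed blast
    then obtain c where c: "\<forall>v\<in>V. g v = (\<Sum>u\<in>V. c u * \<theta> u v)"
      using graded_basisD(4)[OF \<theta>] by blast
    define c' where "c' u = (if u = w then f w else c u)" for u
    have "f v = (\<Sum>u\<in>insert w V. c' u * \<psi> u v)" if v: "v \<in> insert w V" for v
    proof -
      have "(\<Sum>u\<in>V. c' u * \<theta> u v) = (\<Sum>u\<in>V. c u * \<theta> u v)"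
        using insert.hyps(2) by (intro sum.cong) (auto simp: c'_def)
      then show ?thesis
        unfolding sum_\<psi> using v c g[of v] by (auto simp: c'_def algebra_simps)
    qed
    then show "\<exists>c. \<forall>v\<in>insert w V. f v = (\<Sum>u\<in>insert w V. c u * \<psi> u v)"
      by blast
  next
    fix c :: "nat \<Rightarrow> 'k mpoly" and u
    assume c: "\<forall>v\<in>insert w V. (\<Sum>u\<in>insert w V. c u * \<psi> u v) = 0" and u: "u \<in> insert w V"
    have cw: "c w = 0"
      using c unfolding sum_\<psi> by auto
    have "(\<Sum>u\<in>V. c u * \<theta> u v) = 0" if v: "v \<in> V" for v
    proof -
      have ne: "v \<noteq> w" "v \<noteq> 0"
        using v insert.hyps(2) V0 by metis+
      have "Y v - Y w \<noteq> 0"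
        unfolding form[symmetric] by (rule diff_form_nonzero[OF ne])
      then show ?thesis
        using c v ne cw unfolding sum_\<psi> by auto
    qed
    then have "c u = 0" if "u \<in> V" for u
      using graded_basisD(5)[where c = c and u = u, OF \<theta>] that by blast
    then show "c u = 0"
      using u cw by blast
  qed
  moreover have "bij_betw \<kappa> (insert w V) {..<card (insert w V)}"
  proof -
    have "bij_betw (Suc \<circ> k1) V (Suc ` {..<card V})"
      by (rule bij_betw_trans[OF k1]) (simp add: bij_betw_def)
    then have "bij_betw \<kappa> V (Suc ` {..<card V})"
      using insert.hyps(2) by (subst bij_betw_cong[of V \<kappa> "Suc \<circ> k1"]) (auto simp: \<kappa>_def)
    moreover have "bij_betw \<kappa> {w} {0}"
      by (simp add: \<kappa>_def bij_betw_def)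
    ultimately have "bij_betw \<kappa> ({w} \<union> V) ({0} \<union> Suc ` {..<card V})"
      by (intro bij_betw_combine) auto
    then show ?thesis
      using insert.hyps by (simp add: lessThan_Suc_eq_insert_0)
  qed
  ultimately show ?case
    using graded_basis_permute[where g = "\<lambda>n. n" and \<kappa> = \<kappa> and k = k] insert.prems(3) by blast
qed

section \<open>Exponents of graphs without arcs and of stars\<close>

definition vertex_rank :: "nat set \<Rightarrow> nat \<Rightarrow> nat" where
  "vertex_rank V t = card {m \<in> V. m < t}"

lemma rank_mono: "finite V \<Longrightarrow> s \<in> V \<Longrightarrow> s < t \<Longrightarrow> vertex_rank V s < vertex_rank V t"
  unfolding vertex_rank_def by (intro psubset_card_mono) auto

lemma rank_less: "finite V \<Longrightarrow> t \<in> V \<Longrightarrow> vertex_rank V t < card V"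
  unfolding vertex_rank_def by (intro psubset_card_mono) auto

lemma card_above:
  assumes "finite V" "t \<in> V"
  shows "card V = vertex_rank V t + 1 + card {m \<in> V. t < m}"
proof -
  have "V = insert t ({m \<in> V. m < t} \<union> {m \<in> V. t < m})"
    using assms by auto
  then have "card V = card (insert t ({m \<in> V. m < t} \<union> {m \<in> V. t < m}))"
    by simp
  also have "\<dots> = Suc (card ({m \<in> V. m < t} \<union> {m \<in> V. t < m}))"
    using assms by (intro card_insert_disjoint) auto
  also have "card ({m \<in> V. m < t} \<union> {m \<in> V. t < m}) = card {m \<in> V. m < t} + card {m \<in> V. t < m}"
    using assms by (intro card_Un_disjoint) auto
  finally show ?thesis
    by (simp add: vertex_rank_def)
qed

lemma rank_0_iff: "finite V \<Longrightarrow> vertex_rank V t = 0 \<longleftrightarrow> (\<forall>m\<in>V. t \<le> m)"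
  unfolding vertex_rank_def by (auto simp: not_less)

lemma bij_betw_of_strict_order:
  fixes \<kappa> :: "nat \<Rightarrow> nat"
  assumes "finite V" and "\<And>t. t \<in> V \<Longrightarrow> \<kappa> t < card V"
    and "\<And>s t. s \<in> V \<Longrightarrow> t \<in> V \<Longrightarrow> s < t \<Longrightarrow> \<kappa> s \<noteq> \<kappa> t"
  shows "bij_betw \<kappa> V {..<card V}"
proof -
  have inj: "inj_on \<kappa> V"
    using assms(3) by (intro inj_onI) (metis nat_neq_iff)
  moreover have "\<kappa> ` V = {..<card V}"
    using assms(1,2) card_image[OF inj] by (intro card_subset_eq) auto
  ultimately show ?thesis
    by (simp add: bij_betw_def)
qed

lemma bij_betw_rank: "finite V \<Longrightarrow> bij_betw (vertex_rank V) V {..<card V}"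
  using rank_mono[of V] rank_less[of V] by (intro bij_betw_of_strict_order) (auto simp: less_le)

text \<open>Exponents of the graph without arcs by rank: 0 at the bottom, then decreasing from W + n
  - 1 to W + 1.\<close>

definition free_exponent :: "nat \<Rightarrow> nat \<Rightarrow> nat \<Rightarrow> nat" where
  "free_exponent n W k = (if k = 0 then 0 else W + n - k)"

lemma exponent_no_arcs:
  assumes "finite V" "t \<in> V"
  shows "exponent V a b (\<lambda>_ _. False) t = free_exponent (card V) (total_weight V a b) (vertex_rank V t)"
  using card_above[OF assms] rank_0_iff[OF assms(1), of t]
  by (simp add: exponent_def free_exponent_def arcs_below_def)

context
  fixes V :: "nat set" and a b :: "nat \<Rightarrow> int" and v :: nat
  assumes finV: "finite V" and V0: "0 \<notin> V" and weights: "\<And>u. u \<in> V \<Longrightarrow> 0 \<le> a u + b u"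
    and v: "v \<in> V" "0 < a v + b v"
begin

text \<open>The full star of arcs out of \<open>v\<close> has the same effect as increasing \<open>b v\<close> by one.\<close>

lemma star_deformation:
  "i \<noteq> j \<Longrightarrow> deformation a (b(v := b v - 1)) (\<lambda>i _. i = v) i j = deformation a b (\<lambda>_ _. False) i j"
  by (auto simp: deformation_def arc_bound_def)

lemma star_valid: "valid_digraph V (\<lambda>i _. i = v)"
  by (auto simp: valid_digraph_def)

lemma star_weights: "u \<in> V \<Longrightarrow> 0 \<le> a u + (b(v := b v - 1)) u"
  using weights[of u] v by auto

lemma star_total_weight: "total_weight V a b = Suc (total_weight V a (b(v := b v - 1)))"
proof -
  have "(\<Sum>u\<in>V. a u + b u) = (\<Sum>u\<in>V. a u + (b(v := b v - 1)) u) + 1"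
    using finV v by (simp add: sum.remove[of V v])
  moreover have "0 \<le> (\<Sum>u\<in>V. a u + (b(v := b v - 1)) u)"
    using star_weights by (intro sum_nonneg)
  ultimately show ?thesis
    by (simp add: total_weight_def nat_add_distrib)
qed

abbreviation "rank \<equiv> vertex_rank V"

text \<open>A cyclic shift of the positive ranks up to that of v. The vertex v has arcs to all
  smaller vertices and, unless it is the smallest, gets the largest exponent; positive ranks below v
  move one place, and vertices above v regain through their arc from v the unit of weight that was
  traded.\<close>

definition star_rank :: "nat \<Rightarrow> nat" where
  "star_rank t = (if rank t = 0 then 0 else if t = v then 1 else if t < v then Suc (rank t) else rank t)"

lemma star_exponent:
  assumes t: "t \<in> V"
  shows "exponent V a (b(v := b v - 1)) (\<lambda>i _. i = v) t =
    free_exponent (card V) (total_weight V a b) (star_rank t)"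
proof (cases "rank t = 0")
  case True
  then show ?thesis
    using rank_0_iff[OF finV, of t] by (simp add: exponent_def free_exponent_def star_rank_def)
next
  case False
  have arcs: "arcs_below V (\<lambda>i _. i = v) t = (if t = v then rank t else if t < v then 0 else 1)"
  proof -
    have "(\<Sum>m | m \<in> V \<and> m < t. of_bool (m = v)) = (if v < t then 1 else (0::nat))"
      using finV v by (auto simp: of_bool_def)
    then show ?thesis
      by (auto simp: arcs_below_def vertex_rank_def sum.distrib)
  qed
  have "\<not> (\<forall>m\<in>V. t \<le> m)"
    using False unfolding rank_0_iff[OF finV] .
  then have e: "exponent V a (b(v := b v - 1)) (\<lambda>i _. i = v) t =
      total_weight V a (b(v := b v - 1)) + card {m \<in> V. t < m} + 1 + arcs_below V (\<lambda>i _. i = v) t"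
    unfolding exponent_def by (rule if_not_P)
  show ?thesis
    unfolding e arcs using False card_above[OF finV t] star_total_weight
    by (auto simp: free_exponent_def star_rank_def)
qed

lemma bij_betw_star_rank: "bij_betw star_rank V {..<card V}"
proof (rule bij_betw_of_strict_order[OF finV])
  have mono: "rank s < rank t" if "s \<in> V" "s < t" for s t
    using rank_mono[OF finV that] .
  show "star_rank t < card V" if t: "t \<in> V" for t
    using rank_less[OF finV t] rank_less[OF finV v(1)] mono[OF t, of v] by (auto simp: star_rank_def)
  show "star_rank s \<noteq> star_rank t" if "s \<in> V" "t \<in> V" "s < t" for s t
    using mono[OF that(1,3)] mono[OF that(1), of v] mono[OF v(1), of t] mono[OF v(1), of s] that(3)
    by (auto simp: star_rank_def)
qed

lemma graded_basis_of_star: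
  fixes \<theta> :: "nat \<Rightarrow> nat \<Rightarrow> 'k::field_char_0 mpoly"
  assumes "graded_basis V (deformation a (b(v := b v - 1)) (\<lambda>i _. i = v))
    (exponent V a (b(v := b v - 1)) (\<lambda>i _. i = v)) \<theta>"
  shows "\<exists>\<theta>' :: nat \<Rightarrow> nat \<Rightarrow> 'k mpoly.
    graded_basis V (deformation a b (\<lambda>_ _. False)) (exponent V a b (\<lambda>_ _. False)) \<theta>'"
proof -
  let ?g = "free_exponent (card V) (total_weight V a b)"
  have "graded_basis V (deformation a b (\<lambda>_ _. False)) (\<lambda>t. ?g (star_rank t)) \<theta>"
    by (rule iffD1[OF graded_basis_cong assms]) (simp_all add: star_deformation star_exponent)
  from graded_basis_permute[OF this bij_betw_star_rank bij_betw_rank[OF finV]]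
  obtain \<theta>' :: "nat \<Rightarrow> nat \<Rightarrow> 'k mpoly" where
    "graded_basis V (deformation a b (\<lambda>_ _. False)) (\<lambda>t. ?g (rank t)) \<theta>'"
    by blast
  then have "graded_basis V (deformation a b (\<lambda>_ _. False)) (exponent V a b (\<lambda>_ _. False)) \<theta>'"
    by (rule graded_basis_exponent_cong) (simp add: exponent_no_arcs[OF finV])
  then show ?thesis
    by blast
qed

end

text \<open>With a = - b on V each interval shrinks to the single constant b j - b i, and the
  exponents become a permutation of 0, ..., n - 1.\<close>

lemma graded_basis_no_arcs_weight_0:
  assumes "finite V" "0 \<notin> V" "\<And>v. v \<in> V \<Longrightarrow> a v + b v = 0"
  shows "\<exists>\<theta> :: nat \<Rightarrow> nat \<Rightarrow> 'k::field_char_0 mpoly.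
    graded_basis V (deformation a b (\<lambda>_ _. False)) (exponent V a b (\<lambda>_ _. False)) \<theta>"
proof -
  have W: "total_weight V a b = 0"
    using assms(3) by (simp add: total_weight_def)
  have C: "deformation a b (\<lambda>_ _. False) i j = {b j - b i}" if "i \<in> V" "j \<in> V" "i \<noteq> j" for i j
  proof -
    have "a i = - b i" "a j = - b j"
      using assms(3)[OF that(1)] assms(3)[OF that(2)] by auto
    then show ?thesis
      by (auto simp: deformation_def arc_bound_def)
  qed
  let ?g = "free_exponent (card V) 0"
  have "bij_betw (\<lambda>t. ?g (vertex_rank V t)) V {..<card V}"
  proof (rule bij_betw_of_strict_order[OF assms(1)])
    show "?g (vertex_rank V t) < card V" if "t \<in> V" for t
      using rank_less[OF assms(1) that] by (auto simp: free_exponent_def)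
    show "?g (vertex_rank V s) \<noteq> ?g (vertex_rank V t)" if "s \<in> V" "t \<in> V" "s < t" for s t
      using rank_less[OF assms(1) that(2)] rank_mono[OF assms(1) that(1,3)] by (auto simp: free_exponent_def)
  qed
  from braid_graded_basis[where b = b, OF assms(1,2) C this]
  obtain \<theta> :: "nat \<Rightarrow> nat \<Rightarrow> 'k mpoly" where
    "graded_basis V (deformation a b (\<lambda>_ _. False)) (\<lambda>t. ?g (vertex_rank V t)) \<theta>"
    by blast
  then have "graded_basis V (deformation a b (\<lambda>_ _. False)) (exponent V a b (\<lambda>_ _. False)) \<theta>"
    by (rule graded_basis_exponent_cong) (simp add: exponent_no_arcs[OF assms(1)] W)
  then show ?thesis
    by blast
qed

text \<open>Induction on the number of arcs. The hypothesis for proper subsets has to allow all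
  weights, because the restriction carries more weight than the arrangement it comes from.\<close>

lemma graded_basis_from_no_arcs:
  assumes V: "finite V" "0 \<notin> V" "\<And>v. v \<in> V \<Longrightarrow> 0 \<le> a v + b v"
    and smaller: "\<And>U a b E. U \<subset> V \<Longrightarrow> (\<And>v. v \<in> U \<Longrightarrow> 0 \<le> a v + b v) \<Longrightarrow> valid_digraph U E \<Longrightarrow>
      \<exists>\<theta> :: nat \<Rightarrow> nat \<Rightarrow> 'k::field_char_0 mpoly. graded_basis U (deformation a b E) (exponent U a b E) \<theta>"
    and none: "\<exists>\<theta> :: nat \<Rightarrow> nat \<Rightarrow> 'k mpoly.
      graded_basis V (deformation a b (\<lambda>_ _. False)) (exponent V a b (\<lambda>_ _. False)) \<theta>"
    and E: "valid_digraph V E"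
  shows "\<exists>\<theta> :: nat \<Rightarrow> nat \<Rightarrow> 'k mpoly. graded_basis V (deformation a b E) (exponent V a b E) \<theta>"
  using E
proof (induction "card {(i, j) \<in> V \<times> V. i \<noteq> j \<and> E i j}" arbitrary: E rule: less_induct)
  case less
  show ?case
  proof (cases "\<exists>i\<in>V. \<exists>j\<in>V. i \<noteq> j \<and> E i j")
    case False
    then have E: "\<not> E i j" if "i \<in> V" "j \<in> V" "i \<noteq> j" for i j
      using that by blast
    have "deformation a b E i j = deformation a b (\<lambda>_ _. False) i j" if "i \<in> V" "j \<in> V" "i \<noteq> j" for i j
      using E that by (simp add: deformation_def arc_bound_def)
    moreover have "exponent V a b E t = exponent V a b (\<lambda>_ _. False) t" if "t \<in> V" for t
      using E that by (simp add: exponent_def arcs_below_def)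
    ultimately have iff: "graded_basis V (deformation a b E) (exponent V a b E) \<theta> \<longleftrightarrow>
        graded_basis V (deformation a b (\<lambda>_ _. False)) (exponent V a b (\<lambda>_ _. False)) \<theta>"
      for \<theta> :: "nat \<Rightarrow> nat \<Rightarrow> 'k mpoly"
      by (rule graded_basis_cong)
    show ?thesis
      unfolding iff by (rule none)
  next
    case True
    then obtain p q where rem: "removable_arc V E p q"
      using exists_removable_arc[OF V(1) less.prems] by blast
    interpret arc_addition V a b E p q
      by (rule arc_addition.intro[OF V less.prems rem])
    have "{(i, j) \<in> V \<times> V. i \<noteq> j \<and> E' i j} \<subset> {(i, j) \<in> V \<times> V. i \<noteq> j \<and> E i j}"
      using pq by (auto simp: E'_def)
    then have "card {(i, j) \<in> V \<times> V. i \<noteq> j \<and> E' i j} < card {(i, j) \<in> V \<times> V. i \<noteq> j \<and> E i j}"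
      using V(1) by (intro psubset_card_mono) (auto intro: finite_subset[of _ "V \<times> V"])
    moreover have "valid_digraph V E'"
      by (rule valid_E')
    ultimately obtain \<theta> :: "nat \<Rightarrow> nat \<Rightarrow> 'k mpoly" where
      \<theta>: "graded_basis V (deformation a b E') (exponent V a b E') \<theta>"
      using less.hyps by blast
    obtain \<eta> :: "nat \<Rightarrow> nat \<Rightarrow> 'k mpoly" where
      \<eta>: "graded_basis (V - {h}) (deformation a2 b2 E2) (exponent (V - {h}) a2 b2 E2) \<eta>"
      using smaller[of "V - {h}" a2 b2 E2] weights2 valid_E2 hr by blast
    show ?thesis
      by (rule graded_basis_add_arc[OF \<theta> \<eta>])
  qed
qed

theorem deformation_graded_basis:
  assumes "finite V" "0 \<notin> V" "\<And>v. v \<in> V \<Longrightarrow> 0 \<le> a v + b v" "valid_digraph V E"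
  shows "\<exists>\<theta> :: nat \<Rightarrow> nat \<Rightarrow> 'k::field_char_0 mpoly. graded_basis V (deformation a b E) (exponent V a b E) \<theta>"
  using assms
proof (induction V arbitrary: a b E rule: finite_psubset_induct)
  case (psubset V)
  note outer = psubset.IH
  have smaller: "\<exists>\<theta> :: nat \<Rightarrow> nat \<Rightarrow> 'k mpoly. graded_basis U (deformation a b E) (exponent U a b E) \<theta>"
    if "U \<subset> V" "\<And>v. v \<in> U \<Longrightarrow> 0 \<le> a v + b v" "valid_digraph U E" for U a b E
    using outer[of U a b E] that psubset.prems(1) by blast
  show ?case
    using psubset.prems(2,3)
  \<comment> \<open>E is generalized here because lowering the weight turns the graph without arcs
    into a star.\<close>
  proof (induction "total_weight V a b" arbitrary: a b E rule: less_induct)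
    case (less a b E)
    show ?case
    proof (rule graded_basis_from_no_arcs[OF psubset.hyps psubset.prems(1) less.prems(1) smaller _ less.prems(2)])
      show "\<exists>\<theta> :: nat \<Rightarrow> nat \<Rightarrow> 'k mpoly.
          graded_basis V (deformation a b (\<lambda>_ _. False)) (exponent V a b (\<lambda>_ _. False)) \<theta>"
      proof (cases "\<exists>v\<in>V. 0 < a v + b v")
        case True
        then obtain v where v: "v \<in> V" "0 < a v + b v"
          by blast
        note star = psubset.hyps psubset.prems(1) less.prems(1) v
        have "\<exists>\<theta> :: nat \<Rightarrow> nat \<Rightarrow> 'k mpoly.
            graded_basis V (deformation a (b(v := b v - 1)) (\<lambda>i _. i = v))
              (exponent V a (b(v := b v - 1)) (\<lambda>i _. i = v)) \<theta>"
          using star_total_weight[where V = V and a = a and b = b and v = v, OF star] star_weights[where V = V and a = a and b = b and v = v, OF star] star_valid[where V = V and a = a and b = b and v = v, OF star]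
          by (intro less.hyps) auto
        then show ?thesis
          using graded_basis_of_star[where V = V and a = a and b = b and v = v, OF star] by blast
      next
        case False
        then have "a v + b v = 0" if "v \<in> V" for v
          using less.prems(1)[OF that] that by force
        then show ?thesis
          by (rule graded_basis_no_arcs_weight_0[OF psubset.hyps psubset.prems(1)])
      qed
    qed
  qed
qed

section \<open>The cone\<close>

text \<open>Points supported on i alone, or on i and one more index with value 1 there, determine
  all coefficients: the coordinate at i is solved from the equation of b.\<close>

lemma level_set_eq_imp_proportional:
  fixes a b :: "nat \<Rightarrow> 'k::field"
  assumes J: "finite J" and eq: "level_set J a c = level_set J b d" and b: "i \<in> J" "b i \<noteq> 0"
  shows "\<exists>s. (\<forall>m\<in>J. a m = s * b m) \<and> c = s * d"
proof -
  have lin: "lin_form J w (\<lambda>m. if m \<in> J then (if m = i then y else if m = j then 1 else 0) else undefined) =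
      w i * y + w j" if "j \<in> J" "j \<noteq> i" for w :: "nat \<Rightarrow> 'k" and y j
  proof -
    have "lin_form J w (\<lambda>m. if m \<in> J then (if m = i then y else if m = j then 1 else 0) else undefined) =
        (\<Sum>m\<in>J. (if m = i then w i * y else 0) + (if m = j then w j else 0))"
      unfolding lin_form_def using that by (intro sum.cong) auto
    also have "\<dots> = w i * y + w j"
      using J b that by (simp add: sum.distrib)
    finally show ?thesis .
  qed
  have lin0: "lin_form J w (\<lambda>m. if m \<in> J then (if m = i then y else 0) else undefined) = w i * y"
    for w :: "nat \<Rightarrow> 'k" and y
  proof -
    have "lin_form J w (\<lambda>m. if m \<in> J then (if m = i then y else 0) else undefined) =
        (\<Sum>m\<in>J. if m = i then w i * y else 0)"
      unfolding lin_form_def by (intro sum.cong) auto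
    then show ?thesis
      using J b by simp
  qed
  have mem: "lin_form J b x = d \<Longrightarrow> lin_form J a x = c" if "x \<in> coord_space J" for x
    using eq that unfolding level_set_def by blast
  have c: "a i * (d / b i) = c"
    using mem[of "\<lambda>m. if m \<in> J then (if m = i then d / b i else 0) else undefined"] b
    unfolding lin0 by (simp add: coord_space_def PiE_def extensional_def)
  have "a m = (a i / b i) * b m" if m: "m \<in> J" for m
  proof (cases "m = i")
    case True
    then show ?thesis
      using b by simp
  next
    case False
    have "a i * ((d - b m) / b i) + a m = c"
      using mem[of "\<lambda>n. if n \<in> J then (if n = i then (d - b m) / b i else if n = m then 1 else 0) else undefined"] b
      unfolding lin[OF m False] by (simp add: coord_space_def PiE_def extensional_def)
    then have "a i * ((d - b m) / b i) + a m = a i * (d / b i)"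
      using c by simp
    then show ?thesis
      using b by (simp add: field_simps)
  qed
  then show ?thesis
    using c by (intro exI[of _ "a i / b i"]) auto
qed

lemma const_poly_minus: "const_poly (- c) = - const_poly c"
  by (rule minus_unique[symmetric]) (simp flip: const_poly_add)

lemma lin_poly_proportional:
  "(\<And>m. m \<in> J \<Longrightarrow> a m = s * b m) \<Longrightarrow> lin_poly J a = const_poly s * lin_poly J b"
  unfolding lin_poly_def sum_distrib_left
  by (intro sum.cong) (simp_all add: mult.assoc flip: const_poly_mult)

text \<open>The same coefficients serve both spaces: over {1..n} the index 0 is outside the sum,
  over {0..n} it contributes the term of z.\<close>

definition diff_coeffs :: "nat \<Rightarrow> nat \<Rightarrow> 'k::field \<Rightarrow> nat \<Rightarrow> 'k" where
  "diff_coeffs i j c m = (if m = i then 1 else if m = j then - 1 else if m = 0 then - c else 0)"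

lemma sum_diff_coeffs:
  fixes f :: "nat \<Rightarrow> 'r::comm_ring_1" and \<iota> :: "'k::field \<Rightarrow> 'r"
  assumes "finite J" "i \<in> J" "j \<in> J" "i \<noteq> j" "i \<noteq> 0" "j \<noteq> 0" "\<iota> 0 = 0" "\<iota> 1 = 1" "\<iota> (- 1) = - 1"
  shows "(\<Sum>m\<in>J. \<iota> (diff_coeffs i j c m) * f m) = f i - f j + (if 0 \<in> J then \<iota> (- c) * f 0 else 0)"
proof -
  have "(\<Sum>m\<in>J. \<iota> (diff_coeffs i j c m) * f m) =
      (\<Sum>m\<in>J. ((if m = i then f i else 0) + (if m = j then - f j else 0)) + (if m = 0 then \<iota> (- c) * f 0 else 0))"
    using assms by (intro sum.cong) (auto simp: diff_coeffs_def)
  also have "\<dots> = f i - f j + (if 0 \<in> J then \<iota> (- c) * f 0 else 0)"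
    using assms by (simp add: sum.distrib)
  finally show ?thesis .
qed

definition form_at_infinity :: "nat \<Rightarrow> 'k::field" where
  "form_at_infinity m = (if m = 0 then 1 else 0)"

definition diff_hyperplane :: "nat \<Rightarrow> nat \<Rightarrow> nat \<Rightarrow> int \<Rightarrow> (nat \<Rightarrow> 'k::field) set" where
  "diff_hyperplane n i j c = {x \<in> coord_space {0..n}. x i - x j = of_int c * x 0}"

lemma diff_hyperplane_level_set:
  assumes "i \<in> {1..n}" "j \<in> {1..n}" "i \<noteq> j"
  shows "diff_hyperplane n i j c = level_set {0..n} (diff_coeffs i j (of_int c :: 'k::field)) 0"
    and "lin_poly {0..n} (diff_coeffs i j (of_int c :: 'k)) = diff_form i j c"
proof -
  have "lin_form {0..n} (diff_coeffs i j (of_int c :: 'k)) x = x i - x j - of_int c * x 0" for x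
    unfolding lin_form_def using assms by (subst sum_diff_coeffs[where \<iota> = "\<lambda>x. x"]) auto
  then show "diff_hyperplane n i j c = level_set {0..n} (diff_coeffs i j (of_int c :: 'k)) 0"
    by (simp add: diff_hyperplane_def level_set_def)
  show "lin_poly {0..n} (diff_coeffs i j (of_int c :: 'k)) = diff_form i j c"
    unfolding lin_poly_def using assms
    by (subst sum_diff_coeffs[where \<iota> = const_poly]) (auto simp: const_poly_minus diff_form_def const_poly_of_int)
qed

lemma affine_level_set:
  assumes "i \<in> {1..n}" "j \<in> {1..n}" "i \<noteq> j"
  shows "{x \<in> coord_space {1..n}. x i - x j = (d :: 'k::field)} = level_set {1..n} (diff_coeffs i j 0) d"
    and "lin_form {1..n} (diff_coeffs i j 0) x = x i - (x j :: 'k)"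
proof -
  show lin: "lin_form {1..n} (diff_coeffs i j 0) x = x i - (x j :: 'k)" for x
    unfolding lin_form_def using assms by (subst sum_diff_coeffs[where \<iota> = "\<lambda>x. x"]) auto
  then show "{x \<in> coord_space {1..n}. x i - x j = (d :: 'k)} = level_set {1..n} (diff_coeffs i j 0) d"
    by (simp add: level_set_def)
qed

lemma infinity_level_set:
  "{x \<in> coord_space {0..n}. x 0 = (0 :: 'k::field)} = level_set {0..n} form_at_infinity 0"
  "lin_poly {0..n} (form_at_infinity :: nat \<Rightarrow> 'k) = var_poly 0"
proof -
  have "lin_form {0..n} form_at_infinity x = (\<Sum>m\<in>{0..n}. if m = 0 then x 0 else (0 :: 'k))" for x
    unfolding lin_form_def by (intro sum.cong) (auto simp: form_at_infinity_def)
  then show "{x \<in> coord_space {0..n}. x 0 = (0 :: 'k)} = level_set {0..n} form_at_infinity 0"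
    by (simp add: level_set_def)
  have "lin_poly {0..n} (form_at_infinity :: nat \<Rightarrow> 'k) = (\<Sum>m\<in>{0..n}. if m = 0 then var_poly 0 else 0)"
    unfolding lin_poly_def by (intro sum.cong) (auto simp: form_at_infinity_def)
  then show "lin_poly {0..n} (form_at_infinity :: nat \<Rightarrow> 'k) = var_poly 0"
    by simp
qed

definition graph_deformation :: "nat \<Rightarrow> nat pair_pre_digraph \<Rightarrow> nat \<Rightarrow> nat \<Rightarrow> int set" where
  "graph_deformation k G = deformation (\<lambda>_. int k) (\<lambda>_. 0) (\<lambda>i j. (i, j) \<in> parcs G)"

lemma graph_deformation_eq:
  "graph_deformation k G i j =
    {- int k - arc_ind G i j} \<union> {- int k..int k} \<union> {int k + arc_ind G j i}"
  by (auto simp: graph_deformation_def deformation_def arc_bound_def arc_ind_def)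

text \<open>The cone ranges over all equations of an affine hyperplane; these are proportional, so
  they homogenize to the same hyperplane.\<close>

lemma cone_graph_arrangement:
  "cone_arrangement n (graph_arrangement n k G :: (nat \<Rightarrow> 'k::field) set set) =
    insert {x \<in> coord_space {0..n}. x 0 = 0}
      {diff_hyperplane n i j c | i j c. 1 \<le> i \<and> i < j \<and> j \<le> n \<and> c \<in> graph_deformation k G i j}"
    (is "?L = insert ?H ?R")
proof -
  let ?C = "{{x \<in> coord_space {0..n}. lin_form {1..n} a x = c * x 0} | a (c :: 'k).
    (\<exists>i\<in>{1..n}. a i \<noteq> 0) \<and> level_set {1..n} a c \<in> graph_arrangement n k G}"
  have "?C = ?R"
  proof (intro equalityI subsetI)
    fix K
    assume "K \<in> ?C"
    then obtain a c m where K: "K = {x \<in> coord_space {0..n}. lin_form {1..n} a x = c * x 0}"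
      "m \<in> {1..n}" "a m \<noteq> 0" "level_set {1..n} a c \<in> graph_arrangement n k G"
      by blast
    then obtain i j d where d: "level_set {1..n} a c = {x \<in> coord_space {1..n}. x i - x j = of_int d}"
      "1 \<le> i" "i < j" "j \<le> n" "d \<in> graph_deformation k G i j"
      unfolding graph_arrangement_def graph_deformation_eq by blast
    have ij: "i \<in> {1..n}" "j \<in> {1..n}" "i \<noteq> j"
      using d by auto
    have "level_set {1..n} a c = level_set {1..n} (diff_coeffs i j 0) (of_int d)"
      using d(1) affine_level_set(1)[OF ij] by blast
    then obtain s where s: "\<forall>m\<in>{1..n}. a m = s * diff_coeffs i j 0 m" "c = s * of_int d"
      using level_set_eq_imp_proportional[of "{1..n}" a c "diff_coeffs i j 0" "of_int d" i] ij(1)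
      by (auto simp: diff_coeffs_def)
    have s0: "s \<noteq> 0"
      using s(1) K(2,3) by auto
    have "lin_form {1..n} a x = s * lin_form {1..n} (diff_coeffs i j 0) x" for x
      unfolding lin_form_def sum_distrib_left using s(1) by (intro sum.cong) auto
    then have "lin_form {1..n} a x = c * x 0 \<longleftrightarrow> x i - x j = of_int d * x 0" for x
      unfolding affine_level_set(2)[OF ij] s(2) using s0 by (simp add: mult.assoc)
    then have "K = diff_hyperplane n i j d"
      unfolding K(1) diff_hyperplane_def by simp
    then show "K \<in> ?R"
      using d by blast
  next
    fix K
    assume "K \<in> ?R"
    then obtain i j d where K: "K = diff_hyperplane n i j d" and d:
      "1 \<le> i" "i < j" "j \<le> n" "d \<in> graph_deformation k G i j"
      by blast
    have ij: "i \<in> {1..n}" "j \<in> {1..n}" "i \<noteq> j"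
      using d by auto
    have "K = {x \<in> coord_space {0..n}. lin_form {1..n} (diff_coeffs i j 0) x = of_int d * x 0}"
      unfolding K diff_hyperplane_def affine_level_set(2)[OF ij] ..
    moreover have "\<exists>i'\<in>{1..n}. diff_coeffs i j (0 :: 'k) i' \<noteq> 0"
      using ij(1) by (intro bexI[of _ i]) (simp_all add: diff_coeffs_def)
    moreover have "level_set {1..n} (diff_coeffs i j 0) (of_int d :: 'k) \<in> graph_arrangement n k G"
      unfolding affine_level_set(1)[OF ij, symmetric] graph_arrangement_def
      using d unfolding graph_deformation_eq by blast
    ultimately show "K \<in> ?C"
      by blast
  qed
  then show ?thesis
    unfolding cone_arrangement_def by simp
qed

lemma central_cone_graph_arrangement:
  "central_arrangement {0..n} (cone_arrangement n (graph_arrangement n k G :: (nat \<Rightarrow> 'k::field) set set))"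
  unfolding central_arrangement_def cone_graph_arrangement
proof (intro conjI ballI)
  have "{diff_hyperplane n i j c | i j c. 1 \<le> i \<and> i < j \<and> j \<le> n \<and> c \<in> graph_deformation k G i j} \<subseteq>
      (\<lambda>(i, j, c). diff_hyperplane n i j c :: (nat \<Rightarrow> 'k) set) ` ({1..n} \<times> {1..n} \<times> {- int k - 1..int k + 1})"
    by (force simp: graph_deformation_eq arc_ind_def split: if_splits)
  then show "finite (insert {x \<in> coord_space {0..n}. x 0 = (0 :: 'k)}
      {diff_hyperplane n i j c | i j c. 1 \<le> i \<and> i < j \<and> j \<le> n \<and> c \<in> graph_deformation k G i j})"
    by (meson finite.insertI finite_SigmaI finite_atLeastAtMost finite_atLeastAtMost_int finite_imageI finite_subset)
  fix K
  assume "K \<in> insert {x \<in> coord_space {0..n}. x 0 = (0 :: 'k)}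
      {diff_hyperplane n i j c | i j c. 1 \<le> i \<and> i < j \<and> j \<le> n \<and> c \<in> graph_deformation k G i j}"
  then consider "K = {x \<in> coord_space {0..n}. x 0 = (0 :: 'k)}"
    | i j c where "K = diff_hyperplane n i j c" "1 \<le> i" "i < j" "j \<le> n"
    by blast
  then show "\<exists>a. (\<exists>i\<in>{0..n}. a i \<noteq> 0) \<and> K = level_set {0..n} a 0"
  proof cases
    case 1
    then show ?thesis
      unfolding infinity_level_set(1) by (intro exI conjI bexI[of _ 0]) (simp_all add: form_at_infinity_def)
  next
    case (2 i j c)
    then have "K = level_set {0..n} (diff_coeffs i j (of_int c)) 0"
      using diff_hyperplane_level_set(1)[of i n j c] by simp
    then show ?thesis
      using 2 by (intro exI conjI bexI[of _ i]) (simp_all add: diff_coeffs_def)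
  qed
qed

section \<open>Derivations of the polynomial ring\<close>

lemma derivationsD:
  assumes "\<theta> \<in> derivations I"
  shows "\<And>f. f \<in> mpoly_ring I \<Longrightarrow> \<theta> f \<in> mpoly_ring I" "\<And>f. f \<notin> mpoly_ring I \<Longrightarrow> \<theta> f = 0"
    "\<And>f g. f \<in> mpoly_ring I \<Longrightarrow> g \<in> mpoly_ring I \<Longrightarrow> \<theta> (f + g) = \<theta> f + \<theta> g"
    "\<And>c f. f \<in> mpoly_ring I \<Longrightarrow> \<theta> (const_poly c * f) = const_poly c * \<theta> f"
    "\<And>f g. f \<in> mpoly_ring I \<Longrightarrow> g \<in> mpoly_ring I \<Longrightarrow> \<theta> (f * g) = f * \<theta> g + g * \<theta> f"
  using assms unfolding derivations_def by blast+

lemma derivation_const: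
  assumes "\<theta> \<in> derivations I"
  shows "\<theta> (const_poly c) = 0"
proof -
  have "\<theta> (1 * 1) = 1 * \<theta> 1 + 1 * \<theta> 1"
    by (rule derivationsD(5)[OF assms]) simp_all
  then have "\<theta> 1 = \<theta> 1 + \<theta> 1"
    by (simp only: mult_1_left)
  then have "\<theta> 1 = 0"
    by (simp only: add_cancel_right_right)
  then show ?thesis
    using derivationsD(4)[OF assms mpoly_ring_1, of c] by simp
qed

lemma derivation_diff_form:
  assumes \<theta>: "\<theta> \<in> derivations I" and I: "i \<in> I" "j \<in> I" "0 \<in> I"
  shows "\<theta> (diff_form i j c) = \<theta> (var_poly i) - \<theta> (var_poly j) - of_int c * \<theta> (var_poly 0)"
proof -
  have eq: "diff_form i j c = var_poly i + (const_poly (- 1) * var_poly j + const_poly (of_int (- c)) * var_poly 0)"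
    unfolding diff_form_def const_poly_of_int by (simp add: const_poly_minus)
  have "\<theta> (diff_form i j c) = \<theta> (var_poly i) + (\<theta> (const_poly (- 1) * var_poly j) + \<theta> (const_poly (of_int (- c)) * var_poly 0))"
    unfolding eq using I by (simp add: derivationsD(3)[OF \<theta>] mpoly_ring_closed mpoly_ring_var)
  also have "\<dots> = \<theta> (var_poly i) + (const_poly (- 1) * \<theta> (var_poly j) + const_poly (of_int (- c)) * \<theta> (var_poly 0))"
    using I by (simp add: derivationsD(4)[OF \<theta>] mpoly_ring_var)
  finally show ?thesis
    unfolding const_poly_of_int by (simp add: const_poly_minus)
qed

lemma derivation_eq_combination:
  assumes \<theta>: "\<theta> \<in> derivations I" and \<beta>: "\<And>m. m \<in> T \<Longrightarrow> \<beta> m \<in> derivations I"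
    and vars: "\<And>i. i \<in> I \<Longrightarrow> \<theta> (var_poly i) = (\<Sum>m\<in>T. c m * \<beta> m (var_poly i))"
  shows "\<theta> p = (\<Sum>m\<in>T. c m * \<beta> m p)"
proof (cases "p \<in> mpoly_ring I")
  case False
  then show ?thesis
    using derivationsD(2)[OF \<theta>] derivationsD(2)[OF \<beta>] by simp
next
  case True
  then show ?thesis
  proof (induction rule: mpoly_ring_induct)
    case (const c)
    then show ?case
      using derivation_const[OF \<theta>] derivation_const[OF \<beta>] by simp
  next
    case (var i)
    then show ?case
      by (rule vars)
  next
    case (add p q)
    then show ?case
      using derivationsD(3)[OF \<beta>] by (simp add: derivationsD(3)[OF \<theta>] distrib_left sum.distrib)
  next
    case (mult p q)
    have "(\<Sum>m\<in>T. c m * \<beta> m (p * q)) = (\<Sum>m\<in>T. p * (c m * \<beta> m q) + q * (c m * \<beta> m p))"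
      using mult.hyps derivationsD(5)[OF \<beta>] by (intro sum.cong) (simp_all add: algebra_simps)
    then show ?case
      using mult by (simp add: derivationsD(5)[OF \<theta>] sum.distrib sum_distrib_left)
  qed
qed

text \<open>The derivation with prescribed values on the variables, read off from the ring homomorphism
  \<open>x i \<mapsto> x i + \<epsilon> g i\<close> into the polynomials in \<open>\<epsilon>\<close>.\<close>

interpretation dual: coefficient_hom "\<lambda>c. [:const_poly c:] :: 'k::field mpoly poly"
  by (rule coefficient_hom.intro) (simp_all add: const_poly_add flip: const_poly_mult)

definition dual_eval :: "(nat \<Rightarrow> 'k::field mpoly) \<Rightarrow> 'k mpoly \<Rightarrow> 'k mpoly poly" where
  "dual_eval g = eval_poly (\<lambda>c. [:const_poly c:]) (\<lambda>i. [:var_poly i, g i:])"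

lemma coeff_dual_eval_0: "coeff (dual_eval g p) 0 = p"
  using mpoly_ring_UNIV[of p]
  by (induction rule: mpoly_ring_induct) (simp_all add: dual_eval_def dual.eval_add dual.eval_mult coeff_mult)

definition vector_derivation :: "nat set \<Rightarrow> (nat \<Rightarrow> 'k::field mpoly) \<Rightarrow> 'k mpoly \<Rightarrow> 'k mpoly" where
  "vector_derivation I g p = (if p \<in> mpoly_ring I then coeff (dual_eval g p) 1 else 0)"

lemma coeff_dual_eval_mult:
  "coeff (dual_eval g (p * q)) 1 = p * coeff (dual_eval g q) 1 + q * coeff (dual_eval g p) 1"
  using coeff_dual_eval_0[of g p] coeff_dual_eval_0[of g q]
  by (simp add: dual_eval_def dual.eval_mult coeff_mult)

lemma vector_derivation_var: "i \<in> I \<Longrightarrow> vector_derivation I g (var_poly i) = g i"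
  by (simp add: vector_derivation_def dual_eval_def mpoly_ring_var)

lemma coeff_dual_eval_add:
  "coeff (dual_eval g (p + q)) 1 = coeff (dual_eval g p) 1 + coeff (dual_eval g q) 1"
  by (simp add: dual_eval_def dual.eval_add)

lemma vector_derivation_in_derivations:
  fixes g :: "nat \<Rightarrow> 'a::field mpoly"
  assumes "\<And>i. i \<in> I \<Longrightarrow> g i \<in> mpoly_ring I"
  shows "vector_derivation I g \<in> derivations I"
proof -
  have const0: "coeff (dual_eval g (const_poly c)) 1 = 0" for c
    by (simp add: dual_eval_def)
  have ring: "coeff (dual_eval g p) 1 \<in> mpoly_ring I" if "p \<in> mpoly_ring I" for p
    using that
  proof (induction rule: mpoly_ring_induct)
    case (const c)
    then show ?case
      unfolding const0 by (rule mpoly_ring_0)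
  next
    case (var i)
    then show ?case
      using assms by (simp add: dual_eval_def)
  next
    case (add p q)
    then show ?case
      unfolding coeff_dual_eval_add by (intro mpoly_ring_add)
  next
    case (mult p q)
    then show ?case
      unfolding coeff_dual_eval_mult by (intro mpoly_ring_add mpoly_ring_mult)
  qed
  show ?thesis
    unfolding derivations_def
  proof (intro CollectI conjI ballI allI impI)
    show "vector_derivation I g \<in> mpoly_ring I \<rightarrow> mpoly_ring I"
      using ring by (intro Pi_I) (simp add: vector_derivation_def)
    show "vector_derivation I g f = 0" if "f \<notin> mpoly_ring I" for f
      using that by (simp add: vector_derivation_def)
  next
    fix p q :: "'a mpoly"
    assume "p \<in> mpoly_ring I" "q \<in> mpoly_ring I"
    then show "vector_derivation I g (p + q) = vector_derivation I g p + vector_derivation I g q"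
      "vector_derivation I g (p * q) = p * vector_derivation I g q + q * vector_derivation I g p"
      by (simp_all only: vector_derivation_def mpoly_ring_add mpoly_ring_mult if_True
          coeff_dual_eval_add coeff_dual_eval_mult)
  next
    fix c and p :: "'a mpoly"
    assume "p \<in> mpoly_ring I"
    then show "vector_derivation I g (const_poly c * p) = const_poly c * vector_derivation I g p"
      by (simp only: vector_derivation_def mpoly_ring_mult mpoly_ring_const if_True
          coeff_dual_eval_mult const0 mult_zero_right add_0_right)
  qed
qed

text \<open>Equations of one hyperplane are proportional and derivations are linear, so one equation
  suffices. Divisibility in the big ring suffices too, since \<open>mpoly_ring_cancel\<close> places
  the quotient in the subring.\<close>

lemma log_derivations_cone_iff:
  assumes \<theta>: "\<theta> \<in> derivations {0..n}"
  shows "\<theta> \<in> log_derivations {0..n} (cone_arrangement n (graph_arrangement n k G :: (nat \<Rightarrow> 'k::field_char_0) set set)) \<longleftrightarrow>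
    var_poly 0 dvd \<theta> (var_poly 0) \<and>
    (\<forall>i j c. 1 \<le> i \<and> i < j \<and> j \<le> n \<and> c \<in> graph_deformation k G i j \<longrightarrow> diff_form i j c dvd \<theta> (diff_form i j c))"
proof -
  let ?I = "{0..n}"
  have cond: "(\<forall>a. level_set ?I b 0 = level_set ?I a 0 \<longrightarrow>
      (\<exists>g\<in>mpoly_ring ?I. \<theta> (lin_poly ?I a) = g * lin_poly ?I a)) \<longleftrightarrow> lin_poly ?I b dvd \<theta> (lin_poly ?I b)"
    if b: "i \<in> ?I" "b i \<noteq> 0" and nz: "lin_poly ?I b \<noteq> 0" for b :: "nat \<Rightarrow> 'k" and i
  proof
    assume "\<forall>a. level_set ?I b 0 = level_set ?I a 0 \<longrightarrow> (\<exists>g\<in>mpoly_ring ?I. \<theta> (lin_poly ?I a) = g * lin_poly ?I a)"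
    then obtain g where "\<theta> (lin_poly ?I b) = g * lin_poly ?I b"
      by blast
    then show "lin_poly ?I b dvd \<theta> (lin_poly ?I b)"
      by simp
  next
    assume dvd: "lin_poly ?I b dvd \<theta> (lin_poly ?I b)"
    have mem: "lin_poly ?I b \<in> mpoly_ring ?I"
      unfolding lin_poly_def by (intro mpoly_ring_closed mpoly_ring_const mpoly_ring_var)
    obtain g where g: "\<theta> (lin_poly ?I b) = g * lin_poly ?I b"
      using dvd by (metis dvd_def mult.commute)
    have gR: "g \<in> mpoly_ring ?I"
      by (rule mpoly_ring_cancel[OF derivationsD(1)[OF \<theta> mem] mem g nz])
    show "\<forall>a. level_set ?I b 0 = level_set ?I a 0 \<longrightarrow> (\<exists>g\<in>mpoly_ring ?I. \<theta> (lin_poly ?I a) = g * lin_poly ?I a)"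
    proof (intro allI impI)
      fix a
      assume "level_set ?I b 0 = level_set ?I a 0"
      then obtain s where "\<forall>m\<in>?I. a m = s * b m"
        using level_set_eq_imp_proportional[of ?I a 0 b 0 i] b by auto
      then have a: "lin_poly ?I a = const_poly s * lin_poly ?I b"
        by (intro lin_poly_proportional) blast
      have "\<theta> (lin_poly ?I a) = g * lin_poly ?I a"
        unfolding a derivationsD(4)[OF \<theta> mem] g by (rule mult.left_commute)
      then show "\<exists>g\<in>mpoly_ring ?I. \<theta> (lin_poly ?I a) = g * lin_poly ?I a"
        using gR by blast
    qed
  qed
  let ?P = "\<lambda>K. \<forall>a. K = level_set ?I a 0 \<longrightarrow> (\<exists>g\<in>mpoly_ring ?I. \<theta> (lin_poly ?I a) = g * lin_poly ?I a)"
  have infinity: "?P {x \<in> coord_space ?I. x 0 = 0} \<longleftrightarrow> var_poly 0 dvd \<theta> (var_poly 0)"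
    unfolding infinity_level_set(1)
    using cond[of 0 form_at_infinity] by (simp add: form_at_infinity_def infinity_level_set(2))
  have hyper: "?P (diff_hyperplane n i j c) \<longleftrightarrow> diff_form i j c dvd \<theta> (diff_form i j c)"
    if "1 \<le> i" "i < j" "j \<le> n" for i j c
  proof -
    have ij: "i \<in> {1..n}" "j \<in> {1..n}" "i \<noteq> j"
      using that by auto
    have nz: "diff_form i j c \<noteq> (0 :: 'k mpoly)"
      using ij by (intro diff_form_nonzero) auto
    show ?thesis
      unfolding diff_hyperplane_level_set(1)[OF ij]
      using cond[of i "diff_coeffs i j (of_int c)"] ij nz
      by (simp add: diff_coeffs_def[of _ _ _ i] diff_hyperplane_level_set(2)[OF ij])
  qed
  have "\<theta> \<in> log_derivations ?I (cone_arrangement n (graph_arrangement n k G :: (nat \<Rightarrow> 'k) set set)) \<longleftrightarrow>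
      ?P {x \<in> coord_space ?I. x 0 = 0} \<and>
      (\<forall>i j c. 1 \<le> i \<and> i < j \<and> j \<le> n \<and> c \<in> graph_deformation k G i j \<longrightarrow> ?P (diff_hyperplane n i j c))"
    unfolding log_derivations_def cone_graph_arrangement using \<theta> by blast
  also have "\<dots> \<longleftrightarrow> var_poly 0 dvd \<theta> (var_poly 0) \<and>
    (\<forall>i j c. 1 \<le> i \<and> i < j \<and> j \<le> n \<and> c \<in> graph_deformation k G i j \<longrightarrow> diff_form i j c dvd \<theta> (diff_form i j c))"
    by (intro conj_cong infinity iff_allI imp_cong refl hyper) simp_all
  finally show ?thesis .
qed

text \<open>Passes from an indexed basis to a basis as a set of functions. Independence makes the
  indexing injective: equal members would give a relation with coefficients 1 and - 1.\<close>

lemma free_module_onI: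
  fixes \<beta> :: "nat \<Rightarrow> 'r::comm_ring_1 \<Rightarrow> 'r"
  assumes I: "finite I" and R: "0 \<in> R" "1 \<in> R" "- 1 \<in> R"
    and mem: "\<And>m. m \<in> I \<Longrightarrow> \<beta> m \<in> M"
    and span: "\<And>\<theta>. \<theta> \<in> M \<Longrightarrow> \<exists>c. (\<forall>m\<in>I. c m \<in> R) \<and> (\<forall>p. \<theta> p = (\<Sum>m\<in>I. c m * \<beta> m p))"
    and indep: "\<And>c. (\<forall>p. (\<Sum>m\<in>I. c m * \<beta> m p) = 0) \<Longrightarrow> \<forall>m\<in>I. c m = 0"
  shows "free_module_on R (\<lambda>p \<theta> f. p * \<theta> f) M"
proof -
  have sum_apply: "sum F T x = (\<Sum>t\<in>T. F t x)" for F :: "'b \<Rightarrow> 'r \<Rightarrow> 'r" and T x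
    by (induction T rule: infinite_finite_induct) simp_all
  have inj: "inj_on \<beta> I"
  proof (rule inj_onI, rule ccontr)
    fix m m'
    assume m: "m \<in> I" "m' \<in> I" "\<beta> m = \<beta> m'" "m \<noteq> m'"
    let ?c = "\<lambda>k. (if k = m then 1 else 0) + (if k = m' then - 1 else (0 :: 'r))"
    have "(\<Sum>k\<in>I. ?c k * \<beta> k p) = (\<Sum>k\<in>I. (if k = m then \<beta> m p else 0) + (if k = m' then - \<beta> m' p else 0))" for p
      by (intro sum.cong) auto
    then have "\<forall>p. (\<Sum>k\<in>I. ?c k * \<beta> k p) = 0"
      using I m by (simp add: sum.distrib)
    from bspec[OF indep[OF this] m(1)] show False
      using m(4) by simp
  qed
  show ?thesis
    unfolding free_module_on_def
  proof (rule exI[of _ "\<beta> ` I"], intro conjI ballI allI impI)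
    show "\<beta> ` I \<subseteq> M"
      using mem by blast
    fix \<theta>
    assume "\<theta> \<in> M"
    then obtain c where c: "\<forall>m\<in>I. c m \<in> R" "\<forall>p. \<theta> p = (\<Sum>m\<in>I. c m * \<beta> m p)"
      using span by blast
    define d where "d b = c (inv_into I \<beta> b)" for b
    have d: "d (\<beta> m) = c m" if "m \<in> I" for m
      using inj that by (simp add: d_def)
    have "\<theta> p = (\<Sum>b\<in>\<beta> ` I. d b * b p)" for p
      using c(2) by (simp add: sum.reindex[OF inj] d)
    then have "\<theta> = (\<Sum>b\<in>\<beta> ` I. (\<lambda>f. d b * b f))"
      by (simp add: fun_eq_iff sum_apply)
    moreover have "d \<in> \<beta> ` I \<rightarrow> R"
      using c(1) d by auto
    ultimately show "\<exists>T c. finite T \<and> T \<subseteq> \<beta> ` I \<and> c \<in> T \<rightarrow> R \<and> \<theta> = (\<Sum>b\<in>T. (\<lambda>f. c b * b f))"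
      using I by blast
  next
    fix T c b
    assume *: "finite T \<and> T \<subseteq> \<beta> ` I \<and> c \<in> T \<rightarrow> R \<and> (\<Sum>b\<in>T. (\<lambda>f. c b * b f)) = 0" and b: "b \<in> T"
    define d where "d m = (if \<beta> m \<in> T then c (\<beta> m) else 0)" for m
    have "(\<Sum>m\<in>I. d m * \<beta> m p) = 0" for p
    proof -
      have "(\<Sum>m\<in>I. d m * \<beta> m p) = (\<Sum>b\<in>\<beta> ` I. (if b \<in> T then c b else 0) * b p)"
        by (simp add: sum.reindex[OF inj] d_def)
      also have "\<dots> = (\<Sum>b\<in>T. c b * b p)"
        using * I by (intro sum.mono_neutral_cong_right) auto
      also have "\<dots> = (\<Sum>b\<in>T. (\<lambda>f. c b * b f)) p"
        by (simp add: sum_apply)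
      finally show ?thesis
        using * by simp
    qed
    then have d0: "\<forall>m\<in>I. d m = 0"
      using indep by blast
    obtain m where m: "m \<in> I" "b = \<beta> m"
      using * b by blast
    then have "d m = c b"
      using b by (simp add: d_def)
    then show "c b = 0"
      using d0 m(1) by simp
  qed
qed

theorem theorem5p3:
  fixes l k :: nat and G :: "nat pair_pre_digraph"
  assumes "l \<ge> 1"
    and "pair_wf_digraph G" and "pverts G = {1..l + 1}"
    and A1: "\<And>i j h. \<lbrakk>i \<in> pverts G; j \<in> pverts G; h \<in> pverts G; i \<noteq> j; i < h; j < h;
               (i, j) \<in> parcs G\<rbrakk> \<Longrightarrow> (i, h) \<in> parcs G \<or> (h, j) \<in> parcs G"
    and A2: "\<And>i j h. \<lbrakk>i \<in> pverts G; j \<in> pverts G; h \<in> pverts G; i \<noteq> j; i < h; j < h;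
               (i, h) \<in> parcs G; (h, j) \<in> parcs G\<rbrakk> \<Longrightarrow> (i, j) \<in> parcs G"
  shows "free_arrangement {0..l + 1}
           (cone_arrangement (l + 1) (graph_arrangement (l + 1) k G) :: (nat \<Rightarrow> 'k::field_char_0) set set)"
proof -
  define n where "n = l + 1"
  let ?V = "{1..n}" and ?I = "{0..n}" and ?C = "graph_deformation k G"
  let ?R = "mpoly_ring ?I :: 'k mpoly set"
  have V: "?V = pverts G"
    by (simp add: n_def assms(3))
  have valid: "valid_digraph ?V (\<lambda>i j. (i, j) \<in> parcs G)"
    unfolding valid_digraph_def V
  proof (intro ballI impI)
    fix i j h
    assume "i \<in> pverts G" "j \<in> pverts G" "h \<in> pverts G" "i \<noteq> j \<and> i < h \<and> j < h"
    then show "((i, j) \<in> parcs G \<longrightarrow> (i, h) \<in> parcs G \<or> (h, j) \<in> parcs G) \<and>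
        ((i, h) \<in> parcs G \<and> (h, j) \<in> parcs G \<longrightarrow> (i, j) \<in> parcs G)"
      using A1[of i j h] A2[of i j h] by blast
  qed
  define e where "e = exponent ?V (\<lambda>_. int k) (\<lambda>_. 0) (\<lambda>i j. (i, j) \<in> parcs G)"
  have "\<exists>b :: nat \<Rightarrow> nat \<Rightarrow> 'k mpoly. graded_basis ?V ?C e b"
    unfolding graph_deformation_def e_def by (rule deformation_graded_basis[OF _ _ _ valid]) simp_all
  then obtain b :: "nat \<Rightarrow> nat \<Rightarrow> 'k mpoly" where b: "graded_basis ?V ?C e b"
    by (elim exE)
  have VI: "insert 0 ?V = ?I"
    by auto
  \<comment> \<open>Index 0 carries the Euler derivation; a vertex m carries its basis vector,
    extended by 0 on z.\<close>
  define \<beta> where "\<beta> m = vector_derivation ?I (\<lambda>v. if m = 0 then var_poly v else if v = 0 then 0 else b m v)" for m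
  have \<beta>_der: "\<beta> m \<in> derivations ?I" if "m \<in> ?I" for m
    unfolding \<beta>_def
  proof (rule vector_derivation_in_derivations)
    fix v
    assume v: "v \<in> ?I"
    show "(if m = 0 then var_poly v else if v = 0 then 0 else b m v) \<in> ?R"
      using graded_basisD(3)[OF b, of m v] that v unfolding VI by (auto intro: mpoly_ring_var)
  qed
  have \<beta>_var: "\<beta> m (var_poly v) = (if m = 0 then var_poly v else if v = 0 then 0 else b m v)" if "v \<in> ?I" for m v
    unfolding \<beta>_def by (rule vector_derivation_var[OF that])
  have sum_\<beta>: "(\<Sum>m\<in>?I. c m * \<beta> m (var_poly v)) =
      (if v = 0 then c 0 * var_poly 0 else c 0 * var_poly v + (\<Sum>m\<in>?V. c m * b m v))" if v: "v \<in> ?I" for c v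
  proof -
    have "(\<Sum>m\<in>?I. c m * \<beta> m (var_poly v)) = c 0 * \<beta> 0 (var_poly v) + (\<Sum>m\<in>?V. c m * \<beta> m (var_poly v))"
      unfolding VI[symmetric] by (rule sum.insert) auto
    moreover have "(\<Sum>m\<in>?V. c m * \<beta> m (var_poly v)) = (\<Sum>m\<in>?V. if v = 0 then 0 else c m * b m v)"
      using \<beta>_var[OF v] by (intro sum.cong) auto
    ultimately show ?thesis
      using \<beta>_var[OF v] by simp
  qed
  have free: "free_module_on ?R (\<lambda>p \<theta> f. p * \<theta> f)
      (log_derivations ?I (cone_arrangement n (graph_arrangement n k G)))"
  proof (rule free_module_onI[of ?I _ \<beta>])
    show "- 1 \<in> ?R"
      by (simp add: mpoly_ring_uminus)
  next
    fix m
    assume m: "m \<in> ?I"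
    have "var_poly 0 dvd \<beta> m (var_poly 0)"
      by (simp add: \<beta>_var)
    moreover have "diff_form i j c dvd \<beta> m (diff_form i j c)"
      if ij: "1 \<le> i" "i < j" "j \<le> n" and c: "c \<in> ?C i j" for i j c
    proof (cases "m = 0")
      case True
      have "\<beta> m (diff_form i j c) = diff_form i j c"
        using ij m True by (simp add: derivation_diff_form[OF \<beta>_der] \<beta>_var) (simp add: diff_form_def)
      then show ?thesis
        by simp
    next
      case False
      have "\<beta> m (diff_form i j c) = b m i - b m j"
        using ij m False by (simp add: derivation_diff_form[OF \<beta>_der] \<beta>_var)
      moreover have "diff_form i j c dvd b m i - b m j"
        using ij c m False by (intro diff_moduleD[OF graded_basisD(1)[OF b]]) auto
      ultimately show ?thesis
        by simp
    qed
    ultimately show "\<beta> m \<in> log_derivations ?I (cone_arrangement n (graph_arrangement n k G))"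
      by (subst log_derivations_cone_iff[OF \<beta>_der[OF m]]) blast
  next
    fix \<theta>
    assume mem: "\<theta> \<in> log_derivations ?I (cone_arrangement n (graph_arrangement n k G :: (nat \<Rightarrow> 'k) set set))"
    then have \<theta>: "\<theta> \<in> derivations ?I"
      by (simp add: log_derivations_def)
    have log: "diff_form i j c dvd \<theta> (diff_form i j c)"
      if "1 \<le> i" "i < j" "j \<le> n" "c \<in> ?C i j" for i j c
      using mem that log_derivations_cone_iff[OF \<theta>] by blast
    have z: "var_poly 0 dvd \<theta> (var_poly 0)"
      using mem log_derivations_cone_iff[OF \<theta>] by blast
    have varR: "var_poly v \<in> ?R" "\<theta> (var_poly v) \<in> ?R" if "v \<in> ?I" for v
      using that derivationsD(1)[OF \<theta>] mpoly_ring_var by blast+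
    obtain q where "\<theta> (var_poly 0) = var_poly 0 * q"
      using z by (elim dvdE)
    then have q: "\<theta> (var_poly 0) = q * var_poly 0"
      by (simp only: mult.commute)
    have qR: "q \<in> ?R"
      by (rule mpoly_ring_cancel[OF varR(2) varR(1) q]) auto
    \<comment> \<open>Subtracting q times the Euler derivation leaves a derivation that kills z. The
      Euler derivation fixes linear forms, so the divisibility conditions are kept.\<close>
    define f where "f v = \<theta> (var_poly v) - q * var_poly v" for v
    have f_dvd: "diff_form i j c dvd f i - f j" if ij: "1 \<le> i" "i < j" "j \<le> n" and c: "c \<in> ?C i j" for i j c
    proof -
      have "f i - f j = \<theta> (diff_form i j c) - q * diff_form i j c"
        using ij q by (simp add: derivation_diff_form[OF \<theta>] f_def) (simp add: diff_form_def algebra_simps)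
      then show ?thesis
        using log[OF ij c] by simp
    qed
    have "f \<in> diff_module ?V ?C"
    proof (rule diff_moduleI)
      fix i j c
      assume ij: "i \<in> ?V" "j \<in> ?V" "i \<noteq> j" "c \<in> ?C i j"
      show "diff_form i j c dvd f i - f j"
      proof (cases "i < j")
        case True
        then show ?thesis
          using f_dvd ij by simp
      next
        case False
        have "- c \<in> ?C j i"
          using ij(4) by (auto simp: graph_deformation_def deformation_def)
        then have "diff_form j i (- c) dvd f j - f i"
          using f_dvd[of j i "- c"] ij False by simp
        then have "diff_form i j c dvd - (f i - f j)"
          unfolding diff_form_minus by simp
        then show ?thesis
          by (simp only: dvd_minus_iff)
      qed
    qed
    then obtain c where c: "\<forall>v\<in>?V. f v = (\<Sum>u\<in>?V. c u * b u v)"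
      using graded_basisD(4)[OF b] by blast
    \<comment> \<open>The coefficients c may contain foreign variables. The retraction removes them
      and fixes both f and the basis.\<close>
    define d where "d m = (if m = 0 then q else restrict_vars ?I (c m))" for m
    have fd: "f v = (\<Sum>u\<in>?V. d u * b u v)" if v: "v \<in> ?V" for v
    proof -
      have "f v \<in> ?R"
        unfolding f_def using v varR qR by (intro mpoly_ring_diff mpoly_ring_mult) auto
      then have "f v = restrict_vars ?I (\<Sum>u\<in>?V. c u * b u v)"
        using c v restrict_vars_id by metis
      also have "\<dots> = (\<Sum>u\<in>?V. restrict_vars ?I (c u) * restrict_vars ?I (b u v))"
        by (simp add: restrict_vars_def poly_subst_hom)
      also have "\<dots> = (\<Sum>u\<in>?V. d u * b u v)"
      proof (intro sum.cong refl)
        fix u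
        assume u: "u \<in> ?V"
        have "restrict_vars ?I (b u v) = b u v"
          using graded_basisD(3)[OF b u v] unfolding VI by (rule restrict_vars_id)
        then show "restrict_vars ?I (c u) * restrict_vars ?I (b u v) = d u * b u v"
          using u by (simp add: d_def)
      qed
      finally show ?thesis .
    qed
    have "\<theta> p = (\<Sum>m\<in>?I. d m * \<beta> m p)" for p
    proof (rule derivation_eq_combination[where T = ?I and \<beta> = \<beta> and c = d, OF \<theta>])
      show "\<beta> m \<in> derivations ?I" if "m \<in> ?I" for m
        by (rule \<beta>_der[OF that])
      fix i
      assume i: "i \<in> ?I"
      show "\<theta> (var_poly i) = (\<Sum>m\<in>?I. d m * \<beta> m (var_poly i))"
      proof (cases "i = 0")
        case True
        then show ?thesis
          unfolding sum_\<beta>[OF i] by (simp add: d_def q)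
      next
        case False
        then have "i \<in> ?V"
          using i by simp
        have "\<theta> (var_poly i) = d 0 * var_poly i + f i"
          by (simp add: d_def f_def)
        then show ?thesis
          unfolding sum_\<beta>[OF i] fd[OF \<open>i \<in> ?V\<close>] using False by simp
      qed
    qed
    moreover have "\<forall>m\<in>?I. d m \<in> ?R"
      using qR restrict_vars_in_ring by (auto simp: d_def)
    ultimately show "\<exists>c. (\<forall>m\<in>?I. c m \<in> ?R) \<and> (\<forall>p. \<theta> p = (\<Sum>m\<in>?I. c m * \<beta> m p))"
      by blast
  next
    fix c :: "nat \<Rightarrow> 'k mpoly"
    assume c: "\<forall>p. (\<Sum>m\<in>?I. c m * \<beta> m p) = 0"
    have zero: "(\<Sum>m\<in>?I. c m * \<beta> m (var_poly v)) = 0" for v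
      using c by blast
    have c0: "c 0 = 0"
      using zero[of 0] sum_\<beta>[of 0 c] by simp
    have "(\<Sum>m\<in>?V. c m * b m v) = 0" if "v \<in> ?V" for v
      using zero[of v] sum_\<beta>[of v c] c0 that by simp
    then have "c m = 0" if "m \<in> ?V" for m
      using graded_basisD(5)[where c = c and u = m, OF b] that by blast
    then show "\<forall>m\<in>?I. c m = 0"
      using c0 unfolding VI[symmetric] by blast
  qed simp_all
  show ?thesis
    unfolding free_arrangement_def n_def[symmetric] by (rule conjI[OF central_cone_graph_arrangement free])
qed

end
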